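(* Let $n\ge 3$, let $L=-\Delta+V$ on $\mathbb{R}^n$ with $V\in RH_\sigma$ for some $\sigma\ge n/2$, and let $\sigma_0:=2-n/\sigma$. Let $1<\theta<\infty$ with conjugate exponent $\theta'$, and let $T\in GCZO^*_\rho(\gamma,\theta')$ for some $0<\gamma<\sigma_0$. Then: (a)$'$ $T$ is bounded on $BMO_L(\mathbb{R}^n)$ if and only if there is a constant $C$ such that $$\log\Big(\frac{\rho(x_B)}{r_B}\Big)\Big(\frac{1}{|B|}\int_B|T1(y)-(T1)_B|^{\theta}\,dy\Big)^{1/\theta}\le C$$ for every ball $B$ with $r_B\le \tfrac12\rho(x_B)$. (b)$'$ If $0<\alpha<\gamma$, then $T$ is bounded on $BMO_L^\alpha(\mathbb{R}^n)$ if and only if there is a constant $C$ such that $$\Big(\frac{\rho(x_B)}{r_B}\Big)^{\alpha}\Big(\frac{1}{|B|}\int_B|T1(y)-(T1)_B|^{\theta}\,dy\Big)^{1/\theta}\le C$$ for every ball $B$ with $r_B\le \tfrac12\rho(x_B)$. (c)$'$ If $0<\alpha<\gamma$, then $T$ is bounded from $BMO^\alpha(\mathbb{R}^n)$ into $BMO^\alpha_L(\mathbb{R}^n)$ if and only if $T1=0$.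
   Context: Notation. For a ball $B$, $x_B$ and $r_B$ are its centre and radius, and $\lambda B=B(x_B,\lambda r_B)$; $f_B=\frac1{|B|}\int_B f$. Reverse Hölder class. For $1<\sigma<\infty$, $V\in RH_\sigma$ means that $V\ge0$ is locally integrable and there is $C$ with $\big(\frac1{|B|}\int_B V^\sigma\big)^{1/\sigma}\le \frac{C}{|B|}\int_B V$ for every ball $B$; for $\sigma=\infty$ the left side is replaced by the essential supremum of $V$ over $B$ (and $n/\sigma:=0$). $V$ is not a.e. zero. Critical radius. $\rho(x)=\sup\{r>0: r^{2-n}\int_{B(x,r)}V(y)\,dy\le 1\}\in(0,\infty)$. Campanato spaces. For $\alpha\in[0,1)$, $BMO_L^\alpha$ is the space of $f\in L^1_{loc}(\mathbb{R}^n)$ for which there is $C>0$ with $\frac1{|B|^{1+\alpha/n}}\int_B|f-f_B|\le C$ for all balls $B$ and $\frac1{|B|^{1+\alpha/n}}\int_B|f|\le C$ for all balls $B$ with $r_B\ge\rho(x_B)$; the norm is the infimum of such $C$. $BMO_L=BMO_L^0$. The classical space $BMO^\alpha$ is defined by the first condition only, with the corresponding seminorm. Class $GCZO^*_\rho(\gamma,\theta')$. Let $0<\gamma\le1$, $1<\theta<\infty$. $T\in GCZO^*_\rho(\gamma,\theta')$ means that $T$ is a linear operator bounded on $L^{\theta'}(\mathbb{R}^n)$ with an associated kernel $K(x,y)$ (so $Tf(x)=\int K(x,y)f(y)\,dy$ for compactly supported $f\in L^{\theta'}$ and a.e. $x\notin\mathrm{supp}\, f$) satisfying: (i)$'$ for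 each $N>0$ there is $C_N>0$ such that $$\Big(\int_{R<|y-x_B|<2R}|K(x,y)|^{\theta'} dy\Big)^{1/\theta'}\le C_N R^{-n/\theta}\Big(\frac{\rho(x_B)}{R}\Big)^N$$ for all points $x_B$, all $x\in B(x_B,\rho(x_B))$ and all $R>2\rho(x_B)$; (ii)$'$ there is $C>0$ such that $$\Big(\int_{2^kr_B<|y-x_B|<2^{k+1}r_B}|K(x,y)-K(x_B,y)|^{\theta'} dy\Big)^{1/\theta'}\le C2^{-k\gamma}|2^kB|^{-1/\theta}$$ for all balls $B=B(x_B,r_B)$, all $x\in B$ and all $k\ge1$. Definition of $Tf$ for $f$ in these spaces, and of $T1$. For $x_0\in\mathbb{R}^n$ and $R>2\rho(x_0)$, define for a.e. $x\in B(x_0,\rho(x_0))$ $$Tf(x)=T(f\chi_{B(x_0,R)})(x)+\int_{B(x_0,R)^c}K(x,y)f(y)\,dy.$$ This is independent of the choice of $x_0$ and $R$ (a.e.), so it defines a function a.e. on $\mathbb{R}^n$; $T1$ is the case $f\equiv1$. *)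

theory Defs
  imports "HOL-Analysis.Analysis" "HOL-Probability.Essential_Supremum"
begin

text \<open>
  Euclidean n-space is a type \<open>'a :: euclidean_space\<close> with \<open>n = DIM('a)\<close>, measured by
  \<^const>\<open>lebesgue\<close>; functions and kernels are complex-valued, potentials real-valued.  Functions
  are not identified up to null sets, so equalities between elements of Lebesgue spaces are
  stated almost everywhere.

  The Bochner integral of a non-integrable function is \<open>0\<close>.  Wherever finiteness of an integral is
  part of the meaning of a condition, integrability is therefore required explicitly.
\<close>

subsection \<open>Averages and Lebesgue norms\<close>

definition vol_ball :: "'a::euclidean_space \<Rightarrow> real \<Rightarrow> real" where
  "vol_ball x r = measure lebesgue (ball x r)"

definition avg :: "('a::euclidean_space \<Rightarrow> 'b::{banach, second_countable_topology}) \<Rightarrow> 'a \<Rightarrow> real \<Rightarrow> 'b" where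
  "avg f x r = (1 / vol_ball x r) *\<^sub>R (LINT y:ball x r|lebesgue. f y)"

definition loc_integrable :: "('a::euclidean_space \<Rightarrow> 'b::{banach, second_countable_topology}) \<Rightarrow> bool" where
  "loc_integrable f \<longleftrightarrow> (\<forall>x r. set_integrable lebesgue (ball x r) f)"

definition in_Lp :: "real \<Rightarrow> 'a::euclidean_space set \<Rightarrow> ('a \<Rightarrow> complex) \<Rightarrow> bool" where
  "in_Lp p S f \<longleftrightarrow> set_borel_measurable lebesgue S f
     \<and> set_integrable lebesgue S (\<lambda>y. norm (f y) powr p)"

definition Lp_norm :: "real \<Rightarrow> 'a::euclidean_space set \<Rightarrow> ('a \<Rightarrow> complex) \<Rightarrow> real" where
  "Lp_norm p S f = (LINT y:S|lebesgue. norm (f y) powr p) powr (1 / p)"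

definition restr :: "'a::euclidean_space set \<Rightarrow> ('a \<Rightarrow> complex) \<Rightarrow> 'a \<Rightarrow> complex" where
  "restr S f = (\<lambda>y. indicator S y *\<^sub>R f y)"

text \<open>The support of a measurable function, insensitive to changes on null sets.\<close>

definition ess_supp :: "('a::euclidean_space \<Rightarrow> complex) \<Rightarrow> 'a set" where
  "ess_supp f = {x. \<forall>r>0. \<not> (AE y in lebesgue. y \<in> ball x r \<longrightarrow> f y = 0)}"

subsection \<open>Potential and critical radius\<close>

definition reverse_Holder :: "ereal \<Rightarrow> ('a::euclidean_space \<Rightarrow> real) \<Rightarrow> bool" where
  "reverse_Holder \<sigma> V \<longleftrightarrow>
     1 < \<sigma> \<and> (AE x in lebesgue. 0 \<le> V x) \<and> loc_integrable V \<and>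
     (\<exists>C. \<forall>x r. r > 0 \<longrightarrow>
        (if \<sigma> = \<infinity>
         then esssup (lebesgue_on (ball x r)) (\<lambda>y. ereal (V y)) \<le> ereal (C * avg V x r)
         else set_integrable lebesgue (ball x r) (\<lambda>y. V y powr real_of_ereal \<sigma>) \<and>
              avg (\<lambda>y. V y powr real_of_ereal \<sigma>) x r powr (1 / real_of_ereal \<sigma>) \<le> C * avg V x r))"

definition crit_radius :: "('a::euclidean_space \<Rightarrow> real) \<Rightarrow> 'a \<Rightarrow> real" where
  "crit_radius V x =
     Sup {r. r > 0 \<and> r powr (2 - real DIM('a)) * (LINT y:ball x r|lebesgue. V y) \<le> 1}"

subsection \<open>Campanato spaces\<close>

definition osc_bound :: "real \<Rightarrow> ('a::euclidean_space \<Rightarrow> complex) \<Rightarrow> real \<Rightarrow> bool" where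
  "osc_bound \<alpha> f C \<longleftrightarrow> (\<forall>x r. r > 0 \<longrightarrow>
     1 / vol_ball x r powr (1 + \<alpha> / real DIM('a))
       * (LINT y:ball x r|lebesgue. norm (f y - avg f x r)) \<le> C)"

definition size_bound :: "('a::euclidean_space \<Rightarrow> real) \<Rightarrow> real \<Rightarrow> ('a \<Rightarrow> complex) \<Rightarrow> real \<Rightarrow> bool" where
  "size_bound \<rho> \<alpha> f C \<longleftrightarrow> (\<forall>x r. r > 0 \<and> r \<ge> \<rho> x \<longrightarrow>
     1 / vol_ball x r powr (1 + \<alpha> / real DIM('a))
       * (LINT y:ball x r|lebesgue. norm (f y)) \<le> C)"

definition BMO :: "real \<Rightarrow> ('a::euclidean_space \<Rightarrow> complex) set" where
  "BMO \<alpha> = {f. loc_integrable f \<and> (\<exists>C>0. osc_bound \<alpha> f C)}"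

definition BMO_norm :: "real \<Rightarrow> ('a::euclidean_space \<Rightarrow> complex) \<Rightarrow> real" where
  "BMO_norm \<alpha> f = Inf {C. C > 0 \<and> osc_bound \<alpha> f C}"

definition BMO_L :: "('a::euclidean_space \<Rightarrow> real) \<Rightarrow> real \<Rightarrow> ('a \<Rightarrow> complex) set" where
  "BMO_L \<rho> \<alpha> = {f. loc_integrable f \<and> (\<exists>C>0. osc_bound \<alpha> f C \<and> size_bound \<rho> \<alpha> f C)}"

definition BMO_L_norm :: "('a::euclidean_space \<Rightarrow> real) \<Rightarrow> real \<Rightarrow> ('a \<Rightarrow> complex) \<Rightarrow> real" where
  "BMO_L_norm \<rho> \<alpha> f = Inf {C. C > 0 \<and> osc_bound \<alpha> f C \<and> size_bound \<rho> \<alpha> f C}"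

definition bounded_op ::
  "'f set \<Rightarrow> ('f \<Rightarrow> real) \<Rightarrow> 'g set \<Rightarrow> ('g \<Rightarrow> real) \<Rightarrow> ('f \<Rightarrow> 'g) \<Rightarrow> bool" where
  "bounded_op X NX Y NY T \<longleftrightarrow> (\<exists>C. \<forall>f\<in>X. T f \<in> Y \<and> NY (T f) \<le> C * NX f)"

subsection \<open>The operator class\<close>

text \<open>Only the values of \<open>T\<close> on the Lebesgue space are constrained.\<close>

definition Lp_operator :: "real \<Rightarrow> (('a::euclidean_space \<Rightarrow> complex) \<Rightarrow> 'a \<Rightarrow> complex) \<Rightarrow> bool" where
  "Lp_operator p T \<longleftrightarrow>
     bounded_op {f. in_Lp p UNIV f} (Lp_norm p UNIV) {f. in_Lp p UNIV f} (Lp_norm p UNIV) T \<and>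
     (\<forall>f g. in_Lp p UNIV f \<and> in_Lp p UNIV g \<longrightarrow>
        (AE x in lebesgue. T (\<lambda>y. f y + g y) x = T f x + T g x)) \<and>
     (\<forall>c f. in_Lp p UNIV f \<longrightarrow> (AE x in lebesgue. T (\<lambda>y. c * f y) x = c * T f x))"

definition assoc_kernel ::
  "real \<Rightarrow> (('a::euclidean_space \<Rightarrow> complex) \<Rightarrow> 'a \<Rightarrow> complex) \<Rightarrow> ('a \<Rightarrow> 'a \<Rightarrow> complex) \<Rightarrow> bool" where
  "assoc_kernel p T K \<longleftrightarrow> (\<forall>f. in_Lp p UNIV f \<and> compact (ess_supp f) \<longrightarrow>
     (AE x in lebesgue. x \<notin> ess_supp f \<longrightarrow>
        integrable lebesgue (\<lambda>y. K x y * f y) \<and> T f x = (LINT y|lebesgue. K x y * f y)))"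

definition annulus :: "'a::euclidean_space \<Rightarrow> real \<Rightarrow> real \<Rightarrow> 'a set" where
  "annulus x s t = {y. s < dist y x \<and> dist y x < t}"

text \<open>
  \<open>GCZO_star \<rho> \<gamma> p T K\<close>: the operator \<open>T\<close> belongs to the class with parameters
  \<open>(\<gamma>, p)\<close> and \<open>K\<close> is its kernel.  Here \<open>p\<close> plays the role of \<open>\<theta>'\<close>, and
  \<open>\<theta> = p / (p - 1)\<close> is its conjugate exponent.
\<close>

definition GCZO_star ::
  "('a::euclidean_space \<Rightarrow> real) \<Rightarrow> real \<Rightarrow> real \<Rightarrow>
   (('a \<Rightarrow> complex) \<Rightarrow> 'a \<Rightarrow> complex) \<Rightarrow> ('a \<Rightarrow> 'a \<Rightarrow> complex) \<Rightarrow> bool" where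
  "GCZO_star \<rho> \<gamma> p T K \<longleftrightarrow> (let \<theta> = p / (p - 1) in
     0 < \<gamma> \<and> \<gamma> \<le> 1 \<and> 1 < p \<and>
     Lp_operator p T \<and> assoc_kernel p T K \<and>
     (\<forall>N::real. N > 0 \<longrightarrow> (\<exists>C>0. \<forall>xB. \<forall>x\<in>ball xB (\<rho> xB). \<forall>R. R > 2 * \<rho> xB \<longrightarrow>
        in_Lp p (annulus xB R (2 * R)) (K x) \<and>
        Lp_norm p (annulus xB R (2 * R)) (K x)
          \<le> C * R powr (- real DIM('a) / \<theta>) * (\<rho> xB / R) powr N)) \<and>
     (\<exists>C>0. \<forall>xB r. r > 0 \<longrightarrow> (\<forall>x\<in>ball xB r. \<forall>k::nat. k \<ge> 1 \<longrightarrow>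
        in_Lp p (annulus xB (2 ^ k * r) (2 ^ (k + 1) * r)) (\<lambda>y. K x y - K xB y) \<and>
        Lp_norm p (annulus xB (2 ^ k * r) (2 ^ (k + 1) * r)) (\<lambda>y. K x y - K xB y)
          \<le> C * 2 powr (- real k * \<gamma>) * vol_ball xB (2 ^ k * r) powr (- 1 / \<theta>))))"

subsection \<open>The extended operator\<close>

definition is_extension ::
  "('a::euclidean_space \<Rightarrow> real) \<Rightarrow> (('a \<Rightarrow> complex) \<Rightarrow> 'a \<Rightarrow> complex) \<Rightarrow> ('a \<Rightarrow> 'a \<Rightarrow> complex) \<Rightarrow>
   ('a \<Rightarrow> complex) \<Rightarrow> ('a \<Rightarrow> complex) \<Rightarrow> bool" where
  "is_extension \<rho> T K f g \<longleftrightarrow> (\<forall>x0 R. R > 2 * \<rho> x0 \<longrightarrow>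
     (AE x in lebesgue. x \<in> ball x0 (\<rho> x0) \<longrightarrow>
        set_integrable lebesgue (- ball x0 R) (\<lambda>y. K x y * f y) \<and>
        g x = T (restr (ball x0 R) f) x + (LINT y:- ball x0 R|lebesgue. K x y * f y)))"

text \<open>
  Any two functions satisfying \<^const>\<open>is_extension\<close> for the same \<open>f\<close> agree almost everywhere
  when \<open>\<rho> > 0\<close>, since countably many of the balls \<open>ball x (\<rho> x)\<close> cover the space.
  The choice below thus picks a representative of a well-defined class.
\<close>

definition ext_op ::
  "('a::euclidean_space \<Rightarrow> real) \<Rightarrow> (('a \<Rightarrow> complex) \<Rightarrow> 'a \<Rightarrow> complex) \<Rightarrow> ('a \<Rightarrow> 'a \<Rightarrow> complex) \<Rightarrow>
   ('a \<Rightarrow> complex) \<Rightarrow> 'a \<Rightarrow> complex" where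
  "ext_op \<rho> T K f = (SOME g. is_extension \<rho> T K f g)"

text \<open>
  The condition \<open>w (\<rho> x / r) * (1 / |B| * \<integral>\<^sub>B |g - g\<^sub>B| powr \<theta>) powr (1 / \<theta>) \<le> C\<close> for
  all balls \<open>B = ball x r\<close> with \<open>r \<le> \<rho> x / 2\<close>; the weight \<open>w\<close> will be a logarithm or a power,
  hence positive on the relevant range, so that the bound includes finiteness of the integral.
\<close>

definition weighted_osc_cond ::
  "('a::euclidean_space \<Rightarrow> real) \<Rightarrow> (real \<Rightarrow> real) \<Rightarrow> real \<Rightarrow> ('a \<Rightarrow> complex) \<Rightarrow> bool" where
  "weighted_osc_cond \<rho> w \<theta> g \<longleftrightarrow> (\<exists>C. \<forall>x r. 0 < r \<and> r \<le> \<rho> x / 2 \<longrightarrow>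
     in_Lp \<theta> (ball x r) (\<lambda>y. g y - avg g x r) \<and>
     w (\<rho> x / r) * avg (\<lambda>y. norm (g y - avg g x r) powr \<theta>) x r powr (1 / \<theta>) \<le> C)"

end

theory Submission
  imports Defs "HOL-Real_Asymp.Real_Asymp"
begin

text \<open>
  Write \<open>p\<close> for \<open>\<theta>'\<close>, \<open>f\<^sub>B\<close> for the mean of \<open>f\<close> over a ball \<open>B\<close>, and \<open>2B\<close> for the ball with the same
  centre and twice the radius.  Everything rests on the splitting
  \<open>T f = T ((f - f\<^sub>B) 1\<^bsub>2B\<^esub>) + T ((f - f\<^sub>B) (1 - 1\<^bsub>2B\<^esub>)) + f\<^sub>B T1\<close> on \<open>B\<close>.

  The first two terms are harmless whatever \<open>T1\<close> is.  By the John--Nirenberg inequality a function of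
  \<open>BMO\<^sup>\<alpha>\<close> has oscillation of order \<open>r\<^sup>\<alpha>\<close> not only in the mean but in every \<open>L\<^sup>q\<close>, so the first term is
  controlled by the boundedness of \<open>T\<close> on \<open>L\<^sup>p\<close>.  The second term varies on \<open>B\<close> by at most an integral of
  \<open>|K(x,y) - K(x',y)| |f(y) - f\<^sub>B|\<close>; on the \<open>k\<close>-th dyadic annulus Hoelder's inequality gives
  \<open>2\<^bsup>-k\<gamma>\<^esup> (k + 1) 2\<^bsup>k\<alpha>\<^esup> r\<^sup>\<alpha>\<close>, and this is summable because \<open>\<alpha> < \<gamma>\<close> (\<open>local_oscillation\<close>).
  What remains is \<open>f\<^sub>B T1\<close>.

  For \<open>f\<close> in \<open>BMO\<^sub>L\<^sup>\<alpha>\<close> the mean over a ball of radius \<open>r\<close> below the critical radius \<open>\<rho>\<close> is at most of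
  order \<open>r\<^sup>\<alpha> w(\<rho>/r)\<close>: the dyadic dilates of the ball form a chain that ends at a ball of critical size, where the
  size condition applies.  The number \<open>w(\<rho>/r)\<close> is the sum of \<open>2\<^bsup>j\<alpha>\<^esup>\<close> over the links of this
  chain, which is comparable to \<open>log (\<rho>/r)\<close> for \<open>\<alpha> = 0\<close> and to \<open>(\<rho>/r)\<^sup>\<alpha>\<close> for \<open>\<alpha> > 0\<close>
  (\<open>dyadic_weight\<close>).  So the weighted oscillation condition on \<open>T1\<close> says that \<open>f\<^sub>B T1\<close> oscillates
  by \<open>O(r\<^sup>\<alpha>)\<close>, and the first two parts of the theorem are two instances of one
  equivalence (\<open>bounded_BMO_L_iff\<close>).  The condition is sufficient once the size of \<open>T f\<close> on critical balls is bounded,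
  which follows from the rapid decay of the kernel (\<open>critical_ball_size\<close>); larger balls are covered by
  critical ones (\<open>size_from_critical\<close>).  It is necessary because the growth of the means is
  attained: a sum of bumps over the scales between \<open>2r\<close> and \<open>\<rho>\<close> has bounded norm and is constant on \<open>2B\<close>,
  with a value comparable to \<open>r\<^sup>\<alpha> w(\<rho>/r)\<close> (\<open>bump_sum_bounds\<close>, \<open>weighted_cond_of_bounded\<close>).

  On \<open>BMO\<^sup>\<alpha>\<close> the constants have seminorm zero, so boundedness forces \<open>T1 = 0\<close>.  If \<open>T1 = 0\<close>, then
  \<open>T f = T (f - c)\<close> for every constant \<open>c\<close>, and the same estimates apply
  with \<open>f - f\<^sub>B\<close> in place of \<open>f\<close> also on critical balls (\<open>bounded_BMO_BMO_L_iff\<close>).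

  The potential enters only through \<open>\<rho>\<close>, which is positive and varies slowly: \<open>\<rho> y \<ge> c \<rho> x\<close> if
  \<open>|x - y| \<le> A \<rho> x\<close>, with \<open>c\<close> depending on \<open>A\<close> alone.  Both facts come from a power-law bound, valid for
  reverse Hoelder weights, on the mass of \<open>V\<close> on subsets of a ball.
\<close>

section \<open>Balls and averages\<close>

lemma vol_ball_eq:
  fixes x :: "'a::euclidean_space"
  assumes "r \<ge> 0" shows "vol_ball x r = unit_ball_vol (DIM('a)) * r ^ DIM('a)"
  using content_ball[OF assms, of x] by (simp add: vol_ball_def)

lemma vol_ball_pos: "r > 0 \<Longrightarrow> vol_ball x r > 0"
  by (simp add: vol_ball_eq)

lemma vol_ball_nonneg [simp]: "vol_ball x r \<ge> 0"
  by (simp add: vol_ball_def)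

lemma vol_ball_scale:
  fixes x y :: "'a::euclidean_space"
  assumes "r \<ge> 0" "c \<ge> 0" shows "vol_ball x (c * r) = c ^ DIM('a) * vol_ball y r"
  using assms by (simp add: vol_ball_eq power_mult_distrib mult_ac)

lemma vol_ball_le_scale:
  fixes x y :: "'a::euclidean_space"
  assumes "0 \<le> s" "0 \<le> r" "s \<le> c * r" shows "vol_ball x s \<le> c ^ DIM('a) * vol_ball y r"
proof -
  have "s ^ DIM('a) \<le> (c * r) ^ DIM('a)" using assms by (intro power_mono) auto
  hence "unit_ball_vol (DIM('a)) * s ^ DIM('a) \<le> unit_ball_vol (DIM('a)) * (c ^ DIM('a) * r ^ DIM('a))"
    by (intro mult_left_mono) (auto simp: power_mult_distrib)
  thus ?thesis using assms by (simp add: vol_ball_eq mult_ac)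
qed

lemma vol_ball_mono:
  fixes x y :: "'a::euclidean_space"
  shows "0 \<le> s \<Longrightarrow> s \<le> r \<Longrightarrow> vol_ball x s \<le> vol_ball y r"
  using vol_ball_le_scale[of s r 1 x y] by simp

lemma emeasure_ball_finite: "emeasure lebesgue (ball x r) < \<infinity>"
  using lmeasurable_ball[of x r] by (metis fmeasurableD2 infinity_ennreal_def less_top)

lemma borel_measurable_norm_powr:
  fixes f :: "'c \<Rightarrow> 'b::{real_normed_vector, second_countable_topology}"
  shows "f \<in> borel_measurable M \<Longrightarrow> (\<lambda>x. norm (f x) powr q) \<in> borel_measurable M"
  by simp

lemma set_integrable_const_ball [simp]:
  "set_integrable lebesgue (ball x r) (\<lambda>_. c :: 'b::{banach, second_countable_topology})"
  unfolding set_integrable_def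
  by (intro integrable_scaleR_left integrable_real_indicator emeasure_ball_finite) simp

lemma set_integral_const_ball:
  "(LINT y:ball x r|lebesgue. (c :: 'b::{banach, second_countable_topology})) = vol_ball x r *\<^sub>R c"
proof -
  have "integrable lebesgue (indicat_real (ball x r))"
    by (intro integrable_real_indicator emeasure_ball_finite) simp
  hence "(LINT y|lebesgue. indicator (ball x r) y *\<^sub>R c) = (LINT y|lebesgue. indicat_real (ball x r) y) *\<^sub>R c"
    by (intro integral_scaleR_left) auto
  thus ?thesis by (simp add: set_lebesgue_integral_def vol_ball_def)
qed

lemma set_integral_norm_le:
  fixes f :: "'c \<Rightarrow> 'b::{banach, second_countable_topology}"
  assumes "set_integrable M A f"
  shows "norm (LINT x:A|M. f x) \<le> (LINT x:A|M. norm (f x))"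
proof -
  have "norm (LINT x:A|M. f x) \<le> (LINT x|M. norm (indicator A x *\<^sub>R f x))"
    unfolding set_lebesgue_integral_def by (rule integral_norm_bound)
  also have "\<dots> = (LINT x:A|M. norm (f x))"
    unfolding set_lebesgue_integral_def
    by (intro Bochner_Integration.integral_cong) (auto simp: indicator_def)
  finally show ?thesis .
qed

lemma set_integral_nonneg: "(\<And>x. x \<in> A \<Longrightarrow> f x \<ge> 0) \<Longrightarrow> (LINT x:A|M. (f x :: real)) \<ge> 0"
  unfolding set_lebesgue_integral_def
  by (intro Bochner_Integration.integral_nonneg) (auto simp: indicator_def)

lemma set_integral_mono_set_nonneg:
  fixes f :: "'c \<Rightarrow> real"
  assumes "set_integrable M B f" "A \<in> sets M" "A \<subseteq> B" "\<And>x. x \<in> B \<Longrightarrow> f x \<ge> 0"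
  shows "(LINT x:A|M. f x) \<le> (LINT x:B|M. f x)"
  unfolding set_lebesgue_integral_def
proof (rule integral_mono)
  show "integrable M (\<lambda>x. indicator A x *\<^sub>R f x)"
    using set_integrable_subset[OF assms(1-3)] by (simp add: set_integrable_def)
  show "integrable M (\<lambda>x. indicator B x *\<^sub>R f x)"
    using assms(1) by (simp add: set_integrable_def)
  show "indicator A x *\<^sub>R f x \<le> indicator B x *\<^sub>R f x" for x
    using assms(3,4) by (auto simp: indicator_def)
qed

lemma avg_dist_le:
  fixes f :: "'a::euclidean_space \<Rightarrow> 'b::{banach, second_countable_topology}"
  assumes "set_integrable lebesgue (ball x r) f" "r > 0"
  shows "norm (avg f x r - c) * vol_ball x r \<le> (LINT y:ball x r|lebesgue. norm (f y - c))"
proof -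
  have v: "vol_ball x r > 0" using assms by (simp add: vol_ball_pos)
  have "(LINT y:ball x r|lebesgue. f y - c) = (LINT y:ball x r|lebesgue. f y) - vol_ball x r *\<^sub>R c"
    using assms by (subst set_integral_diff) (auto simp: set_integral_const_ball)
  also have "\<dots> = vol_ball x r *\<^sub>R (avg f x r - c)"
    using v by (simp add: avg_def scaleR_diff_right)
  finally have "norm (LINT y:ball x r|lebesgue. f y - c) = norm (avg f x r - c) * vol_ball x r"
    using v by simp
  thus ?thesis using set_integral_norm_le[of lebesgue "ball x r" "\<lambda>y. f y - c"] assms by auto
qed

lemma osc_le_twice:
  fixes f :: "'a::euclidean_space \<Rightarrow> 'b::{banach, second_countable_topology}"
  assumes f: "set_integrable lebesgue (ball x r) f" and r: "r > 0"
  shows "(LINT y:ball x r|lebesgue. norm (f y - avg f x r)) \<le> 2 * (LINT y:ball x r|lebesgue. norm (f y - c))"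
proof -
  have i: "set_integrable lebesgue (ball x r) (\<lambda>y. norm (f y - d))" for d
    using f by (intro set_integrable_norm set_integral_diff) auto
  have "(LINT y:ball x r|lebesgue. norm (f y - avg f x r))
     \<le> (LINT y:ball x r|lebesgue. norm (f y - c) + norm (avg f x r - c))"
    using norm_triangle_ineq4[of "f _ - c" "avg f x r - c"]
    by (intro set_integral_mono i set_integral_add set_integrable_const_ball) auto
  also have "\<dots> = (LINT y:ball x r|lebesgue. norm (f y - c)) + norm (avg f x r - c) * vol_ball x r"
    using i by (subst set_integral_add) (auto simp: set_integral_const_ball)
  finally show ?thesis using avg_dist_le[OF f r, of c] by simp
qed

section \<open>Hoelder's inequality and power means\<close>

lemma Holder_inequality_integral:
  fixes f g :: "'c \<Rightarrow> real"
  assumes pq: "p > 1" "q > 1" "1/p + 1/q = 1"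
    and [measurable]: "f \<in> borel_measurable M" "g \<in> borel_measurable M"
    and f: "integrable M (\<lambda>x. \<bar>f x\<bar> powr p)" and g: "integrable M (\<lambda>x. \<bar>g x\<bar> powr q)"
  shows "integrable M (\<lambda>x. f x * g x)"
    and "(LINT x|M. \<bar>f x * g x\<bar>)
      \<le> (LINT x|M. \<bar>f x\<bar> powr p) powr (1/p) * (LINT x|M. \<bar>g x\<bar> powr q) powr (1/q)"
proof -
  have Y: "\<bar>f x * g x\<bar> \<le> \<bar>f x\<bar> powr p / p + \<bar>g x\<bar> powr q / q" for x
    using Youngs_inequality[of p q "\<bar>f x\<bar>" "\<bar>g x\<bar>"] pq by (simp add: abs_mult)
  show I: "integrable M (\<lambda>x. f x * g x)"
    by (rule Bochner_Integration.integrable_bound[where f="\<lambda>x. \<bar>f x\<bar> powr p / p + \<bar>g x\<bar> powr q / q"])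
       (use Y f g pq in \<open>auto intro!: Bochner_Integration.integrable_add\<close>)
  define a where "a = (LINT x|M. \<bar>f x\<bar> powr p)"
  define b where "b = (LINT x|M. \<bar>g x\<bar> powr q)"
  have ab: "a \<ge> 0" "b \<ge> 0" by (auto simp: a_def b_def)
  show "(LINT x|M. \<bar>f x * g x\<bar>) \<le> (LINT x|M. \<bar>f x\<bar> powr p) powr (1/p) * (LINT x|M. \<bar>g x\<bar> powr q) powr (1/q)"
  proof (cases "a = 0 \<or> b = 0")
    case True
    have "AE x in M. f x * g x = 0"
      using True
    proof
      assume "a = 0"
      hence "AE x in M. \<bar>f x\<bar> powr p = 0" unfolding a_def using f
        by (subst (asm) integral_nonneg_eq_0_iff_AE) auto
      thus ?thesis by eventually_elim auto
    next
      assume "b = 0"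
      hence "AE x in M. \<bar>g x\<bar> powr q = 0" unfolding b_def using g
        by (subst (asm) integral_nonneg_eq_0_iff_AE) auto
      thus ?thesis by eventually_elim auto
    qed
    hence "AE x in M. \<bar>f x * g x\<bar> = 0" by eventually_elim auto
    hence "(LINT x|M. \<bar>f x * g x\<bar>) = 0" by (rule integral_eq_zero_AE)
    thus ?thesis by simp
  next
    case False
    hence ab: "a > 0" "b > 0" using ab by auto
    define s where "s = a powr (1/p)"
    define t where "t = b powr (1/q)"
    have st: "s > 0" "t > 0" using ab by (auto simp: s_def t_def)
    have sp: "s powr p = a" "t powr q = b" using ab pq by (auto simp: s_def t_def powr_powr)
    have *: "\<bar>f x * g x\<bar> \<le> s * t * (\<bar>f x\<bar> powr p / a / p + \<bar>g x\<bar> powr q / b / q)" for x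
    proof -
      have "\<bar>f x\<bar>/s * (\<bar>g x\<bar>/t) \<le> (\<bar>f x\<bar>/s) powr p / p + (\<bar>g x\<bar>/t) powr q / q"
        using Youngs_inequality[of p q "\<bar>f x\<bar>/s" "\<bar>g x\<bar>/t"] pq st by simp
      also have "\<dots> = \<bar>f x\<bar> powr p / a / p + \<bar>g x\<bar> powr q / b / q"
        using st sp by (simp add: powr_divide)
      finally have "s * t * (\<bar>f x\<bar>/s * (\<bar>g x\<bar>/t)) \<le> s * t * (\<bar>f x\<bar> powr p / a / p + \<bar>g x\<bar> powr q / b / q)"
        using st by (intro mult_left_mono) auto
      thus ?thesis using st by (simp add: abs_mult)
    qed
    have "(LINT x|M. \<bar>f x * g x\<bar>) \<le> (LINT x|M. s * t * (\<bar>f x\<bar> powr p / a / p + \<bar>g x\<bar> powr q / b / q))"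
      using I f g * by (intro integral_mono) auto
    also have "\<dots> = s * t * ((LINT x|M. \<bar>f x\<bar> powr p) / a / p + (LINT x|M. \<bar>g x\<bar> powr q) / b / q)"
      using f g by simp
    also have "\<dots> = s * t" using ab pq by (simp add: a_def[symmetric] b_def[symmetric])
    finally show ?thesis by (simp add: s_def t_def a_def b_def)
  qed
qed

lemma norm_restr_powr: "q > 0 \<Longrightarrow> norm (restr S f y) powr q = indicator S y *\<^sub>R (norm (f y) powr q)"
  by (auto simp: restr_def indicator_def)

lemma in_Lp_restr_iff: "q > 0 \<Longrightarrow> in_Lp q UNIV (restr S f) \<longleftrightarrow> in_Lp q S f"
  using norm_restr_powr[of q S f]
  by (simp add: in_Lp_def set_borel_measurable_def set_integrable_def) (simp add: restr_def)

lemma Lp_norm_restr: "q > 0 \<Longrightarrow> Lp_norm q UNIV (restr S f) = Lp_norm q S f"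
  using norm_restr_powr[of q S f]
  by (simp add: Lp_norm_def set_lebesgue_integral_def)

lemma Lp_norm_powr: "q > 0 \<Longrightarrow> Lp_norm q S f powr q = (LINT y:S|lebesgue. norm (f y) powr q)"
  by (simp add: Lp_norm_def powr_powr set_integral_nonneg)

lemma Lp_norm_nonneg [simp]: "Lp_norm q S f \<ge> 0"
  by (simp add: Lp_norm_def)

lemma Holder_inequality_set:
  fixes f g :: "'a::euclidean_space \<Rightarrow> complex"
  assumes pq: "p > 1" "q > 1" "1/p + 1/q = 1" and f: "in_Lp p S f" and g: "in_Lp q S g"
  shows "set_integrable lebesgue S (\<lambda>y. f y * g y)"
    and "(LINT y:S|lebesgue. norm (f y * g y)) \<le> Lp_norm p S f * Lp_norm q S g"
proof -
  have pq0: "p > 0" "q > 0" using pq by auto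
  have m: "restr S f \<in> borel_measurable lebesgue" "restr S g \<in> borel_measurable lebesgue"
    using f g by (auto simp: in_Lp_def restr_def set_borel_measurable_def)
  have i: "integrable lebesgue (\<lambda>x. \<bar>norm (restr S f x)\<bar> powr p)"
          "integrable lebesgue (\<lambda>x. \<bar>norm (restr S g x)\<bar> powr q)"
    using f g pq0 by (auto simp: in_Lp_def norm_restr_powr set_integrable_def)
  note H = Holder_inequality_integral[OF pq _ _ i]
  have e: "norm (restr S f x) * norm (restr S g x) = indicator S x *\<^sub>R norm (f x * g x)" for x
    by (auto simp: restr_def indicator_def norm_mult)
  have "integrable lebesgue (\<lambda>x. restr S f x * restr S g x)"
    using H(1) m by (subst integrable_norm_iff[symmetric]) (auto simp: norm_mult)
  also have "(\<lambda>x. restr S f x * restr S g x) = (\<lambda>x. indicator S x *\<^sub>R (f x * g x))"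
    by (auto simp: restr_def indicator_def)
  finally show "set_integrable lebesgue S (\<lambda>y. f y * g y)"
    by (simp add: set_integrable_def)
  have "(LINT x|lebesgue. \<bar>norm (restr S f x) * norm (restr S g x)\<bar>)
       = (LINT y:S|lebesgue. norm (f y * g y))"
    by (simp add: e set_lebesgue_integral_def)
  thus "(LINT y:S|lebesgue. norm (f y * g y)) \<le> Lp_norm p S f * Lp_norm q S g"
    using H(2) m pq0 by (simp add: Lp_norm_def norm_restr_powr set_lebesgue_integral_def)
qed

text \<open>
  The power mean of order \<open>q\<close> over a ball is at most \<open>M\<close>, including its finiteness and the
  measurability of the function.
\<close>

definition Lq_mean_le :: "real \<Rightarrow> ('a::euclidean_space \<Rightarrow> complex) \<Rightarrow> 'a \<Rightarrow> real \<Rightarrow> real \<Rightarrow> bool" where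
  "Lq_mean_le q h x r M \<longleftrightarrow> in_Lp q (ball x r) h \<and> M \<ge> 0 \<and>
     (LINT y:ball x r|lebesgue. norm (h y) powr q) \<le> M powr q * vol_ball x r"

lemma Lq_mean_le_norm:
  assumes "Lq_mean_le q h x r M" "q > 0"
  shows "Lp_norm q (ball x r) h \<le> M * vol_ball x r powr (1 / q)"
proof -
  have "Lp_norm q (ball x r) h \<le> (M powr q * vol_ball x r) powr (1/q)"
    unfolding Lp_norm_def using assms
    by (intro powr_mono2 set_integral_nonneg) (auto simp: Lq_mean_le_def)
  also have "\<dots> = M * vol_ball x r powr (1/q)"
    using assms by (simp add: Lq_mean_le_def powr_mult powr_powr)
  finally show ?thesis .
qed

lemma Lq_mean_leI:
  assumes "in_Lp q (ball x r) h" "M \<ge> 0" "q > 0" "Lp_norm q (ball x r) h \<le> M * vol_ball x r powr (1 / q)"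
  shows "Lq_mean_le q h x r M"
proof -
  have "(LINT y:ball x r|lebesgue. norm (h y) powr q) = Lp_norm q (ball x r) h powr q"
    using assms by (simp add: Lp_norm_powr)
  also have "\<dots> \<le> (M * vol_ball x r powr (1 / q)) powr q"
    using assms by (intro powr_mono2) auto
  also have "\<dots> = M powr q * vol_ball x r" using assms by (simp add: powr_mult powr_powr)
  finally show ?thesis using assms by (simp add: Lq_mean_le_def)
qed

lemma Lq_mean_le_mono: "Lq_mean_le q h x r M \<Longrightarrow> M \<le> M' \<Longrightarrow> q > 0 \<Longrightarrow> Lq_mean_le q h x r M'"
  unfolding Lq_mean_le_def
  by (smt (verit, best) mult_right_mono powr_mono2 vol_ball_nonneg)

lemma in_Lp_subset:
  assumes "in_Lp q S h" "B \<in> sets lebesgue" "B \<subseteq> S" shows "in_Lp q B h"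
proof -
  have "indicator B x *\<^sub>R (indicator S x *\<^sub>R h x) = indicator B x *\<^sub>R h x" for x
    using assms(3) by (auto simp: indicator_def)
  moreover have "(\<lambda>x. indicator B x *\<^sub>R (indicator S x *\<^sub>R h x)) \<in> borel_measurable lebesgue"
    using assms(1) unfolding in_Lp_def set_borel_measurable_def
    by (intro borel_measurable_scaleR[OF borel_measurable_indicator[OF assms(2)]]) auto
  ultimately have "set_borel_measurable lebesgue B h" by (simp only: set_borel_measurable_def)
  thus ?thesis using assms by (auto simp: in_Lp_def intro: set_integrable_subset)
qed

lemma in_Lp_bound:
  assumes "set_borel_measurable lebesgue S h" "in_Lp q S f" "AE y in lebesgue. y \<in> S \<longrightarrow> norm (h y) \<le> norm (f y)" "q > 0"
  shows "in_Lp q S h"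
proof -
  have m: "(\<lambda>x. norm (indicator S x *\<^sub>R h x) powr q) \<in> borel_measurable lebesgue"
    using borel_measurable_norm_powr assms(1) unfolding set_borel_measurable_def by blast
  have e: "norm (indicator S x *\<^sub>R h x) powr q = indicator S x *\<^sub>R (norm (h x) powr q)" for x
    using assms by (auto simp: indicator_def)
  have "set_integrable lebesgue S (\<lambda>y. norm (h y) powr q)"
  proof (rule set_integrable_bound[where f="\<lambda>y. norm (f y) powr q"])
    show "set_integrable lebesgue S (\<lambda>y. norm (f y) powr q)" using assms by (simp add: in_Lp_def)
    show "set_borel_measurable lebesgue S (\<lambda>y. norm (h y) powr q)"
      using m unfolding set_borel_measurable_def e .
    show "AE x in lebesgue. x \<in> S \<longrightarrow> norm (norm (h x) powr q) \<le> norm (norm (f x) powr q)"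
      using assms(3) by eventually_elim (use assms(4) in \<open>auto intro: powr_mono2\<close>)
  qed
  thus ?thesis using assms(1) by (simp add: in_Lp_def)
qed

lemma in_Lp_add:
  assumes "in_Lp q S f" "in_Lp q S g" "q > 0"
  shows "in_Lp q S (\<lambda>y. f y + g y)"
    and "(LINT y:S|lebesgue. norm (f y + g y) powr q)
      \<le> 2 powr q * ((LINT y:S|lebesgue. norm (f y) powr q) + (LINT y:S|lebesgue. norm (g y) powr q))"
proof -
  have m: "set_borel_measurable lebesgue S (\<lambda>y. f y + g y)"
    using assms unfolding in_Lp_def set_borel_measurable_def scaleR_add_right by auto
  have b: "norm (f y + g y) powr q \<le> 2 powr q * (norm (f y) powr q + norm (g y) powr q)" for y
  proof -
    have "norm (f y + g y) powr q \<le> (2 * max (norm (f y)) (norm (g y))) powr q"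
      using assms norm_triangle_ineq[of "f y" "g y"] by (intro powr_mono2) auto
    also have "\<dots> = 2 powr q * max (norm (f y)) (norm (g y)) powr q" by (simp add: powr_mult)
    also have "\<dots> \<le> 2 powr q * (norm (f y) powr q + norm (g y) powr q)"
      by (intro mult_left_mono) (auto simp: max_def)
    finally show ?thesis .
  qed
  have i: "set_integrable lebesgue S (\<lambda>y. 2 powr q * (norm (f y) powr q + norm (g y) powr q))"
    using assms by (intro set_integrable_mult_right set_integral_add) (auto simp: in_Lp_def)
  have "(\<lambda>x. norm (indicator S x *\<^sub>R (f x + g x)) powr q) \<in> borel_measurable lebesgue"
    using borel_measurable_norm_powr m unfolding set_borel_measurable_def by blast
  also have "(\<lambda>x. norm (indicator S x *\<^sub>R (f x + g x)) powr q) = (\<lambda>x. indicator S x *\<^sub>R (norm (f x + g x) powr q))"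
    using assms by (auto simp: indicator_def)
  finally have i2: "set_integrable lebesgue S (\<lambda>y. norm (f y + g y) powr q)"
    by (intro set_integrable_bound[OF i]) (use b in \<open>auto simp: set_borel_measurable_def\<close>)
  show "in_Lp q S (\<lambda>y. f y + g y)" using m i2 by (simp add: in_Lp_def)
  have "(LINT y:S|lebesgue. norm (f y + g y) powr q) \<le> (LINT y:S|lebesgue. 2 powr q * (norm (f y) powr q + norm (g y) powr q))"
    by (intro set_integral_mono i i2 b)
  also have "\<dots> = 2 powr q * ((LINT y:S|lebesgue. norm (f y) powr q) + (LINT y:S|lebesgue. norm (g y) powr q))"
    using assms by (simp add: in_Lp_def)
  finally show "(LINT y:S|lebesgue. norm (f y + g y) powr q)
      \<le> 2 powr q * ((LINT y:S|lebesgue. norm (f y) powr q) + (LINT y:S|lebesgue. norm (g y) powr q))" .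
qed

lemma in_Lp_cmult: "in_Lp q S f \<Longrightarrow> in_Lp q S (\<lambda>y. c * f y)"
proof -
  assume a: "in_Lp q S f"
  have "(\<lambda>x. c * (indicator S x *\<^sub>R f x)) \<in> borel_measurable lebesgue"
    using a unfolding in_Lp_def set_borel_measurable_def by (intro borel_measurable_times) auto
  hence "set_borel_measurable lebesgue S (\<lambda>y. c * f y)"
    by (simp add: set_borel_measurable_def mult_scaleR_right)
  thus ?thesis using a by (simp add: in_Lp_def norm_mult powr_mult)
qed

lemma Lq_mean_le_const [simp]: "Lq_mean_le q (\<lambda>_. c) x r (norm c)"
proof -
  have "set_borel_measurable lebesgue (ball x r) (\<lambda>_. c)"
    unfolding set_borel_measurable_def by (intro borel_measurable_scaleR borel_measurable_indicator) auto
  thus ?thesis by (auto simp: Lq_mean_le_def in_Lp_def set_integral_const_ball mult.commute)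
qed

text \<open>The factor \<open>4\<close> replaces Minkowski's inequality; constants are irrelevant throughout.\<close>

lemma Lq_mean_le_add:
  assumes "Lq_mean_le q f x r M" "Lq_mean_le q g x r N" "q \<ge> 1"
  shows "Lq_mean_le q (\<lambda>y. f y + g y) x r (4 * (M + N))"
  unfolding Lq_mean_le_def
proof (intro conjI)
  have MN: "M \<ge> 0" "N \<ge> 0" and L: "in_Lp q (ball x r) f" "in_Lp q (ball x r) g"
    using assms by (auto simp: Lq_mean_le_def)
  show "in_Lp q (ball x r) (\<lambda>y. f y + g y)" using in_Lp_add(1)[OF L] assms by simp
  show "4 * (M + N) \<ge> 0" using MN by simp
  have "(LINT y:ball x r|lebesgue. norm (f y + g y) powr q)
     \<le> 2 powr q * ((LINT y:ball x r|lebesgue. norm (f y) powr q) + (LINT y:ball x r|lebesgue. norm (g y) powr q))"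
    using in_Lp_add(2)[OF L] assms by simp
  also have "\<dots> \<le> 2 powr q * (M powr q * vol_ball x r + N powr q * vol_ball x r)"
    using assms by (intro mult_left_mono add_mono) (auto simp: Lq_mean_le_def)
  also have "\<dots> \<le> 2 powr q * ((M+N) powr q * vol_ball x r + (M+N) powr q * vol_ball x r)"
    using assms MN by (intro mult_left_mono add_mono mult_right_mono powr_mono2) auto
  also have "\<dots> = 2 powr q * 2 powr 1 * (M+N) powr q * vol_ball x r" by simp
  also have "\<dots> \<le> 2 powr q * 2 powr q * (M+N) powr q * vol_ball x r"
    using assms by (intro mult_right_mono mult_left_mono powr_mono) auto
  also have "\<dots> = (4 * (M + N)) powr q * vol_ball x r"
    using MN by (simp add: powr_mult[symmetric])
  finally show "(LINT y:ball x r|lebesgue. norm (f y + g y) powr q) \<le> (4 * (M + N)) powr q * vol_ball x r" .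
qed

lemma Lq_mean_le_L1:
  assumes "Lq_mean_le q h x r M" "q > 1" 
  shows "set_integrable lebesgue (ball x r) h" "(LINT y:ball x r|lebesgue. norm (h y)) \<le> M * vol_ball x r"
proof -
  define p where "p = q / (q - 1)"
  have p: "p > 1" "1/q + 1/p = 1" using assms by (auto simp: p_def field_simps)
  have l: "in_Lp q (ball x r) h" "in_Lp p (ball x r) (\<lambda>_. 1)" 
    using assms Lq_mean_le_const[of p 1 x r] by (auto simp: Lq_mean_le_def)
  note H = Holder_inequality_set[OF assms(2) p l]
  show "set_integrable lebesgue (ball x r) h" using H(1) by simp
  have "(LINT y:ball x r|lebesgue. norm (h y)) \<le> Lp_norm q (ball x r) h * Lp_norm p (ball x r) (\<lambda>_. 1)"
    using H(2) by simp
  also have "\<dots> \<le> (M * vol_ball x r powr (1/q)) * (1 * vol_ball x r powr (1/p))"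
    using assms p Lq_mean_le_norm[OF assms(1)] Lq_mean_le_norm[OF Lq_mean_le_const[of p 1 x r]]
    by (intro mult_mono) (auto simp: Lq_mean_le_def)
  also have "\<dots> = M * vol_ball x r powr (1/q + 1/p)"
    by (simp add: powr_add)
  finally show "(LINT y:ball x r|lebesgue. norm (h y)) \<le> M * vol_ball x r" using p by simp
qed

section \<open>The John--Nirenberg inequality\<close>

lemma loc_integrable_measurable:
  assumes "loc_integrable f" shows "f \<in> borel_measurable lebesgue"
proof (rule borel_measurable_LIMSEQ_metric)
  show "(\<lambda>x. indicator (ball 0 (real i)) x *\<^sub>R f x) \<in> borel_measurable lebesgue" for i
    using borel_measurable_integrable assms unfolding loc_integrable_def set_integrable_def by blast
  fix x :: 'a
  obtain N :: nat where "norm x < real N" using reals_Archimedean2 by blast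
  hence "\<forall>i\<ge>N. indicator (ball 0 (real i)) x *\<^sub>R f x = f x" by (auto simp: indicator_def)
  hence "\<forall>\<^sub>F i in sequentially. indicator (ball 0 (real i)) x *\<^sub>R f x = f x"
    using eventually_sequentially by blast
  thus "(\<lambda>i. indicator (ball 0 (real i)) x *\<^sub>R f x) \<longlonglongrightarrow> f x"
    by (rule tendsto_eventually)
qed

lemma emeasure_density_set_integral:
  assumes "set_integrable M A g" "A \<in> sets M" "g \<in> borel_measurable M" "\<And>x. (g x::real) \<ge> 0"
  shows "emeasure (density M (\<lambda>x. ennreal (g x))) A = ennreal (LINT x:A|M. g x)"
proof -
  have "emeasure (density M (\<lambda>x. ennreal (g x))) A = (\<integral>\<^sup>+x. ennreal (indicator A x *\<^sub>R g x) \<partial>M)"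
    using assms by (subst emeasure_density) (auto intro!: nn_integral_cong simp: indicator_def)
  also have "\<dots> = ennreal (LINT x|M. indicator A x *\<^sub>R g x)"
    using assms by (intro nn_integral_eq_integral) (auto simp: set_integrable_def)
  finally show ?thesis by (simp add: set_lebesgue_integral_def)
qed

text \<open>
  A substitute for the Lebesgue differentiation theorem.  Vitali's covering theorem covers \<open>E\<close>, up
  to a null set, by disjoint balls on which \<open>g\<close> has mean at most \<open>l\<close>, all inside an open set
  barely larger than \<open>E\<close>; since \<open>g > l'\<close> on \<open>E\<close>, Markov's inequality gives
  \<open>l' |E| \<le> l |E|\<close> for the outer measure \<open>|E|\<close>, which must vanish as \<open>l < l'\<close>.
\<close>

lemma negligible_small_averages:
  fixes g :: "'a::euclidean_space \<Rightarrow> real"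
  assumes g: "loc_integrable g" "\<And>x. g x \<ge> 0" and l: "0 \<le> l" "l < l'"
    and E: "E \<subseteq> ball x0 R0" and t: "\<And>j. t j > 0" "t \<longlonglongrightarrow> 0"
    and Eg: "\<And>x. x \<in> E \<Longrightarrow> g x > l'"
    and Et: "\<And>x j. x \<in> E \<Longrightarrow> (LINT y:ball x (t j)|lebesgue. g y) \<le> l * vol_ball x (t j)"
  shows "negligible E"
proof -
  have gm: "g \<in> borel_measurable lebesgue" by (rule loc_integrable_measurable[OF g(1)])
  define \<nu> where "\<nu> = density lebesgue (\<lambda>x. ennreal (g x))"
  have sets\<nu>: "sets \<nu> = sets lebesgue" by (simp add: \<nu>_def)
  obtain S where S: "S \<in> sets lebesgue" "E \<subseteq> S" "outer_measure_of lebesgue E = emeasure lebesgue S"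
    using outer_measure_of_attain[of E lebesgue] by auto
  have "outer_measure_of lebesgue E \<le> emeasure lebesgue (ball x0 R0)"
    using outer_measure_of_mono[OF E, of lebesgue] by (subst (asm) outer_measure_of_eq) auto
  hence Sfin: "emeasure lebesgue S < \<infinity>"
    using emeasure_ball_finite[of x0 R0] S(3) by (metis le_less_trans)
  have key: "ennreal l' * emeasure lebesgue S \<le> ennreal l * (emeasure lebesgue S + ennreal \<delta>)" if "\<delta> > 0" for \<delta>
  proof -
    obtain U where U: "open U" "S \<subseteq> U" "U - S \<in> lmeasurable" "emeasure lebesgue (U - S) < ennreal \<delta>"
      using sets_lebesgue_outer_open[of S \<delta>] S(1) \<open>\<delta> > 0\<close> by metis
    define K where "K = {(x, j). x \<in> E \<and> ball x (t j) \<subseteq> U}"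
    have cov: "\<exists>i. i \<in> K \<and> x \<in> ball (fst i) (t (snd i)) \<and> t (snd i) < d" if "x \<in> E" "d > 0" for x d
    proof -
      obtain e where e: "e > 0" "ball x e \<subseteq> U"
        using U(1,2) S(2) \<open>x \<in> E\<close> by (meson open_contains_ball subsetD)
      have "\<forall>\<^sub>F j in sequentially. t j < min d e"
        using t(2) e \<open>d > 0\<close> by (intro order_tendstoD(2)) auto
      then obtain j where "t j < min d e" by (auto simp: eventually_sequentially)
      hence "(x, j) \<in> K" using e \<open>x \<in> E\<close> by (auto simp: K_def)
      thus ?thesis using \<open>t j < min d e\<close> t(1)[of j] by (intro exI[of _ "(x, j)"]) auto
    qed
    obtain C where C: "countable C" "C \<subseteq> K"
      "pairwise (\<lambda>i j. disjnt (ball (fst i) (t (snd i))) (ball (fst j) (t (snd j)))) C"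
      "negligible (E - (\<Union>i\<in>C. ball (fst i) (t (snd i))))"
      using Vitali_covering_theorem_balls[of E K fst "\<lambda>i. t (snd i)", OF cov] by blast
    define B where "B i = ball (fst i) (t (snd i))" for i :: "'a \<times> nat"
    define A where "A = (\<Union>i\<in>C. B i)"
    have "open A" by (auto simp: A_def B_def)
    hence A: "A \<in> sets lebesgue" "A \<subseteq> U"
      using C(2) by (force intro: lborelD simp: A_def B_def K_def)+
    have disj: "disjoint_family_on B C"
      using C(3) by (auto simp: disjoint_family_on_def pairwise_def disjnt_def B_def)
    define N where "N = A \<inter> {y. g y > l'}"
    have "{y \<in> space lebesgue. g y > l'} \<in> sets lebesgue" using gm by measurable
    hence Ns: "N \<in> sets lebesgue" using A by (auto simp: N_def)
    have nul: "E - A \<in> null_sets lebesgue"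
      using C(4) by (simp add: A_def B_def negligible_iff_null_sets)
    have "E \<subseteq> N \<union> (E - A)" using Eg by (auto simp: N_def)
    hence "outer_measure_of lebesgue E \<le> emeasure lebesgue (N \<union> (E - A))"
      using outer_measure_of_mono[of E _ lebesgue] Ns nul by (subst outer_measure_of_eq[symmetric]) auto
    also have "\<dots> = emeasure lebesgue N" using Ns nul by (rule emeasure_Un_null_set)
    finally have 1: "emeasure lebesgue S \<le> emeasure lebesgue N" using S(3) by simp
    have "ennreal l' * emeasure lebesgue N = (\<integral>\<^sup>+x. ennreal l' * indicator N x \<partial>lebesgue)"
      using Ns by (simp add: nn_integral_cmult_indicator)
    also have "\<dots> \<le> (\<integral>\<^sup>+x. ennreal (g x) * indicator N x \<partial>lebesgue)"
      by (intro nn_integral_mono) (auto simp: indicator_def N_def intro: ennreal_leI)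
    also have "\<dots> = emeasure \<nu> N" unfolding \<nu>_def using gm Ns by (subst emeasure_density) auto
    also have "\<dots> \<le> emeasure \<nu> A" using A by (intro emeasure_mono) (auto simp: N_def sets\<nu>)
    also have "\<dots> = (\<integral>\<^sup>+i. emeasure \<nu> (B i) \<partial>count_space C)"
      unfolding A_def using C disj by (intro emeasure_UN_countable) (auto simp: sets\<nu> B_def)
    also have "\<dots> \<le> (\<integral>\<^sup>+i. ennreal l * emeasure lebesgue (B i) \<partial>count_space C)"
    proof (intro nn_integral_mono)
      fix i assume "i \<in> space (count_space C)"
      then obtain x j where i: "i = (x, j)" "x \<in> E" using C(2) by (auto simp: K_def)
      have "emeasure \<nu> (B i) = ennreal (LINT y:ball x (t j)|lebesgue. g y)"
        unfolding \<nu>_def B_def i using g gm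
        by (subst emeasure_density_set_integral) (auto simp: loc_integrable_def)
      also have "\<dots> \<le> ennreal (l * vol_ball x (t j))" by (intro ennreal_leI Et i)
      also have "\<dots> = ennreal l * emeasure lebesgue (B i)"
        using l emeasure_ball_finite[of x "t j"]
        by (simp add: ennreal_mult vol_ball_def B_def i emeasure_eq_ennreal_measure less_top)
      finally show "emeasure \<nu> (B i) \<le> ennreal l * emeasure lebesgue (B i)" .
    qed
    also have "\<dots> = ennreal l * (\<integral>\<^sup>+i. emeasure lebesgue (B i) \<partial>count_space C)"
      by (simp add: nn_integral_cmult)
    also have "(\<integral>\<^sup>+i. emeasure lebesgue (B i) \<partial>count_space C) = emeasure lebesgue A"
      unfolding A_def by (rule emeasure_UN_countable[symmetric]) (simp_all add: C(1) disj, simp add: B_def)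
    finally have 3: "ennreal l' * emeasure lebesgue N \<le> ennreal l * emeasure lebesgue A" .
    have "emeasure lebesgue A \<le> emeasure lebesgue (S \<union> (U - S))"
    proof (rule emeasure_mono)
      show "A \<subseteq> S \<union> (U - S)" using A by blast
      show "S \<union> (U - S) \<in> sets lebesgue" using S(1) fmeasurableD[OF U(3)] by (rule sets.Un)
    qed
    also have "\<dots> \<le> emeasure lebesgue S + emeasure lebesgue (U - S)"
      using S(1) fmeasurableD[OF U(3)] by (rule emeasure_subadditive)
    also have "\<dots> \<le> emeasure lebesgue S + ennreal \<delta>" using U(4) by (intro add_left_mono) auto
    finally have "ennreal l * emeasure lebesgue A \<le> ennreal l * (emeasure lebesgue S + ennreal \<delta>)"
      by (rule mult_left_mono) simp
    with 3 have 2: "ennreal l' * emeasure lebesgue N \<le> ennreal l * (emeasure lebesgue S + ennreal \<delta>)"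
      by (rule order_trans)
    have "ennreal l' * emeasure lebesgue S \<le> ennreal l' * emeasure lebesgue N"
      using 1 by (intro mult_left_mono) auto
    thus ?thesis using 2 by simp
  qed
  define m where "m = measure lebesgue S"
  have m: "emeasure lebesgue S = ennreal m" "m \<ge> 0"
    using Sfin by (auto simp: m_def emeasure_eq_ennreal_measure less_top)
  have "l' * m \<le> l * m + l * \<delta>" if "\<delta> > 0" for \<delta>
  proof -
    have "ennreal (l' * m) \<le> ennreal (l * (m + \<delta>))"
      using key[OF that] l m that by (simp add: ennreal_mult)
    hence "l' * m \<le> l * (m + \<delta>)" using l m that by (subst (asm) ennreal_le_iff) auto
    thus ?thesis by (simp add: distrib_left)
  qed
  note key = this
  have *: "(l' - l) * m \<le> l * \<delta>" if "\<delta> > 0" for \<delta>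
    using key[OF that] by (simp add: left_diff_distrib)
  have "(l' - l) * m \<le> 0"
  proof (rule field_le_epsilon)
    fix e :: real assume "e > 0"
    have "(l' - l) * m \<le> l * (e / (l + 1))" using l \<open>e > 0\<close> by (intro *) auto
    also have "\<dots> \<le> e" using l \<open>e > 0\<close> by (simp add: field_simps)
    finally show "(l' - l) * m \<le> 0 + e" by simp
  qed
  hence "m = 0" using l m by (simp add: mult_le_0_iff)
  hence "S \<in> null_sets lebesgue" using S m by (auto simp: null_sets_def)
  thus ?thesis using S(2) negligible_iff_null_sets negligible_subset by blast
qed

lemma emeasure_UN_countable_le:
  assumes "countable C" "\<And>y. F y \<in> sets M"
  shows "emeasure M (\<Union>y\<in>C. F y) \<le> (\<integral>\<^sup>+y. emeasure M (F y) \<partial>count_space C)"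
proof -
  have U: "(\<Union>y\<in>C. F y) \<in> sets M" using assms by (intro sets.countable_UN'') auto
  have "emeasure M (\<Union>y\<in>C. F y) = (\<integral>\<^sup>+x. indicator (\<Union>y\<in>C. F y) x \<partial>M)"
    using U by simp
  also have "\<dots> \<le> (\<integral>\<^sup>+x. (\<integral>\<^sup>+y. indicator (F y) x \<partial>count_space C) \<partial>M)"
  proof (intro nn_integral_mono)
    fix x
    show "indicator (\<Union>y\<in>C. F y) x \<le> (\<integral>\<^sup>+y. (indicator (F y) x :: ennreal) \<partial>count_space C)"
    proof (cases "x \<in> (\<Union>y\<in>C. F y)")
      case True
      then obtain y where y: "y \<in> C" "x \<in> F y" by auto
      thus ?thesis using nn_integral_ge_point[OF y(1), of "\<lambda>y. indicator (F y) x"] by (auto simp: indicator_def)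
    qed auto
  qed
  also have "\<dots> = (\<integral>\<^sup>+y. (\<integral>\<^sup>+x. indicator (F y) x \<partial>M) \<partial>count_space C)"
    using assms by (intro nn_integral_count_space_nn_integral) auto
  finally show ?thesis using assms by simp
qed

text \<open>One level of the stopping argument has height \<open>JN_const d * A\<close>, where \<open>A\<close> bounds the mean oscillation.\<close>

definition JN_const :: "nat \<Rightarrow> real" where "JN_const d = 5 ^ d * 2 ^ (3 * d + 2)"

lemma JN_const_pos: "JN_const d > 0"
  by (simp add: JN_const_def)

text \<open>
  Each step of the induction on the number of levels passes from the ball \<open>B\<close>, of centre \<open>x\<close> and radius \<open>r\<close>, to balls
  around the points of large deviation.  The radii \<open>r / 8 ^ j\<close> are tested, and the
  first one on which the mean of \<open>|f - f\<^sub>B|\<close> exceeds the threshold \<open>l\<close> is selected.  The mean over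
  the previous ball, which contains the fivefold dilate of the selected one, is still at most \<open>l\<close>, so
  passing to the dilate costs one level, while the total measure of the dilates is at most half of \<open>|B|\<close>.
\<close>

lemma John_Nirenberg_level_sets:
  fixes f :: "'a::euclidean_space \<Rightarrow> complex"
  assumes f: "loc_integrable f" and A: "A > 0"
    and osc: "\<And>x r. 0 < r \<Longrightarrow> r \<le> R \<Longrightarrow>
       (LINT y:ball x r|lebesgue. norm (f y - avg f x r)) \<le> A * vol_ball x r"
    and r: "0 < r" "r \<le> R / 2"
  shows "emeasure lebesgue {y \<in> ball x r. norm (f y - avg f x r) > real k * (JN_const (DIM('a)) * A)}
     \<le> ennreal ((1/2) ^ k * vol_ball x r)"
  using r
proof (induction k arbitrary: x r)
  case 0
  have "emeasure lebesgue {y \<in> ball x r. norm (f y - avg f x r) > real 0 * (JN_const (DIM('a)) * A)}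
     \<le> emeasure lebesgue (ball x r)"
    by (intro emeasure_mono) auto
  also have "\<dots> = ennreal (vol_ball x r)"
    using emeasure_ball_finite[of x r] by (simp add: vol_ball_def emeasure_eq_ennreal_measure less_top)
  finally show ?case by simp
next
  case (Suc k x0 r0)
  let ?d = "DIM('a)"
  define L where "L = JN_const ?d * A"
  define D where "D = 2 ^ (2 * ?d + 1) * A"
  define l where "l = 2 * 5 ^ ?d * D"
  have "(1::real) \<le> 5 ^ ?d" by (rule one_le_power) simp
  hence "1 \<le> 2 * (5::real) ^ ?d" by linarith
  hence "1 * D \<le> (2 * 5 ^ ?d) * D" using A by (intro mult_right_mono) (auto simp: D_def)
  hence Dl: "D > 0" "l > 0" "D \<le> l" using A by (auto simp: D_def l_def)
  have Ll: "L = 2 ^ ?d * l"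
    by (simp add: L_def l_def D_def JN_const_def power_add power_mult power_mult_distrib
          power2_eq_square power3_eq_cube mult_ac flip: power_mult_distrib)
  have "l < L" unfolding Ll using Dl by (simp add: one_less_power)
  have L0: "L > 0" using Dl \<open>l < L\<close> by simp
  define c where "c = avg f x0 r0"
  define g where "g y = norm (f y - c)" for y
  have fi: "set_integrable lebesgue (ball x r) f" for x r using f by (simp add: loc_integrable_def)
  have gi: "set_integrable lebesgue (ball x r) g" for x r
    unfolding g_def using fi by (intro set_integrable_norm set_integral_diff) auto
  hence gl: "loc_integrable g" by (simp add: loc_integrable_def)
  have g0: "g y \<ge> 0" for y by (simp add: g_def)
  have fm: "f \<in> borel_measurable lebesgue" by (rule loc_integrable_measurable[OF f])
  have gm: "g \<in> borel_measurable lebesgue" by (rule loc_integrable_measurable[OF gl])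
  have r0: "r0 > 0" "2 * r0 \<le> R" using Suc.prems by auto
  \<comment> \<open>the mean of \<open>g\<close> over the doubled ball\<close>
  have g2: "(LINT y:ball x0 (2 * r0)|lebesgue. g y) \<le> D * vol_ball x0 r0"
  proof -
    define c2 where "c2 = avg f x0 (2 * r0)"
    have v2: "vol_ball x0 (2 * r0) = 2 ^ ?d * vol_ball x0 r0" using r0 by (intro vol_ball_scale) auto
    have o2: "(LINT y:ball x0 (2*r0)|lebesgue. norm (f y - c2)) \<le> A * vol_ball x0 (2 * r0)"
      unfolding c2_def using r0 by (intro osc) auto
    have i2: "set_integrable lebesgue (ball x r) (\<lambda>y. norm (f y - c2))" for x r
      using fi by (intro set_integrable_norm set_integral_diff) auto
    have "norm (c - c2) * vol_ball x0 r0 \<le> (LINT y:ball x0 r0|lebesgue. norm (f y - c2))"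
      unfolding c_def using fi r0 by (intro avg_dist_le) auto
    also have "\<dots> \<le> (LINT y:ball x0 (2 * r0)|lebesgue. norm (f y - c2))"
      using r0 by (intro set_integral_mono_set_nonneg i2) auto
    finally have cc: "norm (c - c2) * vol_ball x0 r0 \<le> A * vol_ball x0 (2 * r0)" using o2 by simp
    have "(LINT y:ball x0 (2 * r0)|lebesgue. g y)
        \<le> (LINT y:ball x0 (2 * r0)|lebesgue. norm (f y - c2) + norm (c - c2))"
      unfolding g_def using norm_triangle_ineq4[of "f _ - c2" "c - c2"]
      by (intro set_integral_mono i2 set_integral_add gi[unfolded g_def]) auto
    also have "\<dots> = (LINT y:ball x0 (2 * r0)|lebesgue. norm (f y - c2)) + norm (c - c2) * vol_ball x0 (2 * r0)"
      using i2 by (subst set_integral_add) (auto simp: set_integral_const_ball)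
    also have "\<dots> \<le> A * vol_ball x0 (2 * r0) + 2 ^ ?d * (A * vol_ball x0 (2 * r0))"
      using o2 mult_left_mono[OF cc, of "2 ^ ?d"] unfolding v2 by (simp add: mult_ac)
    also have "\<dots> = A * (1 + 2 ^ ?d) * 2 ^ ?d * vol_ball x0 r0" unfolding v2 by (simp add: algebra_simps)
    also have "\<dots> \<le> A * (2 ^ ?d + 2 ^ ?d) * 2 ^ ?d * vol_ball x0 r0"
      using A by (intro mult_right_mono mult_left_mono add_mono) auto
    also have "\<dots> = D * vol_ball x0 r0" unfolding D_def mult_2 power_add by simp
    finally show ?thesis .
  qed
  define t where "t j = r0 / 8 ^ j" for j :: nat
  have t0: "t j > 0" "t j \<le> r0" for j using r0 by (auto simp: t_def field_simps)
  have tS: "t j = 8 * t (Suc j)" for j by (simp add: t_def)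
  have sub2: "ball x (t j) \<subseteq> ball x0 (2 * r0)" if "x \<in> ball x0 r0" for x j
  proof
    fix z assume "z \<in> ball x (t j)"
    thus "z \<in> ball x0 (2 * r0)" using that t0[of j] dist_triangle[of x0 z x] by auto
  qed
  define P where "P x j \<longleftrightarrow> (LINT y:ball x (t j)|lebesgue. g y) > l * vol_ball x (t j)" for x j
  have P0: "\<not> P x 0" if "x \<in> ball x0 r0" for x
  proof -
    have "(LINT y:ball x (t 0)|lebesgue. g y) \<le> (LINT y:ball x0 (2 * r0)|lebesgue. g y)"
      using g0 by (intro set_integral_mono_set_nonneg gi sub2 that) auto
    also have "\<dots> \<le> D * vol_ball x0 r0" by (rule g2)
    also have "\<dots> = D * vol_ball x (t 0)" using r0 vol_ball_scale[of r0 1 x0 x] by (simp add: t_def)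
    also have "\<dots> \<le> l * vol_ball x (t 0)" using Dl by (intro mult_right_mono) auto
    finally show ?thesis by (simp add: P_def)
  qed
  define E where "E = {y \<in> ball x0 r0. g y > real (Suc k) * L}"
  define G where "G = {y \<in> E. \<exists>j. P y j}"
  define j0 where "j0 y = (LEAST j. P y j)" for y
  define \<tau> where "\<tau> y = t (j0 y)" for y
  have G1: "P y (j0 y)" if "y \<in> G" for y
    using that unfolding G_def j0_def by (auto intro: LeastI)
  have G2: "(LINT z:ball y (8 * \<tau> y)|lebesgue. g z) \<le> l * vol_ball y (8 * \<tau> y)"
           "8 * \<tau> y \<le> r0" if "y \<in> G" for y
  proof -
    have "y \<in> ball x0 r0" using that by (auto simp: G_def E_def)
    hence "j0 y \<noteq> 0" using G1[OF that] P0[of y] by metis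
    then obtain i where i: "j0 y = Suc i" by (cases "j0 y") auto
    hence "\<not> P y i" using not_less_Least[of i "P y"] by (simp add: j0_def)
    thus "(LINT z:ball y (8 * \<tau> y)|lebesgue. g z) \<le> l * vol_ball y (8 * \<tau> y)"
      by (simp add: P_def \<tau>_def i tS[symmetric])
    show "8 * \<tau> y \<le> r0" using t0(2)[of i] by (simp add: \<tau>_def i tS[symmetric])
  qed
  have \<tau>0: "\<tau> y > 0" for y by (simp add: \<tau>_def t0)
  have neg: "negligible (E - G)"
  proof (rule negligible_small_averages[OF gl g0 _ \<open>l < L\<close>, of _ x0 r0 t])
    show "0 \<le> l" using Dl by simp
    show "E - G \<subseteq> ball x0 r0" by (auto simp: E_def)
    show "t j > 0" for j by (rule t0)
    show "t \<longlonglongrightarrow> 0" unfolding t_def by real_asymp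
    show "g x > L" if "x \<in> E - G" for x
    proof -
      have "L \<le> real (Suc k) * L" using L0 by simp
      thus ?thesis using that by (auto simp: E_def)
    qed
    show "(LINT y:ball x (t j)|lebesgue. g y) \<le> l * vol_ball x (t j)" if "x \<in> E - G" for x j
      using that by (auto simp: G_def P_def not_less)
  qed
  obtain C where C: "countable C" "C \<subseteq> G"
     "pairwise (\<lambda>i j. disjnt (ball (id i) (\<tau> i)) (ball (id j) (\<tau> j))) C"
     "G \<subseteq> (\<Union>i\<in>C. ball (id i) (5 * \<tau> i))"
  proof (rule Vitali_covering_lemma_balls[where S=G and K=G and a=id and r=\<tau> and B=r0])
    show "G \<subseteq> (\<Union>i\<in>G. ball (id i) (\<tau> i))" using \<tau>0 by force
    show "0 < \<tau> i \<and> \<tau> i \<le> r0" if "i \<in> G" for i using \<tau>0 t0 by (simp add: \<tau>_def)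
  qed (use that in blast)
  define F where "F y = {z \<in> ball y (5 * \<tau> y). norm (f z - avg f y (5 * \<tau> y)) > real k * L}" for y
  have Fs: "F y \<in> sets lebesgue" for y
  proof -
    have "{z \<in> space lebesgue. norm (f z - avg f y (5 * \<tau> y)) > real k * L} \<in> sets lebesgue"
      using fm by measurable
    moreover have "F y = ball y (5 * \<tau> y) \<inter> {z \<in> space lebesgue. norm (f z - avg f y (5 * \<tau> y)) > real k * L}"
      by (auto simp: F_def)
    ultimately show ?thesis by auto
  qed
  \<comment> \<open>the means over the selected dilates differ from \<open>c\<close> by at most one level\<close>
  have cover: "E \<subseteq> (E - G) \<union> (\<Union>y\<in>C. F y)"
  proof
    fix z assume z: "z \<in> E"
    show "z \<in> (E - G) \<union> (\<Union>y\<in>C. F y)"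
    proof (cases "z \<in> G")
      case True
      then obtain y where y: "y \<in> C" "z \<in> ball y (5 * \<tau> y)" using C(4) by auto
      have yG: "y \<in> G" using y C by auto
      have "norm (avg f y (5 * \<tau> y) - c) * vol_ball y (5 * \<tau> y) \<le> (LINT z:ball y (5 * \<tau> y)|lebesgue. g z)"
        unfolding g_def using fi \<tau>0 by (intro avg_dist_le) auto
      also have "\<dots> \<le> (LINT z:ball y (8 * \<tau> y)|lebesgue. g z)"
        using g0 gi less_imp_le[OF \<tau>0] by (intro set_integral_mono_set_nonneg subset_ball) auto
      also have "\<dots> \<le> l * vol_ball y (8 * \<tau> y)" by (rule G2[OF yG])
      also have "\<dots> \<le> l * (2 ^ ?d * vol_ball y (5 * \<tau> y))"
        using Dl \<tau>0[of y] by (intro mult_left_mono vol_ball_le_scale) auto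
      finally have "norm (avg f y (5 * \<tau> y) - c) * vol_ball y (5 * \<tau> y) \<le> L * vol_ball y (5 * \<tau> y)"
        by (simp add: Ll mult_ac)
      hence a: "norm (avg f y (5 * \<tau> y) - c) \<le> L" using vol_ball_pos[of "5 * \<tau> y" y] \<tau>0[of y] by simp
      have "norm (f z - c) > real (Suc k) * L" using z by (simp add: E_def g_def)
      moreover have "norm (f z - c) \<le> norm (f z - avg f y (5 * \<tau> y)) + norm (avg f y (5 * \<tau> y) - c)"
        using norm_triangle_ineq[of "f z - avg f y (5 * \<tau> y)" "avg f y (5 * \<tau> y) - c"] by simp
      ultimately have "norm (f z - avg f y (5 * \<tau> y)) > real k * L" using a by (simp add: algebra_simps)
      thus ?thesis using y by (auto simp: F_def)
    qed (use z in auto)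
  qed
  define \<nu> where "\<nu> = density lebesgue (\<lambda>x. ennreal (g x))"
  have \<nu>b: "emeasure \<nu> (ball x r) = ennreal (LINT y:ball x r|lebesgue. g y)" for x r
    unfolding \<nu>_def by (intro emeasure_density_set_integral gi gm g0) auto
  have Cb: "emeasure lebesgue (F y) \<le> ennreal ((1/2) ^ k * 5 ^ ?d / l) * emeasure \<nu> (ball y (\<tau> y))" if "y \<in> C" for y
  proof -
    have yG: "y \<in> G" using that C by auto
    have "emeasure lebesgue (F y) \<le> ennreal ((1/2) ^ k * vol_ball y (5 * \<tau> y))"
      unfolding F_def L_def using \<tau>0[of y] G2(2)[OF yG] Suc.prems by (intro Suc.IH) auto
    also have "(1/2) ^ k * vol_ball y (5 * \<tau> y) = (1/2) ^ k * 5 ^ ?d / l * (l * vol_ball y (\<tau> y))"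
      using vol_ball_scale[of "\<tau> y" 5 y y] \<tau>0[of y] Dl by simp
    also have "ennreal \<dots> \<le> ennreal ((1/2) ^ k * 5 ^ ?d / l * (LINT z:ball y (\<tau> y)|lebesgue. g z))"
      using G1[OF yG] Dl by (intro ennreal_leI mult_left_mono) (auto simp: P_def \<tau>_def)
    also have "\<dots> = ennreal ((1/2) ^ k * 5 ^ ?d / l) * emeasure \<nu> (ball y (\<tau> y))"
      unfolding \<nu>b using Dl by (intro ennreal_mult) (auto intro!: set_integral_nonneg g0)
    finally show ?thesis .
  qed
  have disj: "disjoint_family_on (\<lambda>y. ball y (\<tau> y)) C"
    using C(3) by (auto simp: disjoint_family_on_def pairwise_def disjnt_def)
  have nul: "E - G \<in> null_sets lebesgue" using neg by (simp add: negligible_iff_null_sets)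
  have UF: "(\<Union>y\<in>C. F y) \<in> sets lebesgue" using C Fs by (intro sets.countable_UN'') auto
  have "emeasure lebesgue E \<le> emeasure lebesgue ((\<Union>y\<in>C. F y) \<union> (E - G))"
    using cover UF nul by (intro emeasure_mono) auto
  also have "\<dots> = emeasure lebesgue (\<Union>y\<in>C. F y)" using UF nul by (rule emeasure_Un_null_set)
  also have "\<dots> \<le> (\<integral>\<^sup>+y. emeasure lebesgue (F y) \<partial>count_space C)"
    using C(1) Fs by (rule emeasure_UN_countable_le)
  also have "\<dots> \<le> (\<integral>\<^sup>+y. ennreal ((1/2) ^ k * 5 ^ ?d / l) * emeasure \<nu> (ball y (\<tau> y)) \<partial>count_space C)"
    using Cb by (intro nn_integral_mono) auto
  also have "\<dots> = ennreal ((1/2) ^ k * 5 ^ ?d / l) * (\<integral>\<^sup>+y. emeasure \<nu> (ball y (\<tau> y)) \<partial>count_space C)"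
    by (simp add: nn_integral_cmult)
  also have "(\<integral>\<^sup>+y. emeasure \<nu> (ball y (\<tau> y)) \<partial>count_space C) = emeasure \<nu> (\<Union>y\<in>C. ball y (\<tau> y))"
    using C(1) disj by (intro emeasure_UN_countable[symmetric]) (auto simp: \<nu>_def)
  finally have 1: "emeasure lebesgue E
     \<le> ennreal ((1/2) ^ k * 5 ^ ?d / l) * emeasure \<nu> (\<Union>y\<in>C. ball y (\<tau> y))" .
  have "emeasure \<nu> (\<Union>y\<in>C. ball y (\<tau> y)) \<le> emeasure \<nu> (ball x0 (2 * r0))"
  proof (intro emeasure_mono UN_least)
    fix y assume "y \<in> C"
    hence "y \<in> ball x0 r0" using C(2) by (auto simp: G_def E_def)
    thus "ball y (\<tau> y) \<subseteq> ball x0 (2 * r0)" unfolding \<tau>_def by (rule sub2)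
  qed (simp add: \<nu>_def)
  also have "\<dots> \<le> ennreal (D * vol_ball x0 r0)" unfolding \<nu>b by (intro ennreal_leI g2)
  finally have "ennreal ((1/2) ^ k * 5 ^ ?d / l) * emeasure \<nu> (\<Union>y\<in>C. ball y (\<tau> y))
      \<le> ennreal ((1/2) ^ k * 5 ^ ?d / l) * ennreal (D * vol_ball x0 r0)"
    by (rule mult_left_mono) simp
  also have "\<dots> = ennreal ((1/2) ^ k * 5 ^ ?d / l * (D * vol_ball x0 r0))"
    using Dl by (intro ennreal_mult[symmetric]) auto
  also have "(1/2) ^ k * 5 ^ ?d / l * (D * vol_ball x0 r0) = (1/2) ^ Suc k * vol_ball x0 r0"
    using Dl by (simp add: l_def)
  finally have "emeasure lebesgue E \<le> ennreal ((1/2) ^ Suc k * vol_ball x0 r0)"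
    using 1 by (rule order_trans[rotated])
  thus ?case by (simp add: E_def g_def c_def L_def)
qed


definition JN_power_const :: "nat \<Rightarrow> real \<Rightarrow> real" where
  "JN_power_const d q = JN_const d * (\<Sum>k. (real k + 1) powr q * (1/2) ^ k) powr (1 / q)"

lemma JN_series_summable: "summable (\<lambda>k. (real k + 1) powr q * (1/2) ^ k)"
proof (rule summable_comparison_test_bigo)
  show "summable (\<lambda>k. norm ((3/4::real) ^ k))" by (simp add: summable_geometric)
  show "(\<lambda>k. (real k + 1) powr q * (1/2) ^ k) \<in> O(\<lambda>k. (3/4) ^ k)" by real_asymp
qed

lemma JN_power_const_nonneg: "JN_power_const d q \<ge> 0"
  using JN_const_pos[of d] by (simp add: JN_power_const_def)

text \<open>
  Cutting \<open>|f - f\<^sub>B|\<close> into layers between consecutive levels, the exponential decay of the level sets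
  beats the growth of \<open>(k + 1) powr q\<close>, for any \<open>q\<close>.
\<close>

lemma John_Nirenberg:
  fixes f :: "'a::euclidean_space \<Rightarrow> complex"
  assumes f: "loc_integrable f" and A: "A > 0"
    and osc: "\<And>x r. 0 < r \<Longrightarrow> r \<le> R \<Longrightarrow>
       (LINT y:ball x r|lebesgue. norm (f y - avg f x r)) \<le> A * vol_ball x r"
    and r: "0 < r" "r \<le> R / 2" and q: "q > 0"
  shows "Lq_mean_le q (\<lambda>y. f y - avg f x r) x r (JN_power_const (DIM('a)) q * A)"
proof -
  define L where "L = JN_const (DIM('a)) * A"
  define h where "h y = f y - avg f x r" for y
  define E where "E k = {y \<in> ball x r. norm (h y) > real k * L}" for k
  define S where "S = (\<Sum>k. (real k + 1) powr q * (1/2) ^ k)"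
  have L: "L > 0" using A JN_const_pos by (simp add: L_def)
  have fm: "f \<in> borel_measurable lebesgue" by (rule loc_integrable_measurable[OF f])
  hence hm: "h \<in> borel_measurable lebesgue" unfolding h_def by (intro borel_measurable_diff) auto
  have Es: "E k \<in> sets lebesgue" for k
  proof -
    have "{z \<in> space lebesgue. norm (h z) > real k * L} \<in> sets lebesgue"
      using hm by measurable
    moreover have "E k = ball x r \<inter> {z \<in> space lebesgue. norm (h z) > real k * L}"
      by (auto simp: E_def)
    ultimately show ?thesis by auto
  qed
  have Em: "emeasure lebesgue (E k) \<le> ennreal ((1/2) ^ k * vol_ball x r)" for k
    unfolding E_def h_def L_def by (rule John_Nirenberg_level_sets[OF f A _ r]) (rule osc)
  have pt: "ennreal (indicator (ball x r) y *\<^sub>R (norm (h y) powr q))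
      \<le> (\<Sum>k. ennreal (((real k + 1) * L) powr q) * indicator (E k) y)" for y
  proof (cases "y \<in> ball x r \<and> norm (h y) \<noteq> 0")
    case False
    thus ?thesis using q by (auto simp: indicator_def)
  next
    case True
    define u where "u = norm (h y) / L"
    have u: "u > 0" using True L by (simp add: u_def)
    define k where "k = nat (\<lceil>u\<rceil> - 1)"
    have k: "real k < u" "u \<le> real k + 1"
      using u by (auto simp: k_def) linarith+
    have "norm (h y) \<le> (real k + 1) * L" "norm (h y) > real k * L"
      using k L by (auto simp: u_def field_simps)
    hence "y \<in> E k" "ennreal (indicator (ball x r) y *\<^sub>R (norm (h y) powr q)) \<le> ennreal (((real k + 1) * L) powr q)"
      using True q by (auto simp: E_def intro!: ennreal_leI powr_mono2)
    hence "ennreal (indicator (ball x r) y *\<^sub>R (norm (h y) powr q))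
       \<le> (\<Sum>i\<in>{k}. ennreal (((real i + 1) * L) powr q) * indicator (E i) y)" by simp
    also have "\<dots> \<le> (\<Sum>k. ennreal (((real k + 1) * L) powr q) * indicator (E k) y)"
      by (rule sum_le_suminf) auto
    finally show ?thesis .
  qed
  have sm: "summable (\<lambda>k. ((real k + 1) * L) powr q * ((1/2) ^ k * vol_ball x r))"
  proof -
    have "summable (\<lambda>k. L powr q * vol_ball x r * ((real k + 1) powr q * (1/2) ^ k))"
      by (intro summable_mult JN_series_summable)
    thus ?thesis using L by (simp add: powr_mult mult_ac)
  qed
  have S: "(\<Sum>k. ((real k + 1) * L) powr q * ((1/2) ^ k * vol_ball x r)) = L powr q * vol_ball x r * S"
    unfolding S_def using L by (subst suminf_mult[OF JN_series_summable, symmetric]) (simp add: powr_mult mult_ac)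
  have S0: "S \<ge> 0" unfolding S_def by (intro suminf_nonneg JN_series_summable) auto
  have "(\<integral>\<^sup>+y. ennreal (indicator (ball x r) y *\<^sub>R (norm (h y) powr q)) \<partial>lebesgue)
     \<le> (\<integral>\<^sup>+y. (\<Sum>k. ennreal (((real k + 1) * L) powr q) * indicator (E k) y) \<partial>lebesgue)"
    by (intro nn_integral_mono pt)
  also have "\<dots> = (\<Sum>k. \<integral>\<^sup>+y. ennreal (((real k + 1) * L) powr q) * indicator (E k) y \<partial>lebesgue)"
    using Es by (intro nn_integral_suminf) auto
  also have "\<dots> = (\<Sum>k. ennreal (((real k + 1) * L) powr q) * emeasure lebesgue (E k))"
    using Es by (simp add: nn_integral_cmult_indicator)
  also have "\<dots> \<le> (\<Sum>k. ennreal (((real k + 1) * L) powr q * ((1/2) ^ k * vol_ball x r)))"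
  proof (intro suminf_le summableI)
    fix k
    have "ennreal (((real k + 1) * L) powr q) * emeasure lebesgue (E k)
       \<le> ennreal (((real k + 1) * L) powr q) * ennreal ((1/2) ^ k * vol_ball x r)"
      by (intro mult_left_mono Em) auto
    also have "\<dots> = ennreal (((real k + 1) * L) powr q * ((1/2) ^ k * vol_ball x r))"
      by (intro ennreal_mult[symmetric]) auto
    finally show "ennreal (((real k + 1) * L) powr q) * emeasure lebesgue (E k)
       \<le> ennreal (((real k + 1) * L) powr q * ((1/2) ^ k * vol_ball x r))" .
  qed
  also have "\<dots> = ennreal (L powr q * vol_ball x r * S)"
    using sm S by (subst suminf_ennreal2) auto
  finally have bd: "(\<integral>\<^sup>+y. ennreal (indicator (ball x r) y *\<^sub>R (norm (h y) powr q)) \<partial>lebesgue)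
     \<le> ennreal (L powr q * vol_ball x r * S)" .
  have mB: "(\<lambda>y. indicator (ball x r) y *\<^sub>R h y) \<in> borel_measurable lebesgue"
    using hm by (intro borel_measurable_scaleR borel_measurable_indicator) auto
  have mq: "(\<lambda>y. indicator (ball x r) y *\<^sub>R (norm (h y) powr q)) \<in> borel_measurable lebesgue"
    using hm by (intro borel_measurable_scaleR borel_measurable_indicator borel_measurable_norm_powr) auto
  have int: "set_integrable lebesgue (ball x r) (\<lambda>y. norm (h y) powr q)"
    unfolding set_integrable_def
  proof (rule integrableI_nonneg[OF mq])
    show "(\<integral>\<^sup>+y. ennreal (indicator (ball x r) y *\<^sub>R (norm (h y) powr q)) \<partial>lebesgue) < \<infinity>"
      using bd by (rule le_less_trans) simp
  qed (auto simp: indicator_def)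
  have "ennreal (LINT y:ball x r|lebesgue. norm (h y) powr q) \<le> ennreal (L powr q * vol_ball x r * S)"
    using bd int unfolding set_lebesgue_integral_def set_integrable_def
    by (subst nn_integral_eq_integral[symmetric]) (auto simp: indicator_def)
  hence le: "(LINT y:ball x r|lebesgue. norm (h y) powr q) \<le> L powr q * vol_ball x r * S"
    using S0 by (subst (asm) ennreal_le_iff) auto
  have "(JN_power_const (DIM('a)) q * A) powr q = L powr q * S"
    using S0 q A JN_const_pos[of "DIM('a)"]
    by (simp add: JN_power_const_def L_def S_def[symmetric] powr_mult powr_powr mult_ac)
  thus ?thesis using le int mB JN_power_const_nonneg A
    by (simp add: Lq_mean_le_def h_def in_Lp_def set_borel_measurable_def mult_ac)
qed

section \<open>Growth of Campanato functions\<close>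

lemma borel_measurable_lebesgue_AE:
  fixes f g :: "'a::euclidean_space \<Rightarrow> 'b::topological_space"
  assumes f: "f \<in> borel_measurable lebesgue" and eq: "AE x in lebesgue. f x = g x"
  shows "g \<in> borel_measurable lebesgue"
proof (rule measurableI)
  fix A :: "'b set" assume A: "A \<in> sets borel"
  have "AE x in lebesgue. x \<in> f -` A \<longleftrightarrow> x \<in> g -` A"
    using eq by eventually_elim auto
  moreover have "f -` A \<in> sets lebesgue" using measurable_sets[OF f A] by simp
  ultimately have "g -` A \<in> sets lebesgue"
    by (rule completion.in_sets_AE) simp
  thus "g -` A \<inter> space lebesgue \<in> sets lebesgue" by simp
qed auto

text \<open>The ratio of \<open>|B| powr (\<alpha> / d)\<close> and \<open>r powr \<alpha>\<close> for a ball \<open>B\<close> of radius \<open>r\<close> in dimension \<open>d\<close>.\<close>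

definition scale_const :: "nat \<Rightarrow> real \<Rightarrow> real" where
  "scale_const d \<alpha> = unit_ball_vol (real d) powr (\<alpha> / real d)"

lemma scale_const_pos: "scale_const d \<alpha> > 0"
  unfolding scale_const_def powr_gt_zero by (metis less_irrefl of_nat_0_le_iff unit_ball_vol_pos)

lemma vol_ball_powr:
  fixes x :: "'a::euclidean_space"
  assumes "r > 0"
  shows "vol_ball x r powr (1 + \<alpha> / real DIM('a)) = scale_const (DIM('a)) \<alpha> * r powr \<alpha> * vol_ball x r"
proof -
  have "vol_ball x r powr (\<alpha> / real DIM('a))
      = scale_const (DIM('a)) \<alpha> * (r ^ DIM('a)) powr (\<alpha> / real DIM('a))"
    using assms by (simp add: vol_ball_eq scale_const_def powr_mult)
  also have "(r ^ DIM('a)) powr (\<alpha> / real DIM('a)) = r powr \<alpha>"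
    using assms by (simp add: powr_realpow[symmetric] powr_powr)
  finally show ?thesis using vol_ball_pos[OF assms, of x] by (simp add: powr_add)
qed

lemma scaled_mean_le_iff:
  fixes x :: "'a::euclidean_space"
  assumes "r > 0"
  shows "1 / vol_ball x r powr (1 + \<alpha> / real DIM('a)) * I \<le> C
    \<longleftrightarrow> I \<le> C * (scale_const (DIM('a)) \<alpha> * r powr \<alpha>) * vol_ball x r"
proof -
  have "scale_const (DIM('a)) \<alpha> * r powr \<alpha> * vol_ball x r > 0"
    using vol_ball_pos[OF assms, of x] scale_const_pos[of "DIM('a)" \<alpha>] assms by simp
  thus ?thesis unfolding vol_ball_powr[OF assms] by (simp add: field_simps)
qed

lemma osc_bound_iff:
  fixes f :: "'a::euclidean_space \<Rightarrow> complex"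
  shows "osc_bound \<alpha> f C \<longleftrightarrow> (\<forall>x r. r > 0 \<longrightarrow> (LINT y:ball x r|lebesgue. norm (f y - avg f x r))
     \<le> C * (scale_const (DIM('a)) \<alpha> * r powr \<alpha>) * vol_ball x r)"
  unfolding osc_bound_def by (simp only: scaled_mean_le_iff cong: imp_cong)

lemma size_bound_iff:
  fixes f :: "'a::euclidean_space \<Rightarrow> complex"
  shows "size_bound \<rho> \<alpha> f C \<longleftrightarrow> (\<forall>x r. r > 0 \<and> r \<ge> \<rho> x \<longrightarrow> (LINT y:ball x r|lebesgue. norm (f y))
     \<le> C * (scale_const (DIM('a)) \<alpha> * r powr \<alpha>) * vol_ball x r)"
  unfolding size_bound_def by (simp only: scaled_mean_le_iff cong: imp_cong)

lemma osc_bound_mono: "osc_bound \<alpha> f C \<Longrightarrow> C \<le> C' \<Longrightarrow> osc_bound \<alpha> f C'"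
  unfolding osc_bound_def by (meson order_trans)

lemma size_bound_mono: "size_bound \<rho> \<alpha> f C \<Longrightarrow> C \<le> C' \<Longrightarrow> size_bound \<rho> \<alpha> f C'"
  unfolding size_bound_def by (meson order_trans)

text \<open>
  The John--Nirenberg inequality is local: on the balls of radius at most \<open>2 * r\<close> a function of \<open>BMO\<^sup>\<alpha>\<close>
  has mean oscillation \<open>O(r powr \<alpha>)\<close>.  This covers \<open>\<alpha> > 0\<close> without passing through Hoelder continuity.
\<close>

lemma Campanato_power_mean:
  assumes "\<alpha> \<ge> 0" "q > 0"
  obtains C where "C > 0" "\<And>(f :: 'a::euclidean_space \<Rightarrow> complex) A x r.
    loc_integrable f \<Longrightarrow> osc_bound \<alpha> f A \<Longrightarrow> A > 0 \<Longrightarrow> r > 0 \<Longrightarrow>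
      Lq_mean_le q (\<lambda>y. f y - avg f x r) x r (C * A * r powr \<alpha>)"
proof
  let ?d = "DIM('a)"
  let ?C = "JN_power_const ?d q * (scale_const ?d \<alpha> * 2 powr \<alpha>) + 1"
  show "?C > 0" using JN_power_const_nonneg[of ?d q] scale_const_pos[of ?d \<alpha>]
    by (intro add_nonneg_pos mult_nonneg_nonneg) (auto simp: less_imp_le)
  fix f :: "'a \<Rightarrow> complex" and A r :: real and x :: 'a
  assume *: "loc_integrable f" "osc_bound \<alpha> f A" "A > 0" "r > 0"
  define B where "B = A * (scale_const ?d \<alpha> * (2 * r) powr \<alpha>)"
  have "B > 0" using * scale_const_pos by (simp add: B_def)
  have osc: "(LINT y:ball x s|lebesgue. norm (f y - avg f x s)) \<le> B * vol_ball x s"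
    if "0 < s" "s \<le> 2 * r" for x s
  proof -
    have "(LINT y:ball x s|lebesgue. norm (f y - avg f x s)) \<le> A * (scale_const ?d \<alpha> * s powr \<alpha>) * vol_ball x s"
      using * that by (simp add: osc_bound_iff)
    also have "\<dots> \<le> B * vol_ball x s" unfolding B_def
      using * that assms scale_const_pos[of ?d \<alpha>]
      by (intro mult_right_mono mult_left_mono powr_mono2) (auto simp: less_imp_le)
    finally show ?thesis .
  qed
  have "Lq_mean_le q (\<lambda>y. f y - avg f x r) x r (JN_power_const ?d q * B)"
    by (rule John_Nirenberg[OF *(1) \<open>B > 0\<close>, where R="2*r"]) (use osc * assms in auto)
  moreover have "JN_power_const ?d q * B \<le> ?C * A * r powr \<alpha>"
    using * by (simp add: B_def powr_mult algebra_simps)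
  ultimately show "Lq_mean_le q (\<lambda>y. f y - avg f x r) x r (?C * A * r powr \<alpha>)"
    using assms by (rule_tac Lq_mean_le_mono)
qed

text \<open>
  The number \<open>r powr \<alpha> * dyadic_sum \<alpha> k\<close> bounds, up to a constant, the change of the mean of a function of
  \<open>BMO\<^sup>\<alpha>\<close> from a ball of radius \<open>r\<close> to its dilate by \<open>2 ^ k\<close>.
\<close>

definition dyadic_sum :: "real \<Rightarrow> nat \<Rightarrow> real" where
  "dyadic_sum \<alpha> k = (\<Sum>j\<le>k. (2 powr \<alpha>) ^ j)"

lemma two_powr_pow: "(2 powr \<alpha>) ^ k * r powr \<alpha> = (2 ^ k * r) powr (\<alpha>::real)"
  by (simp add: powr_mult powr_powr mult.commute flip: powr_realpow)

lemma dyadic_sum_ge: "(2 powr \<alpha>) ^ k \<le> dyadic_sum \<alpha> k"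
  unfolding dyadic_sum_def by (rule member_le_sum) auto

lemma dyadic_sum_pos: "dyadic_sum \<alpha> k > 0"
  using dyadic_sum_ge[of \<alpha> k] by (smt (verit) powr_gt_zero zero_less_power)

lemma dyadic_sum_le:
  assumes "\<alpha> \<ge> 0" shows "dyadic_sum \<alpha> k \<le> (real k + 1) * (2 powr \<alpha>) ^ k"
proof -
  have "dyadic_sum \<alpha> k \<le> (\<Sum>j\<le>k. (2 powr \<alpha>) ^ k)"
    unfolding dyadic_sum_def using assms by (intro sum_mono power_increasing) (auto simp: ge_one_powr_ge_zero)
  thus ?thesis by (simp add: algebra_simps)
qed

lemma avg_dyadic_growth:
  fixes f :: "'a::euclidean_space \<Rightarrow> complex"
  assumes f: "loc_integrable f" "osc_bound \<alpha> f A" "A > 0" "r > 0"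
  shows "norm (avg f x (2 ^ k * r) - avg f x r)
     \<le> 2 ^ DIM('a) * 2 powr \<alpha> * scale_const (DIM('a)) \<alpha> * A * r powr \<alpha> * dyadic_sum \<alpha> k"
proof -
  let ?d = "DIM('a)"
  define c where "c = 2 ^ ?d * 2 powr \<alpha> * scale_const ?d \<alpha> * A"
  have c: "c > 0" using f scale_const_pos by (simp add: c_def)
  have fi: "set_integrable lebesgue (ball x r) f" for x r using f by (simp add: loc_integrable_def)
  have step: "norm (avg f x (2 * s) - avg f x s) \<le> c * s powr \<alpha>" if "s > 0" for s
  proof -
    have "norm (avg f x s - avg f x (2 * s)) * vol_ball x s \<le> (LINT y:ball x s|lebesgue. norm (f y - avg f x (2 * s)))"
      using fi that by (intro avg_dist_le)
    also have "\<dots> \<le> (LINT y:ball x (2 * s)|lebesgue. norm (f y - avg f x (2 * s)))"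
      using that fi by (intro set_integral_mono_set_nonneg set_integrable_norm set_integral_diff) auto
    also have "\<dots> \<le> A * (scale_const ?d \<alpha> * (2 * s) powr \<alpha>) * vol_ball x (2 * s)"
      using f that by (simp add: osc_bound_iff)
    also have "vol_ball x (2 * s) = 2 ^ ?d * vol_ball x s" using that by (intro vol_ball_scale) auto
    also have "A * (scale_const ?d \<alpha> * (2 * s) powr \<alpha>) * (2 ^ ?d * vol_ball x s) = c * s powr \<alpha> * vol_ball x s"
      using that by (simp add: c_def powr_mult)
    finally show ?thesis using vol_ball_pos[OF that, of x] by (simp add: norm_minus_commute)
  qed
  have "norm (avg f x (2 ^ k * r) - avg f x r) \<le> c * r powr \<alpha> * (\<Sum>j<k. (2 powr \<alpha>) ^ j)"
  proof (induction k)
    case (Suc k)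
    have "norm (avg f x (2 ^ Suc k * r) - avg f x r)
       \<le> norm (avg f x (2 * (2 ^ k * r)) - avg f x (2 ^ k * r)) + norm (avg f x (2 ^ k * r) - avg f x r)"
      using norm_triangle_ineq[of "avg f x (2 * (2 ^ k * r)) - avg f x (2 ^ k * r)" "avg f x (2 ^ k * r) - avg f x r"]
      by (simp add: mult.assoc)
    also have "\<dots> \<le> c * (2 ^ k * r) powr \<alpha> + c * r powr \<alpha> * (\<Sum>j<k. (2 powr \<alpha>) ^ j)"
      using f by (intro add_mono step Suc) auto
    also have "\<dots> = c * r powr \<alpha> * (\<Sum>j<Suc k. (2 powr \<alpha>) ^ j)"
      by (simp only: two_powr_pow[symmetric] sum.lessThan_Suc) (simp add: algebra_simps)
    finally show ?case .
  qed simp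
  also have "\<dots> \<le> c * r powr \<alpha> * dyadic_sum \<alpha> k"
    unfolding dyadic_sum_def using c by (intro mult_left_mono sum_mono2) auto
  finally show ?thesis by (simp add: c_def)
qed

lemma Campanato_growth:
  assumes "\<alpha> \<ge> 0" "q \<ge> 1"
  obtains C where "C > 0" "\<And>(f :: 'a::euclidean_space \<Rightarrow> complex) A x r k.
    loc_integrable f \<Longrightarrow> osc_bound \<alpha> f A \<Longrightarrow> A > 0 \<Longrightarrow> r > 0 \<Longrightarrow>
      Lq_mean_le q (\<lambda>y. f y - avg f x r) x (2 ^ k * r) (C * A * r powr \<alpha> * (real k + 1) * (2 powr \<alpha>) ^ k)"
proof -
  let ?d = "DIM('a)"
  have "q > 0" using assms by simp
  obtain C0 where C0: "C0 > 0" and C0': "\<And>(f :: 'a \<Rightarrow> complex) A x r.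
    loc_integrable f \<Longrightarrow> osc_bound \<alpha> f A \<Longrightarrow> A > 0 \<Longrightarrow> r > 0 \<Longrightarrow>
      Lq_mean_le q (\<lambda>y. f y - avg f x r) x r (C0 * A * r powr \<alpha>)"
    using Campanato_power_mean[OF assms(1) \<open>q > 0\<close>, where 'a='a] by metis
  define c where "c = 2 ^ ?d * 2 powr \<alpha> * scale_const ?d \<alpha>"
  have c: "c > 0" using scale_const_pos by (simp add: c_def)
  show ?thesis
  proof (rule that[of "4 * (C0 + c)"])
    show "4 * (C0 + c) > 0" using C0 c by simp
    fix f :: "'a \<Rightarrow> complex" and A r :: real and x :: 'a and k :: nat
    assume f: "loc_integrable f" "osc_bound \<alpha> f A" "A > 0" "r > 0"
    let ?D = "A * r powr \<alpha> * ((real k + 1) * (2 powr \<alpha>) ^ k)"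
    have R: "2 ^ k * r > 0" using f by simp
    have 1: "Lq_mean_le q (\<lambda>y. f y - avg f x (2^k * r)) x (2^k * r) (C0 * ?D)"
    proof (rule Lq_mean_le_mono[OF C0'[OF f(1-3) R] _ \<open>q > 0\<close>])
      have "C0 * A * (2 ^ k * r) powr \<alpha> = C0 * (A * r powr \<alpha> * (1 * (2 powr \<alpha>) ^ k))"
        by (simp add: two_powr_pow[symmetric])
      also have "\<dots> \<le> C0 * ?D" using C0 f by (intro mult_left_mono mult_right_mono) auto
      finally show "C0 * A * (2 ^ k * r) powr \<alpha> \<le> C0 * ?D" .
    qed
    have "norm (avg f x (2 ^ k * r) - avg f x r) \<le> c * A * r powr \<alpha> * dyadic_sum \<alpha> k"
      using avg_dyadic_growth[OF f] by (simp add: c_def)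
    also have "\<dots> \<le> c * A * r powr \<alpha> * ((real k + 1) * (2 powr \<alpha>) ^ k)"
      using c f by (intro mult_left_mono dyadic_sum_le assms) auto
    finally have "norm (avg f x (2 ^ k * r) - avg f x r) \<le> c * ?D" by (simp add: mult_ac)
    hence 2: "Lq_mean_le q (\<lambda>y. avg f x (2^k * r) - avg f x r) x (2^k * r) (c * ?D)"
      using \<open>q > 0\<close> Lq_mean_le_const Lq_mean_le_mono by blast
    show "Lq_mean_le q (\<lambda>y. f y - avg f x r) x (2 ^ k * r) (4 * (C0 + c) * A * r powr \<alpha> * (real k + 1) * (2 powr \<alpha>) ^ k)"
      using Lq_mean_le_add[OF 1 2 assms(2)] by (simp add: algebra_simps)
  qed
qed

text \<open>
  The means are followed from the ball of radius \<open>r\<close> up to the first dyadic dilate of supercritical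
  radius, to which the size condition applies.
\<close>

lemma Campanato_avg_small_ball:
  fixes f :: "'a::euclidean_space \<Rightarrow> complex"
  assumes f: "loc_integrable f" "osc_bound \<alpha> f A" "size_bound \<rho> \<alpha> f A" "A > 0" "r > 0"
    and m: "\<rho> x < 2 ^ (m + 1) * r" and al: "\<alpha> \<ge> 0"
  shows "norm (avg f x r) \<le> (2 ^ DIM('a) + 1) * 2 powr \<alpha> * (2 + 2 powr \<alpha>) * scale_const (DIM('a)) \<alpha> * A * r powr \<alpha> * dyadic_sum \<alpha> m"
proof -
  let ?d = "DIM('a)"
  define R where "R = 2 ^ (m + 1) * r"
  define s where "s = scale_const ?d \<alpha> * A * r powr \<alpha>"
  have s: "s \<ge> 0" using f scale_const_pos[of ?d \<alpha>] by (simp add: s_def)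
  have R: "R > 0" using f by (simp add: R_def)
  have "norm (avg f x R) * vol_ball x R \<le> (LINT y:ball x R|lebesgue. norm (f y))"
    using avg_dist_le[of x R f 0] f R by (simp add: loc_integrable_def)
  also have "\<dots> \<le> A * (scale_const ?d \<alpha> * R powr \<alpha>) * vol_ball x R"
    using f m R by (auto simp: size_bound_iff R_def)
  finally have "norm (avg f x R) \<le> A * (scale_const ?d \<alpha> * R powr \<alpha>)"
    using vol_ball_pos[OF R, of x] by simp
  also have "\<dots> = s * (2 powr \<alpha> * (2 powr \<alpha>) ^ m)"
    by (simp add: R_def s_def two_powr_pow[symmetric, of "m+1", simplified])
  also have "\<dots> \<le> s * (2 powr \<alpha> * dyadic_sum \<alpha> m)"
    using s by (intro mult_left_mono dyadic_sum_ge) auto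
  finally have 1: "norm (avg f x R) \<le> s * (2 powr \<alpha> * dyadic_sum \<alpha> m)" .
  have ds: "dyadic_sum \<alpha> (m + 1) \<le> (1 + 2 powr \<alpha>) * dyadic_sum \<alpha> m"
    using mult_left_mono[OF dyadic_sum_ge[of \<alpha> m], of "2 powr \<alpha>"] by (simp add: dyadic_sum_def algebra_simps)
  have "norm (avg f x R - avg f x r) \<le> 2 ^ ?d * 2 powr \<alpha> * s * dyadic_sum \<alpha> (m + 1)"
    using avg_dyadic_growth[OF f(1,2,4,5), of x "m+1"] by (simp add: R_def s_def mult_ac)
  also have "\<dots> \<le> 2 ^ ?d * 2 powr \<alpha> * s * ((1 + 2 powr \<alpha>) * dyadic_sum \<alpha> m)"
    using s ds by (intro mult_left_mono) auto
  finally have "norm (avg f x r) \<le> s * (2 powr \<alpha> * dyadic_sum \<alpha> m) + 2 ^ ?d * 2 powr \<alpha> * s * ((1 + 2 powr \<alpha>) * dyadic_sum \<alpha> m)"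
    using 1 norm_triangle_ineq4[of "avg f x R" "avg f x R - avg f x r"] by simp
  also have "\<dots> = (1 + 2 ^ ?d * (1 + 2 powr \<alpha>)) * (2 powr \<alpha> * s * dyadic_sum \<alpha> m)"
    by (simp add: algebra_simps)
  also have "\<dots> \<le> (2 ^ ?d + 1) * (2 + 2 powr \<alpha>) * (2 powr \<alpha> * s * dyadic_sum \<alpha> m)"
    using s dyadic_sum_pos[of \<alpha> m] by (intro mult_right_mono) (auto simp: algebra_simps)
  finally show ?thesis by (simp add: s_def mult_ac)
qed

text \<open>
  The bounds on the mean of a function of \<open>BMO\<^sub>L\<^sup>\<alpha>\<close> over a ball of radius \<open>r < \<rho>\<close>, with \<open>t = \<rho> / r\<close>.  Treating
  all such weights at once makes the logarithmic and the power condition instances of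
  one statement.
\<close>

definition dyadic_weight :: "real \<Rightarrow> (real \<Rightarrow> real) \<Rightarrow> bool" where
  "dyadic_weight \<alpha> w \<longleftrightarrow> (\<exists>c>0. \<forall>m t. m \<ge> 1 \<and> 2 ^ m \<le> t \<and> t < 2 ^ (m + 1) \<longrightarrow>
      w t \<ge> 0 \<and> dyadic_sum \<alpha> m \<le> c * w t \<and> w t \<le> c * dyadic_sum \<alpha> m)"

lemma dyadic_weight_ln: "dyadic_weight 0 ln"
  unfolding dyadic_weight_def
proof (intro exI[of _ "2 / ln 2"] conjI allI impI)
  fix m :: nat and t :: real
  assume *: "m \<ge> 1 \<and> 2 ^ m \<le> t \<and> t < 2 ^ (m + 1)"
  have t: "t \<ge> 1" using * by (meson one_le_numeral one_le_power order_trans)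
  have l2: "0 < ln (2::real)" "ln (2::real) \<le> 1" using ln_2_less_1 by auto
  have ds: "dyadic_sum 0 m = real m + 1" by (simp add: dyadic_sum_def)
  have "real m * ln 2 = ln (2 ^ m)" by (simp add: ln_realpow)
  also have "\<dots> \<le> ln t" using * t by (subst ln_le_cancel_iff) auto
  finally have 1: "real m * ln 2 \<le> ln t" .
  have "ln t \<le> ln (2 ^ (m + 1))" using * t by (subst ln_le_cancel_iff) auto
  also have "\<dots> = real (m + 1) * ln 2" by (rule ln_realpow)
  finally have 2: "ln t \<le> (real m + 1) * ln 2" by (simp add: add.commute)
  show "0 \<le> ln t" using t by simp
  have "real m + 1 \<le> 2 * real m" using * by simp
  also have "\<dots> \<le> 2 / ln 2 * ln t" using 1 l2 by (simp add: field_simps)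
  finally show "dyadic_sum 0 m \<le> 2 / ln 2 * ln t" by (simp add: ds)
  have "(real m + 1) * ln 2 \<le> (real m + 1) * 1" using l2 by (intro mult_left_mono) auto
  moreover have "1 * (real m + 1) \<le> 2 / ln 2 * (real m + 1)" using l2 by (intro mult_right_mono) auto
  ultimately show "ln t \<le> 2 / ln 2 * dyadic_sum 0 m" using 2 unfolding ds by linarith
qed simp

lemma dyadic_weight_powr:
  assumes "\<alpha> > 0" shows "dyadic_weight \<alpha> (\<lambda>t. t powr \<alpha>)"
proof -
  let ?b = "2 powr \<alpha>"
  have b: "?b > 1" using assms by simp
  define c where "c = ?b / (?b - 1) + ?b"
  show ?thesis unfolding dyadic_weight_def
  proof (intro exI[of _ c] conjI allI impI)
    show "c > 0" using b by (simp add: c_def add_pos_pos)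
    fix m :: nat and t :: real
    assume *: "m \<ge> 1 \<and> 2 ^ m \<le> t \<and> t < 2 ^ (m + 1)"
    have t: "t \<ge> 1" using * by (meson one_le_numeral one_le_power order_trans)
    have bt: "?b ^ m \<le> t powr \<alpha>"
      using two_powr_pow[of \<alpha> m 1] powr_mono2[of \<alpha> "2 ^ m" t] * assms by simp
    have tb: "t powr \<alpha> \<le> ?b * ?b ^ m"
      using two_powr_pow[of \<alpha> "m+1" 1] powr_mono2[of \<alpha> t "2 ^ (m+1)"] * assms t by simp
    have "dyadic_sum \<alpha> m = (?b ^ Suc m - 1) / (?b - 1)"
      unfolding dyadic_sum_def lessThan_Suc_atMost[symmetric] using b by (subst geometric_sum) auto
    also have "\<dots> \<le> ?b ^ Suc m / (?b - 1)" using b by (intro divide_right_mono) auto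
    also have "\<dots> = ?b / (?b - 1) * ?b ^ m" by simp
    also have "\<dots> \<le> c * t powr \<alpha>" using b bt by (intro mult_mono) (auto simp: c_def)
    finally show "dyadic_sum \<alpha> m \<le> c * t powr \<alpha>" .
    have "?b * ?b ^ m \<le> c * dyadic_sum \<alpha> m"
      using b dyadic_sum_ge[of \<alpha> m] by (intro mult_mono) (auto simp: c_def)
    thus "t powr \<alpha> \<le> c * dyadic_sum \<alpha> m" using tb by simp
    show "t powr \<alpha> \<ge> 0" by simp
  qed
qed

section \<open>Integrals over dyadic annuli\<close>

lemma annulus_measurable [simp]: "annulus x s t \<in> sets lebesgue"
proof -
  have "open (annulus x s t)" unfolding annulus_def
    by (intro open_Collect_conj open_Collect_less continuous_intros)
  thus ?thesis by (force intro: lborelD)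
qed

text \<open>
  Hoelder's inequality on each annulus.  The factor \<open>2 powr (d / q)\<close> comes from comparing the annulus with the ball
  that it surrounds for \<open>\<kappa>\<close>, but with the ball that contains it for \<open>h\<close>.
\<close>

lemma annuli_integral:
  fixes \<kappa> h :: "'a::euclidean_space \<Rightarrow> complex"
  assumes pq: "p > 1" "q > 1" "1/p + 1/q = 1" and s: "s > 0"
    and k1: "\<And>k. in_Lp p (annulus x (2 ^ k * s) (2 ^ (k + 1) * s)) \<kappa>"
    and k2: "\<And>k. Lp_norm p (annulus x (2 ^ k * s) (2 ^ (k + 1) * s)) \<kappa> \<le> a k * vol_ball x (2 ^ k * s) powr (- 1 / q)"
    and h: "\<And>k. Lq_mean_le q h x (2 ^ (k + 1) * s) (M k)"
    and sm: "summable (\<lambda>k. a k * M k)" and a: "\<And>k. a k \<ge> 0"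
  shows "set_integrable lebesgue (- ball x s) (\<lambda>y. \<kappa> y * h y)"
    and "(LINT y:- ball x s|lebesgue. norm (\<kappa> y * h y)) \<le> (2 ^ DIM('a)) powr (1 / q) * (\<Sum>k. a k * M k)"
proof -
  define A where "A k = annulus x (2 ^ k * s) (2 ^ (k + 1) * s)" for k
  define c where "c = ((2::real) ^ DIM('a)) powr (1 / q)"
  have c: "c > 0" by (simp add: c_def)
  define F where "F k y = indicator (A k) y *\<^sub>R (\<kappa> y * h y)" for k y
  have AB: "A k \<subseteq> ball x (2 ^ (k + 1) * s)" for k
    by (auto simp: A_def annulus_def dist_commute)
  have hL: "in_Lp q (A k) h" for k
    by (rule in_Lp_subset[OF _ _ AB]) (use h[of k] in \<open>auto simp: Lq_mean_le_def A_def\<close>)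
  have kL: "in_Lp p (A k) \<kappa>" for k using k1 by (simp add: A_def)
  have Fint: "integrable lebesgue (F k)" for k
    using Holder_inequality_set(1)[OF pq kL hL, of k] unfolding F_def set_integrable_def .
  have Fn: "(LINT y|lebesgue. norm (F k y)) \<le> c * (a k * M k)" for k
  proof -
    let ?v = "vol_ball x (2 ^ k * s)"
    have v: "?v > 0" using s by (intro vol_ball_pos) auto
    have M: "M k \<ge> 0" using h by (simp add: Lq_mean_le_def)
    have hn: "Lp_norm q (A k) h \<le> M k * (c * ?v powr (1 / q))"
    proof -
      have "Lp_norm q (A k) h \<le> Lp_norm q (ball x (2 ^ (k + 1) * s)) h"
        unfolding Lp_norm_def using h[of k] AB[of k] pq
        by (intro powr_mono2 set_integral_mono_set_nonneg set_integral_nonneg) (auto simp: Lq_mean_le_def in_Lp_def A_def)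
      also have "\<dots> \<le> M k * vol_ball x (2 ^ (k + 1) * s) powr (1 / q)"
        using h pq by (intro Lq_mean_le_norm) auto
      also have "vol_ball x (2 ^ (k + 1) * s) = 2 ^ DIM('a) * ?v"
        using vol_ball_scale[of "2 ^ k * s" 2 x x] s by (simp add: mult.assoc)
      finally show ?thesis using v by (simp add: powr_mult c_def)
    qed
    have "(LINT y|lebesgue. norm (F k y)) = (LINT y:A k|lebesgue. norm (\<kappa> y * h y))"
      unfolding set_lebesgue_integral_def F_def
      by (intro Bochner_Integration.integral_cong) (auto simp: indicator_def)
    also have "\<dots> \<le> Lp_norm p (A k) \<kappa> * Lp_norm q (A k) h"
      by (rule Holder_inequality_set(2)[OF pq kL hL])
    also have "\<dots> \<le> (a k * ?v powr (- 1 / q)) * (M k * (c * ?v powr (1 / q)))"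
      using k2 hn a v by (intro mult_mono) (auto simp: A_def)
    also have "\<dots> = c * (a k * M k) * (?v powr (- 1 / q) * ?v powr (1 / q))" by simp
    also have "?v powr (- 1 / q) * ?v powr (1 / q) = 1"
      using v by (simp add: powr_minus_divide flip: powr_add)
    finally show ?thesis by simp
  qed
  have disj: "F j y = 0" if "y \<in> A k" "j \<noteq> k" for j k y
  proof -
    have "\<not> y \<in> A j"
    proof
      assume "y \<in> A j"
      hence "2 ^ j * s < 2 ^ (k + 1) * s" "2 ^ k * s < 2 ^ (j + 1) * s"
        using that by (auto simp: A_def annulus_def)
      hence "(2::real) ^ j < 2 ^ (k + 1)" "(2::real) ^ k < 2 ^ (j + 1)" using s by (auto simp del: power_Suc power_add)
      hence "j < k + 1" "k < j + 1" by (meson one_less_numeral_iff power_strict_increasing_iff semiring_norm(76))+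
      thus False using that by simp
    qed
    thus ?thesis by (simp add: F_def)
  qed
  have sums: "(\<lambda>k. F k y) sums (indicator (\<Union>k. A k) y *\<^sub>R (\<kappa> y * h y))"
     "(\<lambda>k. norm (F k y)) sums norm (indicator (\<Union>k. A k) y *\<^sub>R (\<kappa> y * h y))" for y
  proof -
    have "(\<lambda>k. F k y) sums (indicator (\<Union>k. A k) y *\<^sub>R (\<kappa> y * h y)) \<and>
     (\<lambda>k. norm (F k y)) sums norm (indicator (\<Union>k. A k) y *\<^sub>R (\<kappa> y * h y))"
    proof (cases "y \<in> (\<Union>k. A k)")
      case True
      then obtain k where k: "y \<in> A k" by auto
      hence "indicator (\<Union>k. A k) y *\<^sub>R (\<kappa> y * h y) = F k y" using True by (simp add: F_def)
      thus ?thesis using sums_finite[of "{k}" "\<lambda>k. F k y"] sums_finite[of "{k}" "\<lambda>k. norm (F k y)"] disj[OF k] by auto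
    next
      case False
      hence "F k y = 0" for k by (auto simp: F_def)
      thus ?thesis using False by simp
    qed
    thus "(\<lambda>k. F k y) sums (indicator (\<Union>k. A k) y *\<^sub>R (\<kappa> y * h y))"
     "(\<lambda>k. norm (F k y)) sums norm (indicator (\<Union>k. A k) y *\<^sub>R (\<kappa> y * h y))" by auto
  qed
  have s1: "AE y in lebesgue. summable (\<lambda>k. norm (F k y))" using sums(2) by (auto simp: sums_iff)
  have s3: "summable (\<lambda>k. c * (a k * M k))" using sm by (rule summable_mult)
  have s2: "summable (\<lambda>k. LINT y|lebesgue. norm (F k y))"
    by (rule summable_comparison_test'[OF s3, of 0]) (use Fn in auto)
  have I: "integrable lebesgue (\<lambda>y. indicator (\<Union>k. A k) y *\<^sub>R (\<kappa> y * h y))"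
    using integrable_suminf[OF Fint s1 s2] sums(1) by (simp add: sums_iff)
  have "(LINT y|lebesgue. norm (indicator (\<Union>k. A k) y *\<^sub>R (\<kappa> y * h y))) = (LINT y|lebesgue. (\<Sum>k. norm (F k y)))"
    using sums(2) by (simp add: sums_iff)
  also have "\<dots> = (\<Sum>k. LINT y|lebesgue. norm (F k y))"
    using Fint s1 s2 by (intro integral_suminf) auto
  also have "\<dots> \<le> (\<Sum>k. c * (a k * M k))" by (intro suminf_le Fn s2 s3)
  also have "\<dots> = c * (\<Sum>k. a k * M k)" using sm by (simp add: suminf_mult)
  finally have N: "(LINT y|lebesgue. norm (indicator (\<Union>k. A k) y *\<^sub>R (\<kappa> y * h y))) \<le> c * (\<Sum>k. a k * M k)" .
  \<comment> \<open>the annuli exhaust the complement of the ball up to countably many spheres\<close>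
  have cover: "y \<in> (\<Union>k. A k)" if "y \<notin> ball x s" "y \<notin> (\<Union>k. sphere x (2 ^ k * s))" for y
  proof -
    define d where "d = dist y x"
    have d: "d \<ge> s" using that(1) by (simp add: d_def dist_commute)
    obtain N where "d / s < 2 ^ N" using real_arch_pow[of 2 "d / s"] by auto
    hence ex: "\<exists>n. d < 2 ^ n * s" using s by (auto simp: field_simps intro!: exI[of _ N])
    define k where "k = (LEAST n. d < 2 ^ n * s)"
    have k: "d < 2 ^ k * s" unfolding k_def using ex by (rule LeastI_ex)
    have "k \<noteq> 0" using k d by (intro notI) auto
    then obtain j where j: "k = Suc j" by (cases k) auto
    have "\<not> d < 2 ^ j * s" using not_less_Least[of j "\<lambda>n. d < 2 ^ n * s"] j by (simp add: k_def)
    moreover have "d \<noteq> 2 ^ j * s" using that(2) by (auto simp: d_def dist_commute)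
    ultimately have "y \<in> A j" using k j by (simp add: A_def annulus_def d_def)
    thus ?thesis by auto
  qed
  have Asub: "A k \<inter> ball x s = {}" for k
  proof -
    have "s \<le> 2 ^ k * s" using s by (simp add: )
    thus ?thesis by (auto simp: A_def annulus_def dist_commute)
  qed
  have "(\<Union>k. sphere x (2 ^ k * s)) \<in> null_sets lebesgue"
    using negligible_iff_null_sets negligible_sphere by (intro null_sets_UN) blast
  hence "AE y in lebesgue. y \<notin> (\<Union>k. sphere x (2 ^ k * s))" by (rule AE_not_in)
  hence AEe: "AE y in lebesgue. indicator (\<Union>k. A k) y *\<^sub>R (\<kappa> y * h y) = indicator (- ball x s) y *\<^sub>R (\<kappa> y * h y)"
  proof eventually_elim
    case (elim y)
    have "y \<in> (\<Union>k. A k) \<longleftrightarrow> y \<in> - ball x s" using cover[of y] elim Asub by blast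
    thus ?case by (simp only: indicator_def)
  qed
  have m: "(\<lambda>y. indicator (- ball x s) y *\<^sub>R (\<kappa> y * h y)) \<in> borel_measurable lebesgue"
    using borel_measurable_integrable[OF I] AEe by (rule borel_measurable_lebesgue_AE)
  show "set_integrable lebesgue (- ball x s) (\<lambda>y. \<kappa> y * h y)"
    unfolding set_integrable_def
    by (rule iffD1[OF integrable_cong_AE[OF borel_measurable_integrable[OF I] m AEe] I])
  have "(LINT y:- ball x s|lebesgue. norm (\<kappa> y * h y)) = (LINT y|lebesgue. norm (indicator (- ball x s) y *\<^sub>R (\<kappa> y * h y)))"
    unfolding set_lebesgue_integral_def
    by (intro Bochner_Integration.integral_cong) (auto simp: indicator_def)
  also have "\<dots> = (LINT y|lebesgue. norm (indicator (\<Union>k. A k) y *\<^sub>R (\<kappa> y * h y)))"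
  proof (rule integral_cong_AE)
    show "(\<lambda>y. norm (indicator (- ball x s) y *\<^sub>R (\<kappa> y * h y))) \<in> borel_measurable lebesgue"
      by (rule measurable_compose[OF m borel_measurable_norm])
    show "(\<lambda>y. norm (indicator (\<Union>k. A k) y *\<^sub>R (\<kappa> y * h y))) \<in> borel_measurable lebesgue"
      by (rule measurable_compose[OF borel_measurable_integrable[OF I] borel_measurable_norm])
    show "AE y in lebesgue. norm (indicator (- ball x s) y *\<^sub>R (\<kappa> y * h y)) = norm (indicator (\<Union>k. A k) y *\<^sub>R (\<kappa> y * h y))"
      using AEe by eventually_elim (simp only:)
  qed
  also note N
  finally show "(LINT y:- ball x s|lebesgue. norm (\<kappa> y * h y)) \<le> (2 ^ DIM('a)) powr (1 / q) * (\<Sum>k. a k * M k)"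
    by (simp add: c_def)
qed

section \<open>The critical radius\<close>

text \<open>
  Hoelder's inequality turns the reverse Hoelder condition into a power-law bound on the mass of subsets,
  uniformly for finite and infinite \<open>\<sigma>\<close>.  The exponent \<open>\<beta>\<close> is \<open>1 - 1 / \<sigma>\<close>.
\<close>

lemma reverse_Holder_subset_mass:
  fixes V :: "'a::euclidean_space \<Rightarrow> real"
  assumes RH: "reverse_Holder \<sigma> V" and g: "0 < \<gamma>" "ereal \<gamma> < 2 - ereal (real DIM('a)) / \<sigma>"
  obtains C \<beta> where "C > 0" "\<beta> > 0" "real DIM('a) * \<beta> > real DIM('a) - 2"
    "\<And>x r E. r > 0 \<Longrightarrow> E \<in> sets lebesgue \<Longrightarrow> E \<subseteq> ball x r \<Longrightarrow>
       (LINT y:E|lebesgue. V y) \<le> C * (measure lebesgue E / vol_ball x r) powr \<beta> * (LINT y:ball x r|lebesgue. V y)"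
proof -
  have V0: "AE x in lebesgue. 0 \<le> V x" and Vl: "loc_integrable V" and \<sigma>1: "1 < \<sigma>"
    using RH by (auto simp: reverse_Holder_def)
  have Vi: "set_integrable lebesgue (ball x r) V" for x r using Vl by (simp add: loc_integrable_def)
  have Vm: "V \<in> borel_measurable lebesgue" by (rule loc_integrable_measurable[OF Vl])
  have I0: "(LINT y:ball x r|lebesgue. V y) \<ge> 0" for x r
    unfolding set_lebesgue_integral_def using V0
    by (intro integral_nonneg_AE) (auto elim!: eventually_mono simp: indicator_def)
  have fin: "E \<in> lmeasurable" if "E \<in> sets lebesgue" "E \<subseteq> ball x r" for E :: "'a set" and x r
    using that by (meson bounded_ball bounded_subset bounded_set_imp_lmeasurable)
  have Ei: "integrable lebesgue (indicat_real E)" if "E \<in> lmeasurable" for E :: "'a set"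
    by (intro integrable_real_indicator) (use that in \<open>auto simp: fmeasurable_def\<close>)
  show ?thesis
  proof (cases "\<sigma> = \<infinity>")
    case True
    obtain C where C: "\<And>x r. r > 0 \<Longrightarrow> esssup (lebesgue_on (ball x r)) (\<lambda>y. ereal (V y)) \<le> ereal (C * avg V x r)"
      using RH True by (auto simp: reverse_Holder_def)
    show ?thesis
    proof (rule that[of "max C 1" 1])
      fix x :: 'a and r :: real and E :: "'a set"
      assume r: "r > 0" and E: "E \<in> sets lebesgue" "E \<subseteq> ball x r"
      have "AE y in lebesgue_on (ball x r). ereal (V y) \<le> esssup (lebesgue_on (ball x r)) (\<lambda>y. ereal (V y))"
        by (rule esssup_AE)
      hence "AE y in lebesgue_on (ball x r). ereal (V y) \<le> ereal (C * avg V x r)"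
        by eventually_elim (use C[OF r, of x] order_trans in blast)
      hence "AE y in lebesgue. y \<in> ball x r \<longrightarrow> V y \<le> C * avg V x r"
        by (simp add: AE_restrict_space_iff)
      hence "AE y in lebesgue. y \<in> E \<longrightarrow> V y \<le> C * avg V x r" by eventually_elim (use E in auto)
      hence "(LINT y:E|lebesgue. V y) \<le> (LINT y:E|lebesgue. C * avg V x r)"
        using set_integrable_subset[OF Vi E] set_integrable_subset[OF set_integrable_const_ball E]
        by (intro set_integral_mono_AE) auto
      also have "\<dots> = C * avg V x r * measure lebesgue E"
        using Ei[OF fin[OF E]] by (simp add: set_lebesgue_integral_def)
      also have "\<dots> = C * ((measure lebesgue E / vol_ball x r) * (LINT y:ball x r|lebesgue. V y))"
        by (simp add: avg_def)
      also have "\<dots> \<le> max C 1 * ((measure lebesgue E / vol_ball x r) * (LINT y:ball x r|lebesgue. V y))"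
        using I0[of x r] by (intro mult_right_mono mult_nonneg_nonneg divide_nonneg_nonneg) auto
      finally show "(LINT y:E|lebesgue. V y) \<le> max C 1 * (measure lebesgue E / vol_ball x r) powr 1 * (LINT y:ball x r|lebesgue. V y)"
        by (simp add: mult.assoc)
    qed auto
  next
    case False
    then obtain s where s: "\<sigma> = ereal s" "s > 1" using \<sigma>1 by (cases \<sigma>) auto
    define \<beta> where "\<beta> = 1 - 1 / s"
    define q where "q = s / (s - 1)"
    have q: "q > 1" "1 / s + 1 / q = 1" "1 / q = \<beta>" using s by (auto simp: q_def \<beta>_def field_simps)
    have \<beta>: "\<beta> > 0" using s by (simp add: \<beta>_def)
    obtain C where C: "\<And>x r. r > 0 \<Longrightarrow> set_integrable lebesgue (ball x r) (\<lambda>y. V y powr s)"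
       "\<And>x r. r > 0 \<Longrightarrow> avg (\<lambda>y. V y powr s) x r powr (1 / s) \<le> C * avg V x r"
      using RH s by (auto simp: reverse_Holder_def)
    have "\<gamma> < 2 - real DIM('a) / s" using g s by simp
    hence nb: "real DIM('a) * \<beta> > real DIM('a) - 2" using g by (simp add: \<beta>_def algebra_simps)
    show ?thesis
    proof (rule that[of "max C 1" \<beta>])
      fix x :: 'a and r :: real and E :: "'a set"
      assume r: "r > 0" and E: "E \<in> sets lebesgue" "E \<subseteq> ball x r"
      let ?v = "vol_ball x r" and ?J = "LINT y:ball x r|lebesgue. V y"
      have v: "?v > 0" using r by (rule vol_ball_pos)
      define f where "f y = indicator (ball x r) y *\<^sub>R V y" for y
      have fm: "f \<in> borel_measurable lebesgue"
        unfolding f_def using Vi[of x r] by (simp add: set_integrable_def)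
      have fV: "AE y in lebesgue. \<bar>f y\<bar> powr s = indicator (ball x r) y *\<^sub>R (V y powr s)"
        using V0 by eventually_elim (use s in \<open>auto simp: f_def indicator_def\<close>)
      have Vsm: "integrable lebesgue (\<lambda>y. indicator (ball x r) y *\<^sub>R (V y powr s))"
        using C(1)[OF r] by (simp add: set_integrable_def)
      have fsm: "(\<lambda>y. \<bar>f y\<bar> powr s) \<in> borel_measurable lebesgue" using fm by measurable
      have fi: "integrable lebesgue (\<lambda>y. \<bar>f y\<bar> powr s)"
        using integrable_cong_AE[OF fsm borel_measurable_integrable[OF Vsm] fV] Vsm by simp
      have fI: "(LINT y|lebesgue. \<bar>f y\<bar> powr s) = ?v * avg (\<lambda>y. V y powr s) x r"
        using integral_cong_AE[OF fsm borel_measurable_integrable[OF Vsm] fV] v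
        by (simp add: avg_def set_lebesgue_integral_def)
      have ge: "\<bar>indicat_real E y\<bar> powr q = indicat_real E y" for y using q by (auto simp: indicator_def)
      have gi: "integrable lebesgue (\<lambda>y. \<bar>indicat_real E y\<bar> powr q)"
        unfolding ge by (rule Ei[OF fin[OF E]])
      have gm: "indicat_real E \<in> borel_measurable lebesgue" using E by simp
      note H = Holder_inequality_integral[OF s(2) q(1,2) fm gm fi gi]
      have fg: "f y * indicator E y = indicator E y *\<^sub>R V y" for y using E by (auto simp: f_def indicator_def)
      have "(LINT y:E|lebesgue. V y) \<le> (LINT y|lebesgue. \<bar>f y * indicator E y\<bar>)"
        unfolding set_lebesgue_integral_def fg[symmetric] using H(1) by (intro integral_mono) auto
      also have "\<dots> \<le> (?v * avg (\<lambda>y. V y powr s) x r) powr (1/s) * measure lebesgue E powr \<beta>"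
        using H(2) E unfolding fI ge q(3) by simp
      also have "\<dots> = ?v powr (1/s) * avg (\<lambda>y. V y powr s) x r powr (1/s) * measure lebesgue E powr \<beta>"
        by (simp add: powr_mult)
      also have "\<dots> \<le> ?v powr (1/s) * (max C 1 * avg V x r) * measure lebesgue E powr \<beta>"
      proof (intro mult_right_mono mult_left_mono)
        have "avg V x r \<ge> 0" using I0[of x r] by (simp add: avg_def)
        hence "C * avg V x r \<le> max C 1 * avg V x r" by (intro mult_right_mono) auto
        thus "avg (\<lambda>y. V y powr s) x r powr (1/s) \<le> max C 1 * avg V x r" using C(2)[OF r, of x] by simp
      qed auto
      also have "\<dots> = max C 1 * (?v powr (1/s) / ?v * measure lebesgue E powr \<beta>) * ?J"
        by (simp add: avg_def)
      also have "?v powr (1/s) / ?v = ?v powr (-\<beta>)"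
        using v powr_diff[of ?v "1/s" 1] by (simp add: \<beta>_def)
      also have "?v powr (-\<beta>) * measure lebesgue E powr \<beta> = (measure lebesgue E / ?v) powr \<beta>"
        using v by (simp add: powr_divide powr_minus_divide)
      finally show "(LINT y:E|lebesgue. V y) \<le> max C 1 * (measure lebesgue E / ?v) powr \<beta> * ?J" .
    qed (use \<beta> nb in auto)
  qed
qed

text \<open>
  Let \<open>\<psi> x r\<close> be \<open>r\<^bsup>2-n\<^esup>\<close> times the mass of \<open>V\<close> on \<open>ball x r\<close>, so that the critical radius is the
  supremum of the radii with \<open>\<psi> x r \<le> 1\<close>.  The mass bound gives \<open>\<psi> y r \<le> C (r / R)\<^sup>\<delta> \<psi> x R\<close> whenever
  \<open>ball y r \<subseteq> ball x R\<close>, with \<open>\<delta> > 0\<close>; hence \<open>\<psi> x\<close> tends to \<open>0\<close> at \<open>0\<close> and to infinity at infinity.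
  Doubling bounds \<open>\<psi> x\<close> at multiples of the critical radius, and then \<open>\<psi> y \<le> 1\<close> at a small multiple of
  the critical radius of \<open>x\<close> if \<open>y\<close> is near \<open>x\<close>.
\<close>

lemma
  fixes V :: "'a::euclidean_space \<Rightarrow> real"
  assumes n: "DIM('a) \<ge> 3" and RH: "reverse_Holder \<sigma> V" and nz: "\<not> (AE x in lebesgue. V x = 0)"
    and g: "0 < \<gamma>" "ereal \<gamma> < 2 - ereal (real DIM('a)) / \<sigma>"
  shows crit_radius_pos: "crit_radius V x > 0"
    and crit_radius_slow: "A \<ge> 0 \<Longrightarrow> \<exists>c>0. \<forall>x y. dist x y \<le> A * crit_radius V x \<longrightarrow> c * crit_radius V x \<le> crit_radius V y"
proof -
  let ?n = "real DIM('a)" and ?\<rho> = "crit_radius V"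
  obtain C \<beta> where C: "C > 0" "\<beta> > 0" "?n * \<beta> > ?n - 2"
    and mass: "\<And>x r E. r > 0 \<Longrightarrow> E \<in> sets lebesgue \<Longrightarrow> E \<subseteq> ball x r \<Longrightarrow>
       (LINT y:E|lebesgue. V y) \<le> C * (measure lebesgue E / vol_ball x r) powr \<beta> * (LINT y:ball x r|lebesgue. V y)"
    using reverse_Holder_subset_mass[OF RH g] by metis
  have V0: "AE x in lebesgue. 0 \<le> V x" and Vl: "loc_integrable V"
    using RH by (auto simp: reverse_Holder_def)
  have Vi: "set_integrable lebesgue (ball x r) V" for x r using Vl by (simp add: loc_integrable_def)
  define I where "I x r = (LINT y:ball x r|lebesgue. V y)" for x r
  define \<psi> where "\<psi> x r = r powr (2 - ?n) * I x r" for x r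
  have I0: "I x r \<ge> 0" for x r
    unfolding I_def set_lebesgue_integral_def using V0
    by (intro integral_nonneg_AE) (auto elim!: eventually_mono simp: indicator_def)
  have Imono: "I x r \<le> I y R" if "ball x r \<subseteq> ball y R" for x y r R
    unfolding I_def set_lebesgue_integral_def
  proof (rule integral_mono_AE)
    show "AE z in lebesgue. indicator (ball x r) z *\<^sub>R V z \<le> indicator (ball y R) z *\<^sub>R V z"
      using V0 by eventually_elim (use that in \<open>auto simp: indicator_def\<close>)
  qed (use Vi in \<open>simp_all add: set_integrable_def\<close>)
  define \<delta> where "\<delta> = ?n * \<beta> - (?n - 2)"
  have \<delta>: "\<delta> > 0" using C by (simp add: \<delta>_def)
  \<comment> \<open>the exponent \<open>\<delta>\<close> is positive because \<open>\<sigma> > n / 2\<close>\<close>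
  have growth: "\<psi> y r \<le> C * (r / R) powr \<delta> * \<psi> x R" if "ball y r \<subseteq> ball x R" "0 < r" "0 < R" for x y r R
  proof -
    have "unit_ball_vol ?n \<noteq> 0" by (metis less_irrefl of_nat_0_le_iff unit_ball_vol_pos)
    hence "measure lebesgue (ball y r) / vol_ball x R = (r / R) ^ DIM('a)"
      using that by (simp add: vol_ball_def[symmetric] vol_ball_eq power_divide)
    also have "\<dots> powr \<beta> = (r / R) powr (?n * \<beta>)"
      using that by (simp add: powr_realpow[symmetric] powr_powr)
    finally have "I y r \<le> C * (r / R) powr (?n * \<beta>) * I x R"
      using mass[of R "ball y r" x] that by (simp add: I_def)
    hence "\<psi> y r \<le> r powr (2 - ?n) * (C * (r / R) powr (?n * \<beta>) * I x R)"
      unfolding \<psi>_def by (intro mult_left_mono) auto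
    also have "r powr (2 - ?n) = (r / R) powr (2 - ?n) * R powr (2 - ?n)"
      using that by (simp add: powr_divide)
    also have "(r / R) powr (2 - ?n) * R powr (2 - ?n) * (C * (r / R) powr (?n * \<beta>) * I x R)
       = C * ((r / R) powr (2 - ?n) * (r / R) powr (?n * \<beta>)) * \<psi> x R" by (simp add: \<psi>_def mult_ac)
    also have "(r / R) powr (2 - ?n) * (r / R) powr (?n * \<beta>) = (r / R) powr \<delta>"
      by (simp add: \<delta>_def powr_add[symmetric] algebra_simps)
    finally show ?thesis .
  qed
  \<comment> \<open>a thin shell carries at most half of the mass, so \<open>V\<close> is doubling\<close>
  obtain D where D: "D > 0" "\<And>x r. r > 0 \<Longrightarrow> I x (2 * r) \<le> D * I x r"
  proof -
    define t where "t = min (1/2) ((1 / (2 * C)) powr (1 / \<beta>))"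
    have t: "0 < t" "t \<le> 1/2" using C by (auto simp: t_def)
    have "t powr \<beta> \<le> ((1 / (2 * C)) powr (1 / \<beta>)) powr \<beta>" using t C by (intro powr_mono2) (auto simp: t_def)
    also have "\<dots> = 1 / (2 * C)" using C by (simp add: powr_powr)
    finally have tb: "C * t powr \<beta> \<le> 1/2" using C by (simp add: field_simps)
    \<comment> \<open>the shell between the radii \<open>\<eta> * R\<close> and \<open>R\<close> has relative measure \<open>t\<close>\<close>
    define \<eta> where "\<eta> = (1 - t) powr (1 / ?n)"
    have \<eta>n: "\<eta> ^ DIM('a) = 1 - t" using t by (simp add: \<eta>_def powr_realpow[symmetric] powr_powr)
    have \<eta>: "0 < \<eta>" "\<eta> < 1"
    proof -
      show "0 < \<eta>" using t by (simp add: \<eta>_def)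
      show "\<eta> < 1" using \<eta>n t one_le_power[of \<eta> "DIM('a)"] by linarith
    qed
    have shell: "I x R \<le> 2 * I x (\<eta> * R)" if "R > 0" for x R
    proof -
      define E where "E = ball x R - ball x (\<eta> * R)"
      have sub: "ball x (\<eta> * R) \<subseteq> ball x R" using \<eta> that by (intro subset_ball) auto
      have "measure lebesgue E = vol_ball x R - vol_ball x (\<eta> * R)"
        unfolding E_def vol_ball_def using sub by (intro measurable_measure_Diff) auto
      also have "\<dots> = t * vol_ball x R"
        using vol_ball_scale[of R \<eta> x x] \<eta> that \<eta>n by (simp add: algebra_simps)
      finally have "measure lebesgue E / vol_ball x R = t" using vol_ball_pos[OF that, of x] by simp
      hence "(LINT y:E|lebesgue. V y) \<le> C * t powr \<beta> * I x R"
        using mass[of R E x] that by (simp add: I_def E_def)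
      also have "\<dots> \<le> 1/2 * I x R" using tb I0 by (intro mult_right_mono) auto
      finally have e: "(LINT y:E|lebesgue. V y) \<le> 1/2 * I x R" .
      have "I x R = (LINT y:ball x (\<eta> * R) \<union> E|lebesgue. V y)"
        unfolding I_def E_def using sub by (simp add: Un_absorb1)
      also have "\<dots> = I x (\<eta> * R) + (LINT y:E|lebesgue. V y)"
        unfolding I_def using Vi set_integrable_subset[OF Vi[of x R], of E]
        by (intro set_integral_Un) (auto simp: E_def)
      finally show ?thesis using e by simp
    qed
    have iter: "I x R \<le> 2 ^ m * I x (\<eta> ^ m * R)" if "R > 0" for x R m
    proof (induction m)
      case (Suc m)
      have "I x (\<eta> ^ m * R) \<le> 2 * I x (\<eta> * (\<eta> ^ m * R))" using \<eta> that by (intro shell) auto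
      hence "2 ^ m * I x (\<eta> ^ m * R) \<le> 2 ^ m * (2 * I x (\<eta> * (\<eta> ^ m * R)))" by (intro mult_left_mono) auto
      with Suc have "I x R \<le> 2 ^ m * (2 * I x (\<eta> * (\<eta> ^ m * R)))" by (rule order_trans)
      thus ?case by (simp add: mult_ac)
    qed simp
    obtain m where m: "\<eta> ^ m < 1/2" using real_arch_pow_inv[of "1/2" \<eta>] \<eta> by auto
    show ?thesis
    proof (rule that[of "2 ^ m"])
      fix x :: 'a and r :: real assume r: "r > 0"
      have "I x (2 * r) \<le> 2 ^ m * I x (\<eta> ^ m * (2 * r))" using r by (intro iter) auto
      also have "\<dots> \<le> 2 ^ m * I x r" using m r by (intro mult_left_mono Imono subset_ball) auto
      finally show "I x (2 * r) \<le> 2 ^ m * I x r" .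
    qed simp
  qed
  define S where "S x = {r. r > 0 \<and> \<psi> x r \<le> 1}" for x
  have \<rho>: "?\<rho> x = Sup (S x)" for x by (simp add: crit_radius_def S_def \<psi>_def I_def)
  have bdd: "bdd_above (S x)" for x
  proof -
    obtain R0 where R0: "R0 > 0" "I x R0 > 0"
    proof (rule ccontr)
      assume "\<not> thesis"
      hence z: "I x (real (Suc k)) = 0" for k using that[of "real (Suc k)"] I0[of x "real (Suc k)"] by force
      have "AE y in lebesgue. indicator (ball x (real (Suc k))) y *\<^sub>R V y = 0" for k
      proof -
        have "AE y in lebesgue. 0 \<le> indicator (ball x (real (Suc k))) y *\<^sub>R V y"
          using V0 by eventually_elim (auto simp: indicator_def)
        thus ?thesis using z[of k] Vi[of x "real (Suc k)"]
          by (subst integral_nonneg_eq_0_iff_AE[symmetric]) (auto simp: I_def set_lebesgue_integral_def set_integrable_def)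
      qed
      hence "AE y in lebesgue. \<forall>k. indicator (ball x (real (Suc k))) y *\<^sub>R V y = 0" by (simp only: AE_all_countable simp_thms)
      hence "AE y in lebesgue. V y = 0"
      proof eventually_elim
        case (elim y)
        obtain k where "dist x y < real k" using reals_Archimedean2 by blast
        hence "y \<in> ball x (real (Suc k))" by simp
        thus ?case using elim by (auto simp: indicator_def)
      qed
      thus False using nz by simp
    qed
    hence p0: "\<psi> x R0 > 0" by (simp add: \<psi>_def)
    \<comment> \<open>beyond \<open>R1\<close> the growth of \<open>\<psi> x\<close> from its value at \<open>R0\<close> exceeds \<open>1\<close>\<close>
    define R1 where "R1 = max R0 (R0 * (C / \<psi> x R0) powr (1 / \<delta>))"
    have "r \<le> R1" if "r \<in> S x" for r
    proof (rule ccontr)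
      assume r: "\<not> r \<le> R1"
      have r0: "r > R0" using r by (simp add: R1_def)
      have "\<psi> x R0 \<le> C * (R0 / r) powr \<delta> * \<psi> x r" using r0 R0 by (intro growth subset_ball) auto
      also have "\<dots> \<le> C * (R0 / r) powr \<delta> * 1" using that C by (intro mult_left_mono) (auto simp: S_def)
      finally have "(r / R0) powr \<delta> \<le> C / \<psi> x R0"
        using p0 r0 R0 by (simp add: powr_divide field_simps)
      hence "((r / R0) powr \<delta>) powr (1 / \<delta>) \<le> (C / \<psi> x R0) powr (1 / \<delta>)" using \<delta> by (intro powr_mono2) auto
      hence "r / R0 \<le> (C / \<psi> x R0) powr (1 / \<delta>)" using \<delta> r0 R0 by (simp add: powr_powr)
      hence "r \<le> R0 * (C / \<psi> x R0) powr (1 / \<delta>)" using R0 by (simp add: field_simps)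
      thus False using r by (simp add: R1_def)
    qed
    thus ?thesis by (auto simp: bdd_above_def)
  qed
  have ne: "\<exists>r. r \<in> S x" for x
  proof -
    define a where "a = C * \<psi> x 1 + 1"
    have a: "a > 0" "C * \<psi> x 1 \<le> a" using C I0[of x 1] by (auto simp: a_def \<psi>_def add_nonneg_pos)
    define r where "r = min 1 ((1 / a) powr (1 / \<delta>))"
    have r: "0 < r" "r \<le> 1" using a by (auto simp: r_def)
    have "\<psi> x r \<le> C * (r / 1) powr \<delta> * \<psi> x 1" using r by (intro growth subset_ball) auto
    also have "\<dots> = r powr \<delta> * (C * \<psi> x 1)" by simp
    also have "\<dots> \<le> ((1 / a) powr (1 / \<delta>)) powr \<delta> * a"
      using r a \<delta> C I0[of x 1] by (intro mult_mono powr_mono2) (auto simp: r_def \<psi>_def)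
    also have "\<dots> = 1" using a \<delta> by (simp add: powr_powr)
    finally show ?thesis using r by (auto simp: S_def)
  qed
  have pos: "?\<rho> x > 0" for x
  proof -
    obtain r where "r \<in> S x" using ne by blast
    moreover from this have "r \<le> ?\<rho> x" unfolding \<rho> using bdd by (intro cSup_upper)
    ultimately show ?thesis by (auto simp: S_def)
  qed
  show "?\<rho> x > 0" by (rule pos)
  \<comment> \<open>there is a radius between half the critical radius and the critical radius with \<open>\<psi> \<le> 1\<close>\<close>
  have half: "I x (?\<rho> x / 2) \<le> ?\<rho> x powr (?n - 2)" for x
  proof -
    have "?\<rho> x / 2 < Sup (S x)" using pos[of x] unfolding \<rho> by simp
    then obtain r where r: "r \<in> S x" "?\<rho> x / 2 < r" using less_cSup_iff[OF _ bdd] ne by blast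
    have rr: "r \<le> ?\<rho> x" unfolding \<rho> using bdd r by (intro cSup_upper)
    have "r powr (?n - 2) * (r powr (2 - ?n) * I x r) \<le> r powr (?n - 2) * 1"
      using r by (intro mult_left_mono) (auto simp: S_def \<psi>_def)
    hence "I x r \<le> r powr (?n - 2)"
      using r by (simp add: S_def mult.assoc[symmetric] powr_add[symmetric])
    also have "\<dots> \<le> ?\<rho> x powr (?n - 2)" using rr r n by (intro powr_mono2) (auto simp: S_def)
    finally have "I x r \<le> ?\<rho> x powr (?n - 2)" .
    moreover have "I x (?\<rho> x / 2) \<le> I x r" using r by (intro Imono subset_ball) auto
    ultimately show ?thesis by linarith
  qed
  show "\<exists>c>0. \<forall>x y. dist x y \<le> A * ?\<rho> x \<longrightarrow> c * ?\<rho> x \<le> ?\<rho> y" if A: "A \<ge> 0"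
  proof -
    obtain k where k: "2 * (A + 1) < 2 ^ k" using real_arch_pow[of 2 "2 * (A + 1)"] by auto
    define a where "a = C * D ^ k"
    have a: "a > 0" using C D by (simp add: a_def)
    define c where "c = min 1 ((1 / a) powr (1 / \<delta>))"
    have c: "0 < c" "c \<le> 1" using a by (auto simp: c_def)
    have "c * ?\<rho> x \<le> ?\<rho> y" if xy: "dist x y \<le> A * ?\<rho> x" for x y
    proof -
      let ?r = "?\<rho> x"
      have r: "?r > 0" by (rule pos)
      have big: "I x (2 ^ j * (?r / 2)) \<le> D ^ j * I x (?r / 2)" for j
      proof (induction j)
        case (Suc j)
        have "I x (2 * (2 ^ j * (?r / 2))) \<le> D * I x (2 ^ j * (?r / 2))" using r by (intro D) auto
        also have "\<dots> \<le> D * (D ^ j * I x (?r / 2))" using D Suc by (intro mult_left_mono) auto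
        finally show ?case by (simp add: mult_ac)
      qed simp
      have "I x ((A + 1) * ?r) \<le> I x (2 ^ k * (?r / 2))"
        using k r mult_strict_right_mono[OF k r] by (intro Imono subset_ball) auto
      also have "\<dots> \<le> D ^ k * ?r powr (?n - 2)"
        using big[of k] half[of x] D by (meson less_imp_le mult_left_mono order_trans zero_less_power)
      finally have IA: "I x ((A + 1) * ?r) \<le> D ^ k * ?r powr (?n - 2)" .
      have "\<psi> x ((A + 1) * ?r) \<le> ?r powr (2 - ?n) * (D ^ k * ?r powr (?n - 2))"
        unfolding \<psi>_def
      proof (intro mult_mono IA)
        show "((A + 1) * ?r) powr (2 - ?n) \<le> ?r powr (2 - ?n)" using A r n by (intro powr_mono2') auto
      qed (use I0 in auto)
      also have "\<dots> = D ^ k * (?r powr (2 - ?n) * ?r powr (?n - 2))" by simp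
      also have "?r powr (2 - ?n) * ?r powr (?n - 2) = 1" using r by (simp add: powr_add[symmetric])
      finally have pA: "\<psi> x ((A + 1) * ?r) \<le> D ^ k" by simp
      have sub: "ball y (c * ?r) \<subseteq> ball x ((A + 1) * ?r)"
      proof
        fix z assume "z \<in> ball y (c * ?r)"
        hence "dist y z < c * ?r" by simp
        also have "\<dots> \<le> 1 * ?r" using c r by (intro mult_right_mono) auto
        finally show "z \<in> ball x ((A + 1) * ?r)" using xy dist_triangle[of x z y] by (simp add: algebra_simps)
      qed
      have "\<psi> y (c * ?r) \<le> C * (c * ?r / ((A + 1) * ?r)) powr \<delta> * \<psi> x ((A + 1) * ?r)"
        using c r A by (intro growth sub) auto
      also have "\<dots> \<le> C * (c powr \<delta>) * D ^ k"
      proof (intro mult_mono)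
        have "c / (A + 1) \<le> c" using A c by (simp add: field_simps)
        thus "(c * ?r / ((A + 1) * ?r)) powr \<delta> \<le> c powr \<delta>" using A c r \<delta> by (intro powr_mono2) auto
      qed (use C pA I0 in \<open>auto simp: \<psi>_def\<close>)
      also have "\<dots> = c powr \<delta> * a" by (simp add: a_def)
      also have "\<dots> \<le> ((1 / a) powr (1 / \<delta>)) powr \<delta> * a"
        using c a \<delta> by (intro mult_right_mono powr_mono2) (auto simp: c_def)
      also have "\<dots> = 1" using a \<delta> by (simp add: powr_powr)
      finally have "c * ?r \<in> S y" using c r by (simp add: S_def)
      thus ?thesis unfolding \<rho>[of y] using bdd by (intro cSup_upper)
    qed
    thus ?thesis using c by blast
  qed
qed

section \<open>The extended operator\<close>

lemma closed_ess_supp: "closed (ess_supp f)"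
proof -
  have "open (- ess_supp f)"
    unfolding open_contains_ball
  proof
    fix x assume "x \<in> - ess_supp f"
    then obtain r where r: "r > 0" "AE y in lebesgue. y \<in> ball x r \<longrightarrow> f y = 0"
      by (auto simp: ess_supp_def)
    have "z \<in> - ess_supp f" if z: "z \<in> ball x r" for z
    proof -
      have sub: "ball z (r - dist x z) \<subseteq> ball x r"
      proof
        fix y assume "y \<in> ball z (r - dist x z)"
        thus "y \<in> ball x r" using dist_triangle[of x y z] by auto
      qed
      have "AE y in lebesgue. y \<in> ball z (r - dist x z) \<longrightarrow> f y = 0"
        using r(2) by eventually_elim (use sub in blast)
      moreover have "r - dist x z > 0" using z by simp
      ultimately have "\<exists>e>0. AE y in lebesgue. y \<in> ball z e \<longrightarrow> f y = 0" by blast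
      thus ?thesis unfolding ess_supp_def by blast
    qed
    thus "\<exists>e>0. ball x e \<subseteq> - ess_supp f" using r(1) by blast
  qed
  thus ?thesis by (simp add: closed_def)
qed

lemma ess_supp_restr: "ess_supp (restr S f) \<subseteq> closure S"
proof
  fix x assume x: "x \<in> ess_supp (restr S f)"
  show "x \<in> closure S"
  proof (rule ccontr)
    assume "x \<notin> closure S"
    then obtain r where r: "r > 0" "ball x r \<subseteq> - closure S"
      using open_contains_ball[of "- closure S"] by (auto simp: open_Compl)
    hence "restr S f y = 0" if "y \<in> ball x r" for y
      using that closure_subset[of S] by (auto simp: restr_def indicator_def)
    hence "AE y in lebesgue. y \<in> ball x r \<longrightarrow> restr S f y = 0" by auto
    thus False using x r(1) by (auto simp: ess_supp_def)
  qed
qed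

lemma compact_ess_supp_restr: "bounded S \<Longrightarrow> compact (ess_supp (restr S f))"
  using closed_ess_supp[of "restr S f"] ess_supp_restr[of S f]
  by (meson bounded_closure bounded_subset compact_eq_bounded_closed)

lemma restr_linear: "restr S (\<lambda>y. f y - c * f' y) = (\<lambda>y. restr S f y + (- c) * restr S f' y)"
  by (auto simp: restr_def indicator_def)

lemma tail_integral_tendsto_0:
  fixes F :: "'a::euclidean_space \<Rightarrow> complex"
  assumes "set_integrable lebesgue (- ball x0 R) F"
  shows "(\<lambda>k. LINT y:- ball x0 (R + real k)|lebesgue. F y) \<longlonglongrightarrow> 0"
proof -
  have "(\<lambda>k. LINT y|lebesgue. indicator (- ball x0 (R + real k)) y *\<^sub>R F y) \<longlonglongrightarrow> (LINT y|(lebesgue :: 'a measure). (0::complex))"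
  proof (rule integral_dominated_convergence[where w="\<lambda>y. norm (indicator (- ball x0 R) y *\<^sub>R F y)"])
    show "integrable lebesgue (\<lambda>y. norm (indicator (- ball x0 R) y *\<^sub>R F y))"
      using assms unfolding set_integrable_def by (rule integrable_norm)
    show "(\<lambda>y. indicator (- ball x0 (R + real k)) y *\<^sub>R F y) \<in> borel_measurable lebesgue" for k
    proof -
      have "set_integrable lebesgue (- ball x0 (R + real k)) F"
        by (rule set_integrable_subset[OF assms]) auto
      thus ?thesis unfolding set_integrable_def by (rule borel_measurable_integrable)
    qed
    show "AE y in lebesgue. (\<lambda>k. indicator (- ball x0 (R + real k)) y *\<^sub>R F y) \<longlonglongrightarrow> 0"
    proof (intro AE_I2)
      fix y
      obtain N :: nat where "dist x0 y - R < real N" using reals_Archimedean2 by blast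
      hence "\<forall>k\<ge>N. indicator (- ball x0 (R + real k)) y *\<^sub>R F y = 0" by (auto simp: indicator_def)
      hence "\<forall>\<^sub>F k in sequentially. indicator (- ball x0 (R + real k)) y *\<^sub>R F y = 0"
        using eventually_sequentially by blast
      thus "(\<lambda>k. indicator (- ball x0 (R + real k)) y *\<^sub>R F y) \<longlonglongrightarrow> 0" by (rule tendsto_eventually)
    qed
    show "AE y in lebesgue. norm (indicator (- ball x0 (R + real k)) y *\<^sub>R F y) \<le> norm (indicator (- ball x0 R) y *\<^sub>R F y)" for k
      by (intro AE_I2) (auto simp: indicator_def)
  qed auto
  thus ?thesis by (simp add: set_lebesgue_integral_def)
qed

text \<open>From here on the critical radius may be any positive and slowly varying function.\<close>

locale critical_operator =
  fixes \<rho> :: "'a::euclidean_space \<Rightarrow> real" and \<gamma> p \<theta> :: real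
    and T :: "('a \<Rightarrow> complex) \<Rightarrow> 'a \<Rightarrow> complex" and K :: "'a \<Rightarrow> 'a \<Rightarrow> complex"
  assumes rho_pos: "\<rho> x > 0"
    and rho_slow: "A \<ge> 0 \<Longrightarrow> \<exists>c>0. \<forall>x y. dist x y \<le> A * \<rho> x \<longrightarrow> c * \<rho> x \<le> \<rho> y"
    and theta: "1 < \<theta>" "1 / p + 1 / \<theta> = 1"
    and T_class: "GCZO_star \<rho> \<gamma> p T K"
begin

lemma p_gt_1: "1 < p" and gamma_pos: "0 < \<gamma>" and gamma_le_1: "\<gamma> \<le> 1"
  using T_class by (auto simp: GCZO_star_def Let_def)

lemma theta_eq: "p / (p - 1) = \<theta>"
proof -
  have "1 / \<theta> = (p - 1) / p" using theta p_gt_1 by (simp add: field_simps)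
  thus ?thesis using theta p_gt_1 by (simp add: field_simps)
qed

lemma T_bounded:
  obtains C where "C > 0" "\<And>f. in_Lp p UNIV f \<Longrightarrow> in_Lp p UNIV (T f) \<and> Lp_norm p UNIV (T f) \<le> C * Lp_norm p UNIV f"
proof -
  obtain C where C: "\<And>f. in_Lp p UNIV f \<Longrightarrow> in_Lp p UNIV (T f) \<and> Lp_norm p UNIV (T f) \<le> C * Lp_norm p UNIV f"
    using T_class by (auto simp: GCZO_star_def Let_def Lp_operator_def bounded_op_def)
  show ?thesis
  proof (rule that[of "max C 1"])
    fix f :: "'a \<Rightarrow> complex" assume f: "in_Lp p UNIV f"
    have "C * Lp_norm p UNIV f \<le> max C 1 * Lp_norm p UNIV f" by (intro mult_right_mono) auto
    thus "in_Lp p UNIV (T f) \<and> Lp_norm p UNIV (T f) \<le> max C 1 * Lp_norm p UNIV f"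
      using C[OF f] by linarith
  qed simp
qed

lemma T_add: "in_Lp p UNIV f \<Longrightarrow> in_Lp p UNIV g \<Longrightarrow> AE x in lebesgue. T (\<lambda>y. f y + g y) x = T f x + T g x"
  using T_class by (auto simp: GCZO_star_def Let_def Lp_operator_def)

lemma T_cmult: "in_Lp p UNIV f \<Longrightarrow> AE x in lebesgue. T (\<lambda>y. c * f y) x = c * T f x"
  using T_class by (auto simp: GCZO_star_def Let_def Lp_operator_def)

lemma T_zero: "AE x in lebesgue. T (\<lambda>_. 0) x = 0"
proof -
  have "in_Lp p UNIV (\<lambda>_. 0 :: complex)"
    by (auto simp: in_Lp_def set_borel_measurable_def set_integrable_def)
  from T_cmult[OF this, of 0] show ?thesis by simp
qed

lemma in_Lp_restr_cong: "in_Lp p S f \<Longrightarrow> in_Lp p UNIV (restr S f)"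
  using p_gt_1 by (simp add: in_Lp_restr_iff)

lemma T_restr_off_support:
  assumes "bounded S" "in_Lp p S f"
  shows "AE x in lebesgue. x \<notin> closure S \<longrightarrow>
     set_integrable lebesgue S (\<lambda>y. K x y * f y) \<and> T (restr S f) x = (LINT y:S|lebesgue. K x y * f y)"
proof -
  have "assoc_kernel p T K" using T_class by (auto simp: GCZO_star_def Let_def)
  hence "AE x in lebesgue. x \<notin> ess_supp (restr S f) \<longrightarrow>
        integrable lebesgue (\<lambda>y. K x y * restr S f y) \<and> T (restr S f) x = (LINT y|lebesgue. K x y * restr S f y)"
    using in_Lp_restr_cong[OF assms(2)] compact_ess_supp_restr[OF assms(1), of f]
    unfolding assoc_kernel_def by blast
  moreover have "(\<lambda>y. K x y * restr S f y) = (\<lambda>y. indicator S y *\<^sub>R (K x y * f y))" for x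
    by (auto simp: restr_def)
  ultimately show ?thesis using ess_supp_restr[of S f]
    unfolding set_integrable_def set_lebesgue_integral_def by (auto elim!: eventually_mono)
qed

definition loc_Lp :: "('a \<Rightarrow> complex) \<Rightarrow> bool" where
  "loc_Lp f \<longleftrightarrow> (\<forall>x r. in_Lp p (ball x r) f)"

lemma loc_Lp_bounded: "loc_Lp f \<Longrightarrow> bounded S \<Longrightarrow> S \<in> sets lebesgue \<Longrightarrow> in_Lp p S f"
  unfolding loc_Lp_def by (metis bounded_subset_ballD in_Lp_subset)

text \<open>On an open set \<open>B\<close>, the part of \<open>f\<close> outside \<open>B\<close> acts only through the kernel.\<close>

lemma T_restr_split:
  assumes f: "loc_Lp f" and A: "bounded A" "A \<in> sets lebesgue" and B: "open B"
  shows "AE x in lebesgue. x \<in> B \<longrightarrow> set_integrable lebesgue (A - B) (\<lambda>y. K x y * f y) \<and>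
     T (restr A f) x = T (restr (A \<inter> B) f) x + (LINT y:A - B|lebesgue. K x y * f y)"
proof -
  have Bm: "B \<in> sets lebesgue" using B by (force intro: lborelD)
  have L: "in_Lp p (A - B) f" "in_Lp p (A \<inter> B) f"
    using A Bm by (auto intro!: loc_Lp_bounded[OF f] intro: bounded_subset[OF A(1)])
  have e: "(\<lambda>y. restr (A \<inter> B) f y + restr (A - B) f y) = restr A f"
    by (auto simp: restr_def indicator_def)
  have 1: "AE x in lebesgue. T (restr A f) x = T (restr (A \<inter> B) f) x + T (restr (A - B) f) x"
    using T_add[OF in_Lp_restr_cong[OF L(2)] in_Lp_restr_cong[OF L(1)]] unfolding e .
  have 2: "AE x in lebesgue. x \<notin> closure (A - B) \<longrightarrow>
     set_integrable lebesgue (A - B) (\<lambda>y. K x y * f y) \<and> T (restr (A - B) f) x = (LINT y:A - B|lebesgue. K x y * f y)"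
    using A L by (intro T_restr_off_support) (auto intro: bounded_subset)
  have 3: "x \<notin> closure (A - B)" if "x \<in> B" for x
  proof -
    have "closure (A - B) \<subseteq> - B" using B by (intro closure_minimal) auto
    thus ?thesis using that by auto
  qed
  show ?thesis using 1 2
  proof eventually_elim
    case (elim x)
    thus ?case using 3[of x] by auto
  qed
qed



definition admissible :: "('a \<Rightarrow> complex) \<Rightarrow> bool" where
  "admissible f \<longleftrightarrow> loc_Lp f \<and> (\<forall>x0 R. R > 2 * \<rho> x0 \<longrightarrow>
     (\<forall>x\<in>ball x0 (\<rho> x0). set_integrable lebesgue (- ball x0 R) (\<lambda>y. K x y * f y)))"

lemma two_rho: "R > 2 * \<rho> x0 \<Longrightarrow> \<rho> x0 < R" using rho_pos[of x0] by linarith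

text \<open>
  Where two of the critical balls meet, the two truncations of \<open>f\<close> differ by functions supported away
  from the intersection, on which \<open>T\<close> is given by its kernel.
\<close>

lemma local_values_agree:
  assumes f: "admissible f" and R: "R > 2 * \<rho> x0" "R' > 2 * \<rho> x1"
  shows "AE x in lebesgue. x \<in> ball x0 (\<rho> x0) \<inter> ball x1 (\<rho> x1) \<longrightarrow>
     T (restr (ball x0 R) f) x + (LINT y:- ball x0 R|lebesgue. K x y * f y) =
     T (restr (ball x1 R') f) x + (LINT y:- ball x1 R'|lebesgue. K x y * f y)"
proof -
  let ?A = "ball x0 R" and ?B = "ball x1 R'"
  have fl: "loc_Lp f" using f by (simp add: admissible_def)
  have 1: "AE x in lebesgue. x \<in> ?B \<longrightarrow> set_integrable lebesgue (?A - ?B) (\<lambda>y. K x y * f y) \<and>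
     T (restr ?A f) x = T (restr (?A \<inter> ?B) f) x + (LINT y:?A - ?B|lebesgue. K x y * f y)"
    by (intro T_restr_split[OF fl]) auto
  have 2: "AE x in lebesgue. x \<in> ?A \<longrightarrow> set_integrable lebesgue (?B - ?A) (\<lambda>y. K x y * f y) \<and>
     T (restr ?B f) x = T (restr (?B \<inter> ?A) f) x + (LINT y:?B - ?A|lebesgue. K x y * f y)"
    by (intro T_restr_split[OF fl]) auto
  show ?thesis using 1 2
  proof eventually_elim
    case (elim x)
    show ?case
    proof
      assume x: "x \<in> ball x0 (\<rho> x0) \<inter> ball x1 (\<rho> x1)"
      hence xAB: "x \<in> ?A" "x \<in> ?B" using two_rho[OF R(1)] two_rho[OF R(2)] by auto
      have iA: "set_integrable lebesgue (- ?A) (\<lambda>y. K x y * f y)"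
        and iB: "set_integrable lebesgue (- ?B) (\<lambda>y. K x y * f y)"
        using f R x by (auto simp: admissible_def)
      have "- (?A \<inter> ?B) = - ?A \<union> (?A - ?B)" by auto
      hence a: "(LINT y:- (?A \<inter> ?B)|lebesgue. K x y * f y) = (LINT y:- ?A|lebesgue. K x y * f y) + (LINT y:?A - ?B|lebesgue. K x y * f y)"
        using iA elim xAB set_integral_Un[of "- ?A" "?A - ?B" lebesgue "\<lambda>y. K x y * f y"] by auto
      have "- (?A \<inter> ?B) = - ?B \<union> (?B - ?A)" by auto
      hence b: "(LINT y:- (?A \<inter> ?B)|lebesgue. K x y * f y) = (LINT y:- ?B|lebesgue. K x y * f y) + (LINT y:?B - ?A|lebesgue. K x y * f y)"
        using iB elim xAB set_integral_Un[of "- ?B" "?B - ?A" lebesgue "\<lambda>y. K x y * f y"] by auto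
      show "T (restr ?A f) x + (LINT y:- ?A|lebesgue. K x y * f y) = T (restr ?B f) x + (LINT y:- ?B|lebesgue. K x y * f y)"
        using a b elim xAB by (simp add: Int_commute algebra_simps)
    qed
  qed
qed

lemma countable_critical_cover:
  obtains X where "countable X" "\<And>x. \<exists>z\<in>X. x \<in> ball z (\<rho> z)"
proof -
  obtain F' where F': "F' \<subseteq> (\<lambda>x. ball x (\<rho> x)) ` UNIV" "countable F'" "\<Union>F' = \<Union>((\<lambda>x. ball x (\<rho> x)) ` UNIV)"
    using Lindelof[of "(\<lambda>x. ball x (\<rho> x)) ` UNIV"] by auto
  obtain X where X: "countable X" "F' = (\<lambda>x. ball x (\<rho> x)) ` X"
    using F'(1,2) by (metis countable_image_eq_inj subset_imageE subset_UNIV countable_subset_image)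
  have "\<exists>z\<in>X. x \<in> ball z (\<rho> z)" for x
  proof -
    have "x \<in> \<Union>((\<lambda>x. ball x (\<rho> x)) ` UNIV)" using rho_pos[of x] by (intro UN_I[of x]) auto
    hence "x \<in> \<Union>((\<lambda>x. ball x (\<rho> x)) ` X)" unfolding F'(3)[symmetric] X(2) .
    thus ?thesis by blast
  qed
  thus ?thesis using X(1) that by blast
qed

text \<open>
  The values on the critical balls are glued along a countable cover, so that the exceptional null
  sets add up to a null set.
\<close>

lemma is_extension_exists:
  assumes f: "admissible f" shows "\<exists>g. is_extension \<rho> T K f g"
proof -
  obtain X where X: "countable X" "\<And>x. \<exists>z\<in>X. x \<in> ball z (\<rho> z)" using countable_critical_cover by blast
  then obtain s where s: "\<And>x. s x \<in> X" "\<And>x. x \<in> ball (s x) (\<rho> (s x))" by metis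
  define G where "G z x = T (restr (ball z (3 * \<rho> z)) f) x + (LINT y:- ball z (3 * \<rho> z)|lebesgue. K x y * f y)" for z x
  have "is_extension \<rho> T K f (\<lambda>x. G (s x) x)"
    unfolding is_extension_def
  proof (intro allI impI)
    fix x0 R assume R: "R > 2 * \<rho> x0"
    have "AE x in lebesgue. \<forall>z\<in>X. x \<in> ball x0 (\<rho> x0) \<inter> ball z (\<rho> z) \<longrightarrow>
       T (restr (ball x0 R) f) x + (LINT y:- ball x0 R|lebesgue. K x y * f y) = G z x"
      unfolding G_def AE_ball_countable[OF X(1)]
      using R rho_pos by (intro ballI local_values_agree[OF f]) auto
    thus "AE x in lebesgue. x \<in> ball x0 (\<rho> x0) \<longrightarrow>
        set_integrable lebesgue (- ball x0 R) (\<lambda>y. K x y * f y) \<and>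
        G (s x) x = T (restr (ball x0 R) f) x + (LINT y:- ball x0 R|lebesgue. K x y * f y)"
    proof eventually_elim
      case (elim x)
      thus ?case using s[of x] f R by (auto simp: admissible_def)
    qed
  qed
  thus ?thesis by blast
qed

lemma ext_op_extension: "admissible f \<Longrightarrow> is_extension \<rho> T K f (ext_op \<rho> T K f)"
  unfolding ext_op_def using is_extension_exists by (rule someI_ex)

lemma is_extension_linear:
  assumes f: "loc_Lp f" "is_extension \<rho> T K f g" and f': "loc_Lp f'" "is_extension \<rho> T K f' g'"
  shows "is_extension \<rho> T K (\<lambda>y. f y - c * f' y) (\<lambda>x. g x - c * g' x)"
  unfolding is_extension_def
proof (intro allI impI)
  fix x0 R assume R: "R > 2 * \<rho> x0"
  let ?B = "ball x0 R"
  have L: "in_Lp p UNIV (restr ?B f)" "in_Lp p UNIV (restr ?B f')"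
    using f f' by (auto intro!: in_Lp_restr_cong simp: loc_Lp_def)
  have A1: "AE x in lebesgue. T (restr ?B (\<lambda>y. f y - c * f' y)) x = T (restr ?B f) x + T (\<lambda>y. (- c) * restr ?B f' y) x"
    unfolding restr_linear by (intro T_add L in_Lp_cmult)
  have A2: "AE x in lebesgue. T (\<lambda>y. (- c) * restr ?B f' y) x = (- c) * T (restr ?B f') x"
    by (intro T_cmult L)
  have A3: "AE x in lebesgue. x \<in> ball x0 (\<rho> x0) \<longrightarrow>
        set_integrable lebesgue (- ?B) (\<lambda>y. K x y * f y) \<and>
        g x = T (restr ?B f) x + (LINT y:- ?B|lebesgue. K x y * f y)"
    using f R by (auto simp: is_extension_def)
  have A4: "AE x in lebesgue. x \<in> ball x0 (\<rho> x0) \<longrightarrow>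
        set_integrable lebesgue (- ?B) (\<lambda>y. K x y * f' y) \<and>
        g' x = T (restr ?B f') x + (LINT y:- ?B|lebesgue. K x y * f' y)"
    using f' R by (auto simp: is_extension_def)
  show "AE x in lebesgue. x \<in> ball x0 (\<rho> x0) \<longrightarrow>
        set_integrable lebesgue (- ?B) (\<lambda>y. K x y * (f y - c * f' y)) \<and>
        g x - c * g' x = T (restr ?B (\<lambda>y. f y - c * f' y)) x + (LINT y:- ?B|lebesgue. K x y * (f y - c * f' y))"
    using A1 A2 A3 A4
  proof eventually_elim
    case (elim x)
    show ?case
    proof
      assume x: "x \<in> ball x0 (\<rho> x0)"
      have i: "set_integrable lebesgue (- ?B) (\<lambda>y. K x y * f y)" "set_integrable lebesgue (- ?B) (\<lambda>y. c * (K x y * f' y))"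
        using elim x by auto
      have e: "K x y * (f y - c * f' y) = K x y * f y - c * (K x y * f' y)" for y by (simp add: algebra_simps)
      show "set_integrable lebesgue (- ?B) (\<lambda>y. K x y * (f y - c * f' y)) \<and>
        g x - c * g' x = T (restr ?B (\<lambda>y. f y - c * f' y)) x + (LINT y:- ?B|lebesgue. K x y * (f y - c * f' y))"
        unfolding e using set_integral_diff[OF i] elim x by (simp add: algebra_simps)
    qed
  qed
qed

text \<open>
  The radius of truncation may be lowered below the critical one: on \<open>ball x0 r\<close> it suffices to cut off
  at \<open>2 * r\<close>.
\<close>

lemma is_extension_local:
  assumes f: "loc_Lp f" "is_extension \<rho> T K f g" and r: "0 < r" "r \<le> \<rho> x0"
  shows "AE x in lebesgue. x \<in> ball x0 r \<longrightarrow>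
     set_integrable lebesgue (- ball x0 (2 * r)) (\<lambda>y. K x y * f y) \<and>
     g x = T (restr (ball x0 (2 * r)) f) x + (LINT y:- ball x0 (2 * r)|lebesgue. K x y * f y)"
proof -
  let ?R = "3 * \<rho> x0"
  let ?A = "ball x0 ?R" and ?B = "ball x0 (2 * r)"
  have BA: "?A \<inter> ?B = ?B" "- ?B = - ?A \<union> (?A - ?B)" using r rho_pos[of x0] by auto
  have 1: "AE x in lebesgue. x \<in> ?B \<longrightarrow> set_integrable lebesgue (?A - ?B) (\<lambda>y. K x y * f y) \<and>
     T (restr ?A f) x = T (restr ?B f) x + (LINT y:?A - ?B|lebesgue. K x y * f y)"
    using T_restr_split[OF f(1), of ?A ?B] unfolding BA(1) by auto
  have 2: "AE x in lebesgue. x \<in> ball x0 (\<rho> x0) \<longrightarrow>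
        set_integrable lebesgue (- ?A) (\<lambda>y. K x y * f y) \<and>
        g x = T (restr ?A f) x + (LINT y:- ?A|lebesgue. K x y * f y)"
    using f(2) rho_pos[of x0] by (auto simp: is_extension_def)
  show ?thesis using 1 2
  proof eventually_elim
    case (elim x)
    show ?case
    proof
      assume "x \<in> ball x0 r"
      hence x: "x \<in> ?B" "x \<in> ball x0 (\<rho> x0)" using r by auto
      have i: "set_integrable lebesgue (- ?A) (\<lambda>y. K x y * f y)" "set_integrable lebesgue (?A - ?B) (\<lambda>y. K x y * f y)"
        using elim x by auto
      have "set_integrable lebesgue (- ?B) (\<lambda>y. K x y * f y)"
        unfolding BA(2) using i by (intro set_integrable_Un) auto
      moreover have "(LINT y:- ?B|lebesgue. K x y * f y) = (LINT y:- ?A|lebesgue. K x y * f y) + (LINT y:?A - ?B|lebesgue. K x y * f y)"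
        unfolding BA(2) using i by (intro set_integral_Un) auto
      ultimately show "set_integrable lebesgue (- ?B) (\<lambda>y. K x y * f y) \<and>
         g x = T (restr ?B f) x + (LINT y:- ?B|lebesgue. K x y * f y)"
        using elim x by simp
    qed
  qed
qed

text \<open>
  The kernel may behave badly in its first variable, so measurability comes from
  \<open>T\<close>: almost everywhere on a critical ball, the extension is the limit of \<open>T\<close> applied to truncations.
\<close>

lemma is_extension_measurable:
  assumes f: "loc_Lp f" "is_extension \<rho> T K f g"
  shows "g \<in> borel_measurable lebesgue"
proof -
  obtain C where C: "\<And>f. in_Lp p UNIV f \<Longrightarrow> in_Lp p UNIV (T f)" using T_bounded by metis
  have loc: "(\<lambda>x. indicator (ball x0 (\<rho> x0)) x *\<^sub>R g x) \<in> borel_measurable lebesgue" for x0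
  proof -
    let ?R = "3 * \<rho> x0"
    let ?t = "\<lambda>k x. T (restr (ball x0 (?R + real k)) f) x"
    have tm: "?t k \<in> borel_measurable lebesgue" for k
    proof -
      have "in_Lp p UNIV (?t k)" using f by (intro C in_Lp_restr_cong) (simp add: loc_Lp_def)
      thus ?thesis by (simp add: in_Lp_def set_borel_measurable_def)
    qed
    have "AE x in lebesgue. x \<in> ball x0 (\<rho> x0) \<longrightarrow>
        set_integrable lebesgue (- ball x0 (?R + real k)) (\<lambda>y. K x y * f y) \<and>
        g x = ?t k x + (LINT y:- ball x0 (?R + real k)|lebesgue. K x y * f y)" for k
      using f(2) rho_pos[of x0] unfolding is_extension_def by auto
    hence "AE x in lebesgue. \<forall>k. x \<in> ball x0 (\<rho> x0) \<longrightarrow>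
        set_integrable lebesgue (- ball x0 (?R + real k)) (\<lambda>y. K x y * f y) \<and>
        g x = ?t k x + (LINT y:- ball x0 (?R + real k)|lebesgue. K x y * f y)"
      by (simp only: AE_all_countable simp_thms)
    hence lim: "AE x in lebesgue. x \<in> ball x0 (\<rho> x0) \<longrightarrow> (\<lambda>k. ?t k x) \<longlonglongrightarrow> g x"
    proof eventually_elim
      case (elim x)
      show ?case
      proof
        assume x: "x \<in> ball x0 (\<rho> x0)"
        have i: "set_integrable lebesgue (- ball x0 ?R) (\<lambda>y. K x y * f y)" using elim[rule_format, of 0] x by simp
        have "g x = ?t k x + (LINT y:- ball x0 (?R + real k)|lebesgue. K x y * f y)" for k
          using elim x by blast
        hence "?t k x = g x - (LINT y:- ball x0 (?R + real k)|lebesgue. K x y * f y)" for k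
          by (metis add_diff_cancel_right')
        moreover have "(\<lambda>k. g x - (LINT y:- ball x0 (?R + real k)|lebesgue. K x y * f y)) \<longlonglongrightarrow> g x - 0"
          by (intro tendsto_intros tail_integral_tendsto_0 i)
        ultimately show "(\<lambda>k. ?t k x) \<longlonglongrightarrow> g x" by simp
      qed
    qed
    define L where "L x = lim (\<lambda>k. indicator (ball x0 (\<rho> x0)) x *\<^sub>R ?t k x)" for x
    have Lm: "L \<in> borel_measurable lebesgue"
      unfolding L_def using tm by (intro borel_measurable_lim_metric borel_measurable_scaleR borel_measurable_indicator) auto
    have "AE x in lebesgue. L x = indicator (ball x0 (\<rho> x0)) x *\<^sub>R g x"
      using lim by eventually_elim (auto simp: L_def indicator_def limI)
    with Lm show ?thesis by (rule borel_measurable_lebesgue_AE)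
  qed
  obtain X where X: "countable X" "\<And>x. \<exists>z\<in>X. x \<in> ball z (\<rho> z)" using countable_critical_cover by blast
  show ?thesis
  proof (rule measurableI)
    fix A :: "complex set" assume A: "A \<in> sets borel"
    have "g -` A \<inter> ball z (\<rho> z) \<in> sets lebesgue" for z
      by (rule set_borel_measurable_sets[OF _ A]) (use loc in \<open>auto simp: set_borel_measurable_def\<close>)
    hence "(\<Union>z\<in>X. g -` A \<inter> ball z (\<rho> z)) \<in> sets lebesgue" using X(1) by (intro sets.countable_UN'') auto
    also have "(\<Union>z\<in>X. g -` A \<inter> ball z (\<rho> z)) = g -` A \<inter> space lebesgue" using X(2) by auto
    finally show "g -` A \<inter> space lebesgue \<in> sets lebesgue" .
  qed auto
qed

end

section \<open>Kernel estimates\<close>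

lemma summable_tail:
  assumes "0 < b" "b < 1" shows "summable (\<lambda>k. (real k + c) * b ^ k)"
proof -
  have 1: "summable (\<lambda>k. c * b ^ k)" using assms by (intro summable_mult summable_geometric) auto
  have "summable (\<lambda>k. of_nat k * b ^ k)"
  proof -
    have "summable (\<lambda>n. diffs (\<lambda>_. 1) n * b ^ n)"
      using assms by (intro termdiff_converges[where K=1]) (auto intro: summable_geometric)
    hence "summable (\<lambda>n. real (Suc n) * b ^ n)" by (simp add: diffs_def)
    hence "summable (\<lambda>n. real (Suc n) * b ^ n - b ^ n)"
      using assms by (intro summable_diff summable_geometric) auto
    thus ?thesis by (simp add: algebra_simps)
  qed
  from summable_add[OF this 1] show ?thesis by (simp add: distrib_right)
qed

lemma power_powr: "(x ^ k) powr a = (x powr a) ^ k" for x a :: real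
  by (induction k) (auto simp: powr_mult)

lemma osc_bound_const: "osc_bound \<alpha> (\<lambda>_ :: 'a::euclidean_space. c) 0"
proof -
  have "avg (\<lambda>_. c) x r = c" if "r > 0" for x :: 'a and r
    using vol_ball_pos[OF that, of x] by (simp add: avg_def set_integral_const_ball)
  thus ?thesis by (simp add: osc_bound_def)
qed

lemma const_in_BMO: "(\<lambda>_ :: 'a::euclidean_space. c) \<in> BMO \<alpha>"
proof -
  have "osc_bound \<alpha> (\<lambda>_ :: 'a. c) 1"
    by (rule osc_bound_mono[OF osc_bound_const]) simp
  thus ?thesis by (auto simp: BMO_def loc_integrable_def intro!: exI[of _ 1])
qed

context critical_operator begin

text \<open>
  Growth of means over dyadic dilates, as for a function of \<open>BMO\<^sup>\<alpha>\<close> from which a suitable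
  constant has been subtracted.
\<close>

definition dyadic_growth :: "real \<Rightarrow> real \<Rightarrow> ('a \<Rightarrow> complex) \<Rightarrow> 'a \<Rightarrow> real \<Rightarrow> real \<Rightarrow> bool" where
  "dyadic_growth q \<alpha> h x r M \<longleftrightarrow> (\<forall>k. Lq_mean_le q h x (2 ^ k * r) (M * ((real k + 1) * (2 powr \<alpha>) ^ k)))"

lemma kernel_decay:
  assumes "N > 0"
  shows "\<exists>C>0. \<forall>xB. \<forall>x\<in>ball xB (\<rho> xB). \<forall>R. R > 2 * \<rho> xB \<longrightarrow>
        in_Lp p (annulus xB R (2 * R)) (K x) \<and>
        Lp_norm p (annulus xB R (2 * R)) (K x) \<le> C * R powr (- real DIM('a) / \<theta>) * (\<rho> xB / R) powr N"
proof -
  from T_class have "\<forall>N::real. N > 0 \<longrightarrow> (\<exists>C>0. \<forall>xB. \<forall>x\<in>ball xB (\<rho> xB). \<forall>R. R > 2 * \<rho> xB \<longrightarrow>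
        in_Lp p (annulus xB R (2 * R)) (K x) \<and>
        Lp_norm p (annulus xB R (2 * R)) (K x) \<le> C * R powr (- real DIM('a) / \<theta>) * (\<rho> xB / R) powr N)"
    unfolding GCZO_star_def Let_def theta_eq by (elim conjE)
  thus ?thesis using assms by (elim allE impE)
qed

text \<open>The kernel decays with any exponent \<open>N\<close>, and \<open>N = \<alpha> + 1\<close> suffices to beat the growth of \<open>h\<close>.\<close>

lemma far_tail:
  assumes al: "\<alpha> \<ge> 0"
  obtains C where "C > 0" "\<And>x0 R x h M. R > 2 * \<rho> x0 \<Longrightarrow> x \<in> ball x0 (\<rho> x0) \<Longrightarrow> M \<ge> 0 \<Longrightarrow> dyadic_growth \<theta> \<alpha> h x0 R M \<Longrightarrow>
     set_integrable lebesgue (- ball x0 R) (\<lambda>y. K x y * h y) \<and> (LINT y:- ball x0 R|lebesgue. norm (K x y * h y)) \<le> C * M"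
proof -
  define N where "N = \<alpha> + 1"
  have N: "N > 0" using al by (simp add: N_def)
  obtain C0 where C0: "C0 > 0" "\<And>xB x R. x \<in> ball xB (\<rho> xB) \<Longrightarrow> R > 2 * \<rho> xB \<Longrightarrow>
        in_Lp p (annulus xB R (2 * R)) (K x) \<and>
        Lp_norm p (annulus xB R (2 * R)) (K x) \<le> C0 * R powr (- real DIM('a) / \<theta>) * (\<rho> xB / R) powr N"
    using kernel_decay[OF N] by blast
  define w where "w = unit_ball_vol (real DIM('a)) powr (1 / \<theta>)"
  have "unit_ball_vol (real DIM('a)) \<noteq> 0" by (metis less_irrefl of_nat_0_le_iff unit_ball_vol_pos)
  hence w: "w > 0" by (simp add: w_def)
  define a where "a k = C0 * w * ((1/2) powr N) ^ k" for k :: nat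
  define S where "S = (\<Sum>k. (real k + 2) * (1/2) ^ k)"
  have Ssum: "summable (\<lambda>k. (real k + 2) * (1/2::real) ^ k)" by (rule summable_tail) auto
  have S: "S \<ge> 0" unfolding S_def by (intro suminf_nonneg Ssum) auto
  have half: "(1/2) powr N * 2 powr \<alpha> = 1/2"
    by (simp add: N_def powr_add powr_divide)
  define B where "B = (2 ^ DIM('a)) powr (1 / \<theta>) * (C0 * w * 2 powr \<alpha> * S)"
  have B: "B \<ge> 0" using C0 w S by (simp add: B_def)
  show ?thesis
  proof (rule that[of "B + 1"])
    show "B + 1 > 0" using B by simp
    fix x0 R x h M
    assume R: "R > 2 * \<rho> x0" and x: "x \<in> ball x0 (\<rho> x0)" and M: "M \<ge> 0" and h: "dyadic_growth \<theta> \<alpha> h x0 R M"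
    have R0: "R > 0" using R rho_pos[of x0] by linarith
    let ?M = "\<lambda>k. M * ((real (k + 1) + 1) * (2 powr \<alpha>) ^ (k + 1))"
    have Rk: "2 ^ k * R > 2 * \<rho> x0" for k :: nat
    proof -
      have "1 * R \<le> 2 ^ k * R" using R0 by (intro mult_right_mono) auto
      thus ?thesis using R by linarith
    qed
    have ann: "annulus x0 (2 ^ k * R) (2 ^ (k + 1) * R) = annulus x0 (2 ^ k * R) (2 * (2 ^ k * R))" for k :: nat
      by (simp add: mult.assoc)
    have k1: "in_Lp p (annulus x0 (2 ^ k * R) (2 ^ (k + 1) * R)) (K x)" for k
      unfolding ann using C0(2)[OF x Rk] by blast
    have k2: "Lp_norm p (annulus x0 (2 ^ k * R) (2 ^ (k + 1) * R)) (K x) \<le> a k * vol_ball x0 (2 ^ k * R) powr (- 1 / \<theta>)" for k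
    proof -
      let ?s = "2 ^ k * R"
      have s: "?s > 0" using R0 by simp
      have v: "?s powr (- real DIM('a) / \<theta>) = w * vol_ball x0 ?s powr (- 1 / \<theta>)"
      proof -
        have "vol_ball x0 ?s powr (- 1 / \<theta>) = unit_ball_vol (real DIM('a)) powr (- 1 / \<theta>) * (?s ^ DIM('a)) powr (- 1 / \<theta>)"
          using s by (simp add: vol_ball_eq powr_mult)
        also have "(?s ^ DIM('a)) powr (- 1 / \<theta>) = ?s powr (- real DIM('a) / \<theta>)"
          using s by (simp only: powr_realpow[symmetric] powr_powr) simp
        finally show ?thesis using w by (simp add: w_def powr_minus)
      qed
      have "(\<rho> x0 / ?s) powr N \<le> ((1/2) ^ k) powr N"
      proof (intro powr_mono2)
        have "\<rho> x0 / R \<le> 1" using R rho_pos[of x0] R0 by (simp add: field_simps)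
        hence "(\<rho> x0 / R) * (1/2) ^ k \<le> 1 * (1/2) ^ k" by (intro mult_right_mono) auto
        thus "\<rho> x0 / ?s \<le> (1/2) ^ k" by (simp add: power_divide mult.commute)
      qed (use N rho_pos[of x0] s in \<open>auto simp: less_imp_le\<close>)
      also have "((1/2::real) ^ k) powr N = ((1/2) powr N) ^ k" by (rule power_powr)
      finally have rN: "(\<rho> x0 / ?s) powr N \<le> ((1/2) powr N) ^ k" .
      have "Lp_norm p (annulus x0 ?s (2 * ?s)) (K x) \<le> C0 * ?s powr (- real DIM('a) / \<theta>) * (\<rho> x0 / ?s) powr N"
        using C0(2)[OF x Rk] by blast
      also have "\<dots> \<le> C0 * ?s powr (- real DIM('a) / \<theta>) * ((1/2) powr N) ^ k"
        using C0 rN by (intro mult_left_mono) auto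
      also have "\<dots> = a k * vol_ball x0 ?s powr (- 1 / \<theta>)" unfolding v a_def by simp
      finally show ?thesis unfolding ann .
    qed
    have h': "Lq_mean_le \<theta> h x0 (2 ^ (k + 1) * R) (?M k)" for k
      using h unfolding dyadic_growth_def by blast
    have aM: "a k * ?M k = C0 * w * 2 powr \<alpha> * M * ((real k + 2) * (1/2) ^ k)" for k
    proof -
      have "a k * ?M k = C0 * w * 2 powr \<alpha> * M * ((real k + 2) * (((1/2) powr N) ^ k * (2 powr \<alpha>) ^ k))"
        by (simp add: a_def algebra_simps)
      also have "((1/2) powr N) ^ k * (2 powr \<alpha>) ^ k = (1/2) ^ k"
        unfolding power_mult_distrib[symmetric] half ..
      finally show ?thesis .
    qed
    have sm: "summable (\<lambda>k. a k * ?M k)" unfolding aM by (intro summable_mult Ssum)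
    have sv: "(\<Sum>k. a k * ?M k) = C0 * w * 2 powr \<alpha> * M * S" unfolding aM S_def by (rule suminf_mult[OF Ssum])
    have a0: "a k \<ge> 0" for k using C0 w by (simp add: a_def)
    have th: "1 / p + 1 / \<theta> = 1" by (rule theta(2))
    note I = annuli_integral[OF p_gt_1 theta(1) th R0 k1 k2 h' sm a0]
    have "B * M \<le> (B + 1) * M" using M by (intro mult_right_mono) auto
    thus "set_integrable lebesgue (- ball x0 R) (\<lambda>y. K x y * h y) \<and> (LINT y:- ball x0 R|lebesgue. norm (K x y * h y)) \<le> (B + 1) * M"
      using I unfolding sv by (auto simp: B_def mult_ac)
  qed
qed

text \<open>The regularity exponent \<open>\<gamma>\<close> beats the growth exponent \<open>\<alpha>\<close> of \<open>h\<close>.\<close>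

lemma difference_tail:
  assumes al: "\<alpha> \<ge> 0" "\<alpha> < \<gamma>"
  obtains C where "C > 0" "\<And>x0 r x h M. r > 0 \<Longrightarrow> x \<in> ball x0 r \<Longrightarrow> M \<ge> 0 \<Longrightarrow> dyadic_growth \<theta> \<alpha> h x0 r M \<Longrightarrow>
     set_integrable lebesgue (- ball x0 (2 * r)) (\<lambda>y. (K x y - K x0 y) * h y) \<and>
     (LINT y:- ball x0 (2 * r)|lebesgue. norm ((K x y - K x0 y) * h y)) \<le> C * M"
proof -
  obtain C0 where C0: "C0 > 0" "\<And>xB r x k. r > 0 \<Longrightarrow> x \<in> ball xB r \<Longrightarrow> k \<ge> 1 \<Longrightarrow>
        in_Lp p (annulus xB (2 ^ k * r) (2 ^ (k + 1) * r)) (\<lambda>y. K x y - K xB y) \<and>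
        Lp_norm p (annulus xB (2 ^ k * r) (2 ^ (k + 1) * r)) (\<lambda>y. K x y - K xB y)
          \<le> C0 * 2 powr (- real k * \<gamma>) * vol_ball xB (2 ^ k * r) powr (- 1 / \<theta>)"
    using T_class unfolding GCZO_star_def Let_def theta_eq by blast
  define b where "b = 2 powr (\<alpha> - \<gamma>)"
  have "2 powr (\<alpha> - \<gamma>) < 2 powr (0::real)" using al by (intro powr_less_mono) auto
  hence b: "0 < b" "b < 1" by (auto simp: b_def)
  define a where "a k = C0 * 2 powr (- real (k + 1) * \<gamma>)" for k :: nat
  define S where "S = (\<Sum>k. (real k + 3) * b ^ k)"
  have Ssum: "summable (\<lambda>k. (real k + 3) * b ^ k)" using b by (rule summable_tail)
  have S: "S \<ge> 0" unfolding S_def using b by (intro suminf_nonneg Ssum) auto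
  define B where "B = (2 ^ DIM('a)) powr (1 / \<theta>) * (C0 * (2 powr \<alpha> * b) * S)"
  have B: "B \<ge> 0" using C0 S b by (simp add: B_def)
  show ?thesis
  proof (rule that[of "B + 1"])
    show "B + 1 > 0" using B by simp
    fix x0 r x h M
    assume r: "r > 0" and x: "x \<in> ball x0 r" and M: "M \<ge> 0" and h: "dyadic_growth \<theta> \<alpha> h x0 r M"
    have R0: "2 * r > 0" using r by simp
    let ?M = "\<lambda>k. M * ((real (k + 2) + 1) * (2 powr \<alpha>) ^ (k + 2))"
    have e: "2 ^ k * (2 * r) = 2 ^ (k + 1) * r" "2 ^ (k + 1) * (2 * r) = 2 ^ (k + 1 + 1) * r"
      "2 ^ (k + 1) * (2 * r) = 2 ^ (k + 2) * r" for k :: nat by simp_all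
    have k1: "in_Lp p (annulus x0 (2 ^ k * (2 * r)) (2 ^ (k + 1) * (2 * r))) (\<lambda>y. K x y - K x0 y)" for k
      unfolding e(1,2) using C0(2)[OF r x, of "k + 1"] by simp
    have k2: "Lp_norm p (annulus x0 (2 ^ k * (2 * r)) (2 ^ (k + 1) * (2 * r))) (\<lambda>y. K x y - K x0 y)
       \<le> a k * vol_ball x0 (2 ^ k * (2 * r)) powr (- 1 / \<theta>)" for k
      unfolding e(1,2) a_def using C0(2)[OF r x, of "k + 1"] by simp
    have h': "Lq_mean_le \<theta> h x0 (2 ^ (k + 1) * (2 * r)) (?M k)" for k
      using h unfolding dyadic_growth_def e(3) by blast
    have aM: "a k * ?M k = C0 * (2 powr \<alpha> * b) * M * ((real k + 3) * b ^ k)" for k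
    proof -
      have "2 powr (- real (k + 1) * \<gamma>) * (2 powr \<alpha>) ^ (k + 2) = (2 powr \<alpha> * b) * b ^ k"
        by (simp add: b_def powr_realpow[symmetric] powr_powr powr_add[symmetric] algebra_simps)
      thus ?thesis unfolding a_def by (simp add: algebra_simps)
    qed
    have sm: "summable (\<lambda>k. a k * ?M k)" unfolding aM by (intro summable_mult Ssum)
    have sv: "(\<Sum>k. a k * ?M k) = C0 * (2 powr \<alpha> * b) * M * S" unfolding aM S_def by (rule suminf_mult[OF Ssum])
    have a0: "a k \<ge> 0" for k using C0 by (simp add: a_def)
    note I = annuli_integral[OF p_gt_1 theta(1) theta(2) R0 k1 k2 h' sm a0]
    have "B * M \<le> (B + 1) * M" using M by (intro mult_right_mono) auto
    thus "set_integrable lebesgue (- ball x0 (2 * r)) (\<lambda>y. (K x y - K x0 y) * h y) \<and>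
     (LINT y:- ball x0 (2 * r)|lebesgue. norm ((K x y - K x0 y) * h y)) \<le> (B + 1) * M"
      using I unfolding sv by (auto simp: B_def mult_ac)
  qed
qed

lemma Campanato_admissible:
  assumes f: "loc_integrable f" "osc_bound \<alpha> f A" and A: "A > 0" and al: "\<alpha> \<ge> 0"
  shows "admissible f"
proof -
  obtain C1 where C1: "C1 > 0" "\<And>(f :: 'a \<Rightarrow> complex) A x r. loc_integrable f \<Longrightarrow> osc_bound \<alpha> f A \<Longrightarrow> A > 0 \<Longrightarrow> r > 0 \<Longrightarrow>
      Lq_mean_le p (\<lambda>y. f y - avg f x r) x r (C1 * A * r powr \<alpha>)"
    using Campanato_power_mean[OF al, of p, where 'a='a] p_gt_1 by auto
  obtain C2 where C2: "C2 > 0" "\<And>(f :: 'a \<Rightarrow> complex) A x r k. loc_integrable f \<Longrightarrow> osc_bound \<alpha> f A \<Longrightarrow> A > 0 \<Longrightarrow> r > 0 \<Longrightarrow>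
      Lq_mean_le \<theta> (\<lambda>y. f y - avg f x r) x (2 ^ k * r) (C2 * A * r powr \<alpha> * (real k + 1) * (2 powr \<alpha>) ^ k)"
    using Campanato_growth[OF al, of \<theta>, where 'a='a] theta by auto
  obtain C3 where C3: "\<And>x0 R x h M. R > 2 * \<rho> x0 \<Longrightarrow> x \<in> ball x0 (\<rho> x0) \<Longrightarrow> M \<ge> 0 \<Longrightarrow> dyadic_growth \<theta> \<alpha> h x0 R M \<Longrightarrow>
     set_integrable lebesgue (- ball x0 R) (\<lambda>y. K x y * h y) \<and> (LINT y:- ball x0 R|lebesgue. norm (K x y * h y)) \<le> C3 * M"
    by (rule far_tail[OF al], rule that)
  show ?thesis unfolding admissible_def loc_Lp_def
  proof (intro conjI allI impI ballI)
    fix x r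
    show "in_Lp p (ball x r) f"
    proof (cases "r > 0")
      case True
      have "in_Lp p (ball x r) (\<lambda>y. f y - avg f x r)"
        using C1(2)[OF f A True, of x] by (simp add: Lq_mean_le_def)
      moreover have "in_Lp p (ball x r) (\<lambda>y. avg f x r)"
        using Lq_mean_le_const[of p "avg f x r" x r] by (simp add: Lq_mean_le_def)
      ultimately have "in_Lp p (ball x r) (\<lambda>y. (f y - avg f x r) + avg f x r)"
        using p_gt_1 by (intro in_Lp_add) auto
      thus ?thesis by simp
    next
      case False
      hence "ball x r = {}" by simp
      moreover have "in_Lp p {} f"
        by (simp add: in_Lp_def set_borel_measurable_def)
      ultimately show ?thesis by (simp only:)
    qed
  next
    fix x0 R x assume R: "R > 2 * \<rho> x0" and x: "x \<in> ball x0 (\<rho> x0)"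
    have R0: "R > 0" using R rho_pos[of x0] by linarith
    define c where "c = avg f x0 R"
    define M where "M = 4 * (C2 * A * R powr \<alpha> + norm c)"
    have M: "M \<ge> 0" using C2 A by (simp add: M_def)
    have "dyadic_growth \<theta> \<alpha> f x0 R M"
      unfolding dyadic_growth_def
    proof
      fix k
      have "Lq_mean_le \<theta> (\<lambda>y. (f y - c) + c) x0 (2 ^ k * R) (4 * (C2 * A * R powr \<alpha> * (real k + 1) * (2 powr \<alpha>) ^ k + norm c))"
        unfolding c_def using theta by (intro Lq_mean_le_add C2 f A R0 Lq_mean_le_const) auto
      moreover have "4 * (C2 * A * R powr \<alpha> * (real k + 1) * (2 powr \<alpha>) ^ k + norm c) \<le> M * ((real k + 1) * (2 powr \<alpha>) ^ k)"
      proof -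
        have "1 * 1 \<le> (real k + 1) * (2 powr \<alpha>) ^ k"
          using al by (intro mult_mono one_le_power) (auto simp: ge_one_powr_ge_zero)
        hence "norm c * 1 \<le> norm c * ((real k + 1) * (2 powr \<alpha>) ^ k)" by (intro mult_left_mono) auto
        thus ?thesis by (simp add: M_def algebra_simps)
      qed
      ultimately show "Lq_mean_le \<theta> f x0 (2 ^ k * R) (M * ((real k + 1) * (2 powr \<alpha>) ^ k))"
        using theta by (auto intro: Lq_mean_le_mono)
    qed
    thus "set_integrable lebesgue (- ball x0 R) (\<lambda>y. K x y * f y)" using C3[OF R x M] by blast
  qed
qed

lemma BMO_admissible:
  assumes "f \<in> BMO \<alpha>" "\<alpha> \<ge> 0" shows "admissible f"
proof -
  obtain A where "A > 0" "osc_bound \<alpha> f A" "loc_integrable f" using assms(1) by (auto simp: BMO_def)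
  thus ?thesis using Campanato_admissible assms(2) by blast
qed

lemma const_admissible: "admissible (\<lambda>_. c)"
  by (rule BMO_admissible[OF const_in_BMO[where \<alpha>=0]]) simp

lemma loc_Lp_diff_const: "loc_Lp f \<Longrightarrow> loc_Lp (\<lambda>y. f y - c)"
  unfolding loc_Lp_def
proof (intro allI)
  fix x :: 'a and r
  assume f: "\<forall>x r. in_Lp p (ball x r) f"
  have "in_Lp p (ball x r) (\<lambda>y. - c)"
    using Lq_mean_le_const[of p "- c" x r] by (simp add: Lq_mean_le_def)
  hence "in_Lp p (ball x r) (\<lambda>y. f y + - c)" using f p_gt_1 by (intro in_Lp_add) auto
  thus "in_Lp p (ball x r) (\<lambda>y. f y - c)" by simp
qed

text \<open>Comparing the values of the tail at two points of the ball only involves differences of kernels.\<close>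

lemma local_oscillation:
  assumes al: "\<alpha> \<ge> 0" "\<alpha> < \<gamma>"
  obtains C where "C > 0" "\<And>x0 r h g M. 0 < r \<Longrightarrow> r \<le> \<rho> x0 \<Longrightarrow> loc_Lp h \<Longrightarrow> is_extension \<rho> T K h g \<Longrightarrow>
      M \<ge> 0 \<Longrightarrow> dyadic_growth \<theta> \<alpha> h x0 r M \<Longrightarrow>
     \<exists>c. AE x in lebesgue. x \<in> ball x0 r \<longrightarrow> norm (g x - T (restr (ball x0 (2 * r)) h) x - c) \<le> C * M"
proof -
  obtain C where C: "C > 0" "\<And>x0 r x h M. r > 0 \<Longrightarrow> x \<in> ball x0 r \<Longrightarrow> M \<ge> 0 \<Longrightarrow> dyadic_growth \<theta> \<alpha> h x0 r M \<Longrightarrow>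
     set_integrable lebesgue (- ball x0 (2 * r)) (\<lambda>y. (K x y - K x0 y) * h y) \<and>
     (LINT y:- ball x0 (2 * r)|lebesgue. norm ((K x y - K x0 y) * h y)) \<le> C * M"
    by (rule difference_tail[OF al], rule that)
  show ?thesis
  proof (rule that[of "2 * C"])
    show "2 * C > 0" using C by simp
    fix x0 r h g M
    assume r: "0 < r" "r \<le> \<rho> x0" and h: "loc_Lp h" "is_extension \<rho> T K h g" and M: "M \<ge> 0"
      and gr: "dyadic_growth \<theta> \<alpha> h x0 r M"
    let ?E = "- ball x0 (2 * r)"
    define P where "P x \<longleftrightarrow> set_integrable lebesgue ?E (\<lambda>y. K x y * h y) \<and>
     g x = T (restr (ball x0 (2 * r)) h) x + (LINT y:?E|lebesgue. K x y * h y)" for x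
    have AEP: "AE x in lebesgue. x \<in> ball x0 r \<longrightarrow> P x"
      unfolding P_def by (rule is_extension_local[OF h r])
    \<comment> \<open>a base point outside the exceptional null set; the tail at \<open>x0\<close> itself need not converge\<close>
    obtain x' where x': "x' \<in> ball x0 r" "P x'"
    proof (rule ccontr)
      assume "\<not> thesis"
      hence "AE x in lebesgue. x \<notin> ball x0 r" using AEP that by (auto elim!: eventually_mono)
      hence "ball x0 r \<in> null_sets lebesgue" by (subst AE_iff_null_sets) auto
      hence "vol_ball x0 r = 0" by (simp add: vol_ball_def measure_def null_sets_def)
      thus False using vol_ball_pos[OF r(1), of x0] by simp
    qed
    define c where "c = (LINT y:?E|lebesgue. K x' y * h y)"
    show "\<exists>c. AE x in lebesgue. x \<in> ball x0 r \<longrightarrow> norm (g x - T (restr (ball x0 (2 * r)) h) x - c) \<le> 2 * C * M"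
    proof (intro exI[of _ c])
      show "AE x in lebesgue. x \<in> ball x0 r \<longrightarrow> norm (g x - T (restr (ball x0 (2 * r)) h) x - c) \<le> 2 * C * M"
        using AEP
      proof eventually_elim
        case (elim x)
        show ?case
        proof
          assume x: "x \<in> ball x0 r"
          let ?D = "\<lambda>x y. (K x y - K x0 y) * h y"
          have D: "set_integrable lebesgue ?E (?D z)" "(LINT y:?E|lebesgue. norm (?D z y)) \<le> C * M" if "z \<in> ball x0 r" for z
            using C(2)[OF r(1) that M gr] by auto
          have "g x - T (restr (ball x0 (2 * r)) h) x - c = (LINT y:?E|lebesgue. K x y * h y) - (LINT y:?E|lebesgue. K x' y * h y)"
            using elim x by (simp add: P_def c_def)
          also have "\<dots> = (LINT y:?E|lebesgue. K x y * h y - K x' y * h y)"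
            using elim x x'(2) by (intro set_integral_diff(2)[symmetric]) (auto simp: P_def)
          also have "\<dots> = (LINT y:?E|lebesgue. ?D x y - ?D x' y)"
            by (rule set_lebesgue_integral_cong) (auto simp: algebra_simps)
          also have "\<dots> = (LINT y:?E|lebesgue. ?D x y) - (LINT y:?E|lebesgue. ?D x' y)"
            by (intro set_integral_diff D x x'(1))
          finally have "norm (g x - T (restr (ball x0 (2 * r)) h) x - c) \<le> norm (LINT y:?E|lebesgue. ?D x y) + norm (LINT y:?E|lebesgue. ?D x' y)"
            by (simp add: norm_triangle_ineq4)
          also have "\<dots> \<le> C * M + C * M"
            using set_integral_norm_le[OF D(1)[OF x]] set_integral_norm_le[OF D(1)[OF x'(1)]] D(2)[OF x] D(2)[OF x'(1)]
            by (intro add_mono) linarith+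
          finally show "norm (g x - T (restr (ball x0 (2 * r)) h) x - c) \<le> 2 * C * M" by simp
        qed
      qed
    qed
  qed
qed

lemma T_local_mean:
  assumes c: "c \<ge> 1"
  obtains C where "C > 0" "\<And>x0 r h M. 0 < r \<Longrightarrow> Lq_mean_le p h x0 (c * r) M \<Longrightarrow>
    set_integrable lebesgue (ball x0 r) (T (restr (ball x0 (c * r)) h)) \<and>
    (LINT y:ball x0 r|lebesgue. norm (T (restr (ball x0 (c * r)) h) y)) \<le> C * M * vol_ball x0 r"
proof -
  obtain C0 where C0: "C0 > 0" "\<And>f. in_Lp p UNIV f \<Longrightarrow> in_Lp p UNIV (T f) \<and> Lp_norm p UNIV (T f) \<le> C0 * Lp_norm p UNIV f"
    using T_bounded by blast
  have p0: "p > 0" using p_gt_1 by simp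
  define C where "C = C0 * (c ^ DIM('a)) powr (1 / p)"
  have "C > 0" using C0 c by (simp add: C_def)
  show ?thesis
  proof (rule that[OF \<open>C > 0\<close>])
    fix x0 :: 'a and r M :: real and h :: "'a \<Rightarrow> complex"
    assume r: "0 < r" and h: "Lq_mean_le p h x0 (c * r) M"
    let ?f = "restr (ball x0 (c * r)) h"
    have f: "in_Lp p UNIV ?f" using h by (intro in_Lp_restr_cong) (simp add: Lq_mean_le_def)
    have M: "M \<ge> 0" using h by (simp add: Lq_mean_le_def)
    have Tf: "in_Lp p UNIV (T ?f)" "Lp_norm p UNIV (T ?f) \<le> C0 * Lp_norm p UNIV ?f" using C0(2)[OF f] by auto
    have "Lp_norm p (ball x0 r) (T ?f) \<le> Lp_norm p UNIV (T ?f)"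
      unfolding Lp_norm_def using Tf(1) p0
      by (intro powr_mono2 set_integral_mono_set_nonneg set_integral_nonneg) (auto simp: in_Lp_def)
    also have "\<dots> \<le> C0 * Lp_norm p (ball x0 (c * r)) h" using Tf(2) p0 by (simp add: Lp_norm_restr)
    also have "\<dots> \<le> C0 * (M * vol_ball x0 (c * r) powr (1 / p))"
      using C0 by (intro mult_left_mono Lq_mean_le_norm h p0) auto
    also have "vol_ball x0 (c * r) = c ^ DIM('a) * vol_ball x0 r" using r c by (intro vol_ball_scale) auto
    also have "C0 * (M * (c ^ DIM('a) * vol_ball x0 r) powr (1 / p)) = C * M * vol_ball x0 r powr (1 / p)"
      by (simp add: C_def powr_mult)
    finally have "Lq_mean_le p (T ?f) x0 r (C * M)"
      using in_Lp_subset[OF Tf(1), of "ball x0 r"] \<open>C > 0\<close> M p0 by (intro Lq_mean_leI) auto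
    thus "set_integrable lebesgue (ball x0 r) (T ?f) \<and> (LINT y:ball x0 r|lebesgue. norm (T ?f y)) \<le> C * M * vol_ball x0 r"
      using Lq_mean_le_L1 p_gt_1 by blast
  qed
qed

end

section \<open>From local estimates to norm bounds\<close>

lemma set_integral_finite_Union_le:
  fixes f :: "'c \<Rightarrow> real"
  assumes C: "finite C" and f: "\<And>z. z \<in> C \<Longrightarrow> set_integrable M (B z) f" "\<And>x. f x \<ge> 0"
    and A: "A \<subseteq> (\<Union>z\<in>C. B z)" "set_integrable M A f"
  shows "(LINT x:A|M. f x) \<le> (\<Sum>z\<in>C. LINT x:B z|M. f x)"
proof -
  have "(LINT x:A|M. f x) \<le> (LINT x|M. (\<Sum>z\<in>C. indicator (B z) x *\<^sub>R f x))"
    unfolding set_lebesgue_integral_def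
  proof (rule integral_mono)
    show "integrable M (\<lambda>x. indicator A x *\<^sub>R f x)" using A by (simp add: set_integrable_def)
    show "integrable M (\<lambda>x. \<Sum>z\<in>C. indicator (B z) x *\<^sub>R f x)"
      using f(1) by (intro Bochner_Integration.integrable_sum) (simp add: set_integrable_def)
    show "indicator A x *\<^sub>R f x \<le> (\<Sum>z\<in>C. indicator (B z) x *\<^sub>R f x)" for x
    proof (cases "x \<in> A")
      case True
      then obtain z where z: "z \<in> C" "x \<in> B z" using A by auto
      have "indicator (B z) x *\<^sub>R f x \<le> (\<Sum>z\<in>C. indicator (B z) x *\<^sub>R f x)"
        using C z f(2)[of x] by (intro member_le_sum) (auto simp: indicator_def)
      thus ?thesis using True z by simp
    qed (use f(2)[of x] in \<open>auto intro!: sum_nonneg simp: indicator_def\<close>)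
  qed
  also have "\<dots> = (\<Sum>z\<in>C. LINT x:B z|M. f x)"
    unfolding set_lebesgue_integral_def using f(1)
    by (intro Bochner_Integration.integral_sum) (simp add: set_integrable_def)
  finally show ?thesis .
qed

lemma set_integrable_of_AE_bound:
  fixes g u :: "'a::euclidean_space \<Rightarrow> complex"
  assumes u: "set_integrable lebesgue (ball x r) u" and g: "g \<in> borel_measurable lebesgue" and r: "r > 0" and e: "e \<ge> 0"
    and ae: "AE y in lebesgue. y \<in> ball x r \<longrightarrow> norm (g y - c) \<le> norm (u y) + e"
  shows "set_integrable lebesgue (ball x r) g"
    and "(LINT y:ball x r|lebesgue. norm (g y - c)) \<le> (LINT y:ball x r|lebesgue. norm (u y)) + e * vol_ball x r"
proof -
  have i: "set_integrable lebesgue (ball x r) (\<lambda>y. norm (u y) + e)"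
    by (rule set_integral_add(1)[OF set_integrable_norm[OF u] set_integrable_const_ball])
  have "set_integrable lebesgue (ball x r) (\<lambda>y. g y - c)"
  proof (rule set_integrable_bound[OF i])
    show "set_borel_measurable lebesgue (ball x r) (\<lambda>y. g y - c)"
      unfolding set_borel_measurable_def using g
      by (intro borel_measurable_scaleR borel_measurable_indicator borel_measurable_diff) auto
    show "AE y in lebesgue. y \<in> ball x r \<longrightarrow> norm (g y - c) \<le> norm (norm (u y) + e)"
      using ae by eventually_elim (use e in auto)
  qed
  hence gc: "set_integrable lebesgue (ball x r) (\<lambda>y. g y - c)" .
  have "set_integrable lebesgue (ball x r) (\<lambda>y. (g y - c) + c)" using gc by (intro set_integral_add) auto
  thus "set_integrable lebesgue (ball x r) g" by simp
  have "(LINT y:ball x r|lebesgue. norm (g y - c)) \<le> (LINT y:ball x r|lebesgue. norm (u y) + e)"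
    using ae by (intro set_integral_mono_AE set_integrable_norm gc i) auto
  also have "\<dots> = (LINT y:ball x r|lebesgue. norm (u y)) + e * vol_ball x r"
    using set_integral_add(2)[OF set_integrable_norm[OF u] set_integrable_const_ball, of e]
    by (simp add: set_integral_const_ball mult.commute)
  finally show "(LINT y:ball x r|lebesgue. norm (g y - c)) \<le> (LINT y:ball x r|lebesgue. norm (u y)) + e * vol_ball x r" .
qed

text \<open>Boundedness with respect to an infimum of admissible constants, expressed through the constants.\<close>

lemma bounded_op_InfI:
  fixes P :: "'f \<Rightarrow> real \<Rightarrow> bool" and Q :: "'g \<Rightarrow> real \<Rightarrow> bool"
  assumes X: "\<And>f. f \<in> X \<Longrightarrow> \<exists>A>0. P f A" and C: "C > 0"
    and PQ: "\<And>f A. f \<in> X \<Longrightarrow> A > 0 \<Longrightarrow> P f A \<Longrightarrow> T f \<in> Y \<and> Q (T f) (C * A)"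
  shows "bounded_op X (\<lambda>f. Inf {A. A > 0 \<and> P f A}) Y (\<lambda>g. Inf {A. A > 0 \<and> Q g A}) T"
  unfolding bounded_op_def
proof (intro exI[of _ C] ballI conjI)
  fix f assume f: "f \<in> X"
  obtain A0 where A0: "A0 > 0" "P f A0" using X[OF f] by blast
  show "T f \<in> Y" using PQ[OF f A0] by blast
  let ?I = "Inf {A. A > 0 \<and> Q (T f) A}"
  have "?I / C \<le> Inf {A. A > 0 \<and> P f A}"
  proof (rule cInf_greatest)
    show "{A. A > 0 \<and> P f A} \<noteq> {}" using A0 by blast
    fix A assume "A \<in> {A. A > 0 \<and> P f A}"
    hence "C * A \<in> {A. A > 0 \<and> Q (T f) A}" using PQ[OF f] C by auto
    hence "?I \<le> C * A" by (rule cInf_lower) (auto intro!: bdd_belowI[of _ 0])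
    thus "?I / C \<le> A" using C by (simp add: field_simps)
  qed
  thus "?I \<le> C * Inf {A. A > 0 \<and> P f A}" using C by (simp add: field_simps)
qed

text \<open>The strict inequality \<open>B > C * A\<close> is due to the infimum, which need not be attained.\<close>

lemma bounded_op_InfE:
  fixes P :: "'f \<Rightarrow> real \<Rightarrow> bool" and Q :: "'g \<Rightarrow> real \<Rightarrow> bool"
  assumes b: "bounded_op X (\<lambda>f. Inf {A. A > 0 \<and> P f A}) Y (\<lambda>g. Inf {A. A > 0 \<and> Q g A}) T"
    and Y: "\<And>g. g \<in> Y \<Longrightarrow> \<exists>A>0. Q g A" and mono: "\<And>g A B. Q g A \<Longrightarrow> A \<le> B \<Longrightarrow> Q g B"
  obtains C where "C \<ge> 0" "\<And>f A B. f \<in> X \<Longrightarrow> A > 0 \<Longrightarrow> P f A \<Longrightarrow> B > C * A \<Longrightarrow> T f \<in> Y \<and> Q (T f) B"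
proof -
  obtain C where C: "\<And>f. f \<in> X \<Longrightarrow> T f \<in> Y \<and> Inf {A. A > 0 \<and> Q (T f) A} \<le> C * Inf {A. A > 0 \<and> P f A}"
    using b unfolding bounded_op_def by blast
  show ?thesis
  proof (rule that[of "max C 0"])
    fix f A B assume f: "f \<in> X" "A > 0" "P f A" and B: "B > max C 0 * A"
    have "Inf {A. A > 0 \<and> P f A} \<ge> 0" using f by (intro cInf_greatest) auto
    moreover have "Inf {A. A > 0 \<and> P f A} \<le> A" using f by (intro cInf_lower) (auto intro!: bdd_belowI[of _ 0])
    ultimately have "C * Inf {A. A > 0 \<and> P f A} \<le> max C 0 * A" by (intro mult_mono) auto
    hence "Inf {A. A > 0 \<and> Q (T f) A} < B" using C[OF f(1)] B by linarith
    moreover have "{A. A > 0 \<and> Q (T f) A} \<noteq> {}" using Y C[OF f(1)] by blast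
    ultimately have "\<exists>A'\<in>{A. A > 0 \<and> Q (T f) A}. A' < B" by (rule_tac cInf_lessD)
    then obtain A' where "A' > 0" "Q (T f) A'" "A' < B" by blast
    thus "T f \<in> Y \<and> Q (T f) B" using C[OF f(1)] mono by (meson less_imp_le)
  qed simp
qed

context critical_operator begin

lemma loc_integrable_of_critical:
  fixes g :: "'a \<Rightarrow> complex"
  assumes "\<And>x. set_integrable lebesgue (ball x (\<rho> x)) g"
  shows "loc_integrable g"
  unfolding loc_integrable_def
proof (intro allI)
  fix x :: 'a and r
  have "cball x r \<subseteq> (\<Union>z\<in>UNIV. ball z (\<rho> z))"
  proof
    fix y show "y \<in> (\<Union>z\<in>UNIV. ball z (\<rho> z))" using rho_pos[of y] by (intro UN_I[of y]) auto
  qed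
  then obtain Z where Z: "finite Z" "cball x r \<subseteq> (\<Union>z\<in>Z. ball z (\<rho> z))"
    using compactE_image[OF compact_cball, of UNIV "\<lambda>z. ball z (\<rho> z)" x r] by auto
  have "set_integrable lebesgue (\<Union>z\<in>Z. ball z (\<rho> z)) g"
    using Z assms by (intro set_integrable_UN) auto
  thus "set_integrable lebesgue (ball x r) g"
    using Z(2) ball_subset_cball[of x r] by (rule_tac set_integrable_subset) auto
qed

text \<open>
  A ball of radius at least the critical one is covered by critical balls that are centred in it and whose
  fivefold contractions are disjoint; their radii are at most comparable to its own, since \<open>\<rho>\<close> varies
  slowly.
\<close>

lemma size_from_critical:
  assumes al: "\<alpha> \<ge> 0"
  obtains C where "C > 0" "\<And>g D x r. loc_integrable (g :: 'a \<Rightarrow> complex) \<Longrightarrow> D \<ge> 0 \<Longrightarrow>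
    (\<forall>x. (LINT y:ball x (\<rho> x)|lebesgue. norm (g y)) \<le> D * \<rho> x powr \<alpha> * vol_ball x (\<rho> x)) \<Longrightarrow>
    \<rho> x \<le> r \<Longrightarrow> (LINT y:ball x r|lebesgue. norm (g y)) \<le> C * D * r powr \<alpha> * vol_ball x r"
proof -
  obtain c0 where c0: "c0 > 0" "\<And>x y. dist x y \<le> 1 * \<rho> x \<Longrightarrow> c0 * \<rho> x \<le> \<rho> y"
    using rho_slow[of 1] by auto
  define c where "c = min c0 1"
  have c: "c > 0" "c \<le> 1" using c0 by (auto simp: c_def)
  have cr: "c * \<rho> z \<le> r" if "dist x z \<le> r" "\<rho> x \<le> r" for x z r
  proof (cases "dist x z \<le> \<rho> z")
    case True
    have "c * \<rho> z \<le> c0 * \<rho> z" using rho_pos[of z] by (intro mult_right_mono) (auto simp: c_def)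
    also have "\<dots> \<le> \<rho> x" using c0(2)[of z x] True by (simp add: dist_commute)
    finally show ?thesis using that by simp
  next
    case False
    have "c * \<rho> z \<le> 1 * \<rho> z" using c rho_pos[of z] by (intro mult_right_mono) auto
    thus ?thesis using False that by simp
  qed
  let ?d = "DIM('a)"
  show ?thesis
  proof (rule that[of "(1 / c) powr \<alpha> * 5 ^ ?d * (2 / c) ^ ?d"])
    show "(1 / c) powr \<alpha> * 5 ^ ?d * (2 / c) ^ ?d > 0" using c by simp
    fix g :: "'a \<Rightarrow> complex" and D r x
    assume g: "loc_integrable g" and D: "D \<ge> 0" and r: "\<rho> x \<le> r"
      and crit: "\<forall>x. (LINT y:ball x (\<rho> x)|lebesgue. norm (g y)) \<le> D * \<rho> x powr \<alpha> * vol_ball x (\<rho> x)"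
    have r0: "r > 0" using r rho_pos[of x] by linarith
    have gi: "set_integrable lebesgue (ball x r) (\<lambda>y. norm (g y))" for x r
      using g by (intro set_integrable_norm) (simp add: loc_integrable_def)
    have "cball x r \<subseteq> (\<Union>z\<in>cball x r. ball z (\<rho> z / 5))"
    proof
      fix y assume "y \<in> cball x r"
      thus "y \<in> (\<Union>z\<in>cball x r. ball z (\<rho> z / 5))" using rho_pos[of y] by (intro UN_I[of y]) auto
    qed
    then obtain Z where Z: "Z \<subseteq> cball x r" "finite Z" "cball x r \<subseteq> (\<Union>z\<in>Z. ball z (\<rho> z / 5))"
      using compactE_image[OF compact_cball, of "cball x r" "\<lambda>z. ball z (\<rho> z / 5)" x r] by auto
    have rz: "\<rho> z \<le> r / c" if "z \<in> cball x r" for z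
      using cr[of x z r] that r c by (simp add: field_simps)
    obtain C where C: "C \<subseteq> Z" "pairwise (\<lambda>i j. disjnt (ball (id i) (\<rho> i / 5)) (ball (id j) (\<rho> j / 5))) C"
       "cball x r \<subseteq> (\<Union>i\<in>C. ball (id i) (5 * (\<rho> i / 5)))"
    proof (rule Vitali_covering_lemma_balls[where S="cball x r" and K=Z and a=id and r="\<lambda>z. \<rho> z / 5" and B="r / c"])
      show "cball x r \<subseteq> (\<Union>i\<in>Z. ball (id i) (\<rho> i / 5))" using Z by simp
      show "0 < \<rho> i / 5 \<and> \<rho> i / 5 \<le> r / c" if "i \<in> Z" for i
      proof -
        have "\<rho> i \<le> r / c" using rz that Z(1) by blast
        thus ?thesis using rho_pos[of i] by linarith
      qed
    qed (use that in blast)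
    have fC: "finite C" using C(1) Z(2) finite_subset by blast
    have Cx: "z \<in> cball x r" if "z \<in> C" for z using that C(1) Z(1) by blast
    have "(LINT y:ball x r|lebesgue. norm (g y)) \<le> (\<Sum>z\<in>C. LINT y:ball z (\<rho> z)|lebesgue. norm (g y))"
      using C(3) ball_subset_cball[of x r] by (intro set_integral_finite_Union_le fC gi) auto
    also have "\<dots> \<le> (\<Sum>z\<in>C. D * (r / c) powr \<alpha> * (5 ^ ?d * vol_ball z (\<rho> z / 5)))"
    proof (intro sum_mono)
      fix z assume z: "z \<in> C"
      have "(LINT y:ball z (\<rho> z)|lebesgue. norm (g y)) \<le> D * \<rho> z powr \<alpha> * vol_ball z (\<rho> z)" using crit by blast
      also have "\<dots> \<le> D * (r / c) powr \<alpha> * vol_ball z (\<rho> z)"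
        using D al rho_pos[of z] rz[OF Cx[OF z]] by (intro mult_right_mono mult_left_mono powr_mono2) auto
      also have "vol_ball z (\<rho> z) = 5 ^ ?d * vol_ball z (\<rho> z / 5)"
        using vol_ball_scale[of "\<rho> z / 5" 5 z z] rho_pos[of z] by simp
      finally show "(LINT y:ball z (\<rho> z)|lebesgue. norm (g y)) \<le> D * (r / c) powr \<alpha> * (5 ^ ?d * vol_ball z (\<rho> z / 5))" .
    qed
    also have "\<dots> = D * (r / c) powr \<alpha> * 5 ^ ?d * (\<Sum>z\<in>C. vol_ball z (\<rho> z / 5))"
      by (simp add: sum_distrib_left mult.assoc)
    also have "(\<Sum>z\<in>C. vol_ball z (\<rho> z / 5)) = measure lebesgue (\<Union>z\<in>C. ball z (\<rho> z / 5))"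
      unfolding vol_ball_def using C(2) by (intro measure_UNION'[symmetric] fC) auto
    finally have 1: "(LINT y:ball x r|lebesgue. norm (g y))
      \<le> D * (r / c) powr \<alpha> * 5 ^ ?d * measure lebesgue (\<Union>z\<in>C. ball z (\<rho> z / 5))" .
    have "measure lebesgue (\<Union>z\<in>C. ball z (\<rho> z / 5)) \<le> vol_ball x (2 / c * r)"
      unfolding vol_ball_def
    proof (rule measure_mono_fmeasurable)
      show "(\<Union>z\<in>C. ball z (\<rho> z / 5)) \<subseteq> ball x (2 / c * r)"
      proof (intro UN_least subsetI)
        fix z y assume z: "z \<in> C" and y: "y \<in> ball z (\<rho> z / 5)"
        have "dist x y \<le> dist x z + dist z y" by (rule dist_triangle)
        also have "\<dots> < r + r / c" using Cx[OF z] rz[OF Cx[OF z]] y rho_pos[of z] by simp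
        also have "\<dots> \<le> r / c + r / c" using c r0 by (simp add: field_simps)
        finally show "y \<in> ball x (2 / c * r)" by simp
      qed
    qed (auto intro!: sets.finite_UN fC)
    also have "vol_ball x (2 / c * r) = (2 / c) ^ ?d * vol_ball x r" using c r0 by (intro vol_ball_scale) auto
    finally have "D * (r / c) powr \<alpha> * 5 ^ ?d * measure lebesgue (\<Union>z\<in>C. ball z (\<rho> z / 5))
      \<le> D * (r / c) powr \<alpha> * 5 ^ ?d * ((2 / c) ^ ?d * vol_ball x r)"
      using D by (intro mult_left_mono) auto
    also have "\<dots> = ((1 / c) powr \<alpha> * 5 ^ ?d * (2 / c) ^ ?d) * D * r powr \<alpha> * vol_ball x r"
      using powr_mult[of "1 / c" r \<alpha>] by simp
    finally show "(LINT y:ball x r|lebesgue. norm (g y)) \<le> ((1 / c) powr \<alpha> * 5 ^ ?d * (2 / c) ^ ?d) * D * r powr \<alpha> * vol_ball x r"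
      using 1 by linarith
  qed
qed

text \<open>
  The part of \<open>f - f\<^sub>B\<close> near the ball is estimated by the boundedness of \<open>T\<close> on \<open>L\<^sup>p\<close>, the rest by
  the regularity of the kernel.
\<close>

lemma small_ball_oscillation:
  assumes al: "\<alpha> \<ge> 0" "\<alpha> < \<gamma>"
  obtains C where "C > 0" "\<And>f A x0 r g. loc_integrable f \<Longrightarrow> osc_bound \<alpha> f A \<Longrightarrow> A > 0 \<Longrightarrow> 0 < r \<Longrightarrow> r \<le> \<rho> x0 \<Longrightarrow>
     is_extension \<rho> T K (\<lambda>y. f y - avg f x0 r) g \<Longrightarrow>
     set_integrable lebesgue (ball x0 r) g \<and> (\<exists>c. (LINT y:ball x0 r|lebesgue. norm (g y - c)) \<le> C * A * r powr \<alpha> * vol_ball x0 r)"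
proof -
  obtain C1 where C1: "C1 > 0" "\<And>(f :: 'a \<Rightarrow> complex) A x r k. loc_integrable f \<Longrightarrow> osc_bound \<alpha> f A \<Longrightarrow> A > 0 \<Longrightarrow> r > 0 \<Longrightarrow>
      Lq_mean_le p (\<lambda>y. f y - avg f x r) x (2 ^ k * r) (C1 * A * r powr \<alpha> * (real k + 1) * (2 powr \<alpha>) ^ k)"
    using Campanato_growth[OF al(1), of p, where 'a='a] p_gt_1 by auto
  obtain C2 where C2: "C2 > 0" "\<And>(f :: 'a \<Rightarrow> complex) A x r k. loc_integrable f \<Longrightarrow> osc_bound \<alpha> f A \<Longrightarrow> A > 0 \<Longrightarrow> r > 0 \<Longrightarrow>
      Lq_mean_le \<theta> (\<lambda>y. f y - avg f x r) x (2 ^ k * r) (C2 * A * r powr \<alpha> * (real k + 1) * (2 powr \<alpha>) ^ k)"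
    using Campanato_growth[OF al(1), of \<theta>, where 'a='a] theta by auto
  obtain C3 where C3: "C3 > 0" "\<And>x0 r h g M. 0 < r \<Longrightarrow> r \<le> \<rho> x0 \<Longrightarrow> loc_Lp h \<Longrightarrow> is_extension \<rho> T K h g \<Longrightarrow>
      M \<ge> 0 \<Longrightarrow> dyadic_growth \<theta> \<alpha> h x0 r M \<Longrightarrow>
     \<exists>c. AE x in lebesgue. x \<in> ball x0 r \<longrightarrow> norm (g x - T (restr (ball x0 (2 * r)) h) x - c) \<le> C3 * M"
    by (rule local_oscillation[OF al], rule that)
  obtain C4 where C4: "C4 > 0" "\<And>x0 r h M. 0 < r \<Longrightarrow> Lq_mean_le p h x0 (2 * r) M \<Longrightarrow>
    set_integrable lebesgue (ball x0 r) (T (restr (ball x0 (2 * r)) h)) \<and>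
    (LINT y:ball x0 r|lebesgue. norm (T (restr (ball x0 (2 * r)) h) y)) \<le> C4 * M * vol_ball x0 r"
    by (rule T_local_mean[of 2], simp, rule that)
  define C where "C = C4 * C1 * 2 * 2 powr \<alpha> + C3 * C2"
  have "C > 0" using C1 C2 C3 C4 by (simp add: C_def add_pos_pos)
  show ?thesis
  proof (rule that[OF \<open>C > 0\<close>])
    fix f :: "'a \<Rightarrow> complex" and A r :: real and x0 :: 'a and g
    assume f: "loc_integrable f" "osc_bound \<alpha> f A" "A > 0" and r: "0 < r" "r \<le> \<rho> x0"
      and g: "is_extension \<rho> T K (\<lambda>y. f y - avg f x0 r) g"
    define h where "h y = f y - avg f x0 r" for y
    have g': "is_extension \<rho> T K h g" using g by (simp add: h_def[abs_def])
    have "loc_Lp f" using Campanato_admissible[OF f al(1)] by (simp add: admissible_def)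
    hence hL: "loc_Lp h" unfolding h_def by (rule loc_Lp_diff_const)
    have M0: "C2 * A * r powr \<alpha> \<ge> 0" using C2 f by simp
    have gr: "dyadic_growth \<theta> \<alpha> h x0 r (C2 * A * r powr \<alpha>)"
      unfolding dyadic_growth_def h_def using C2(2)[OF f r(1), of x0] by (simp add: mult.assoc)
    obtain c where c: "AE x in lebesgue. x \<in> ball x0 r \<longrightarrow> norm (g x - T (restr (ball x0 (2 * r)) h) x - c) \<le> C3 * (C2 * A * r powr \<alpha>)"
      using C3(2)[OF r hL g' M0 gr] by blast
    let ?u = "T (restr (ball x0 (2 * r)) h)"
    have ae: "AE x in lebesgue. x \<in> ball x0 r \<longrightarrow> norm (g x - c) \<le> norm (?u x) + C3 * (C2 * A * r powr \<alpha>)"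
      using c
    proof eventually_elim
      case (elim x)
      have "norm (g x - c) \<le> norm (?u x) + norm (g x - ?u x - c)"
        using norm_triangle_ineq[of "?u x" "g x - ?u x - c"] by simp
      thus ?case using elim by auto
    qed
    have "Lq_mean_le p h x0 (2 ^ 1 * r) (C1 * A * r powr \<alpha> * (real 1 + 1) * (2 powr \<alpha>) ^ 1)"
      unfolding h_def by (rule C1(2)[OF f r(1)])
    hence u: "set_integrable lebesgue (ball x0 r) ?u"
        "(LINT y:ball x0 r|lebesgue. norm (?u y)) \<le> C4 * (C1 * A * r powr \<alpha> * 2 * 2 powr \<alpha>) * vol_ball x0 r"
      using C4(2)[OF r(1), of h x0] by auto
    have e0: "C3 * (C2 * A * r powr \<alpha>) \<ge> 0" using C3 M0 by simp
    have gm: "g \<in> borel_measurable lebesgue" by (rule is_extension_measurable[OF hL g'])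
    note S = set_integrable_of_AE_bound[OF u(1) gm r(1) e0 ae]
    have "(LINT y:ball x0 r|lebesgue. norm (g y - c))
        \<le> C4 * (C1 * A * r powr \<alpha> * 2 * 2 powr \<alpha>) * vol_ball x0 r + C3 * (C2 * A * r powr \<alpha>) * vol_ball x0 r"
      using S(2) u(2) by linarith
    also have "\<dots> = C * A * r powr \<alpha> * vol_ball x0 r" by (simp add: C_def algebra_simps)
    finally show "set_integrable lebesgue (ball x0 r) g \<and> (\<exists>c. (LINT y:ball x0 r|lebesgue. norm (g y - c)) \<le> C * A * r powr \<alpha> * vol_ball x0 r)"
      using S(1) by blast
  qed
qed

text \<open>
  On critical balls \<open>T\<close> controls the size, not only the oscillation, because of the decay of the kernel at
  distances above \<open>2 * \<rho>\<close>; hence the truncation at \<open>3 * \<rho>\<close>.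
\<close>

lemma critical_ball_size:
  assumes al: "\<alpha> \<ge> 0"
  obtains C where "C > 0" "\<And>h g x0 M. loc_Lp h \<Longrightarrow> is_extension \<rho> T K h g \<Longrightarrow> M \<ge> 0 \<Longrightarrow>
     Lq_mean_le p h x0 (3 * \<rho> x0) M \<Longrightarrow> dyadic_growth \<theta> \<alpha> h x0 (3 * \<rho> x0) M \<Longrightarrow>
     set_integrable lebesgue (ball x0 (\<rho> x0)) g \<and> (LINT y:ball x0 (\<rho> x0)|lebesgue. norm (g y)) \<le> C * M * vol_ball x0 (\<rho> x0)"
proof -
  obtain C3 where C3: "C3 > 0" "\<And>x0 R x h M. R > 2 * \<rho> x0 \<Longrightarrow> x \<in> ball x0 (\<rho> x0) \<Longrightarrow> M \<ge> 0 \<Longrightarrow> dyadic_growth \<theta> \<alpha> h x0 R M \<Longrightarrow>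
     set_integrable lebesgue (- ball x0 R) (\<lambda>y. K x y * h y) \<and> (LINT y:- ball x0 R|lebesgue. norm (K x y * h y)) \<le> C3 * M"
    by (rule far_tail[OF al], rule that)
  obtain C4 where C4: "C4 > 0" "\<And>x0 r h M. 0 < r \<Longrightarrow> Lq_mean_le p h x0 (3 * r) M \<Longrightarrow>
    set_integrable lebesgue (ball x0 r) (T (restr (ball x0 (3 * r)) h)) \<and>
    (LINT y:ball x0 r|lebesgue. norm (T (restr (ball x0 (3 * r)) h) y)) \<le> C4 * M * vol_ball x0 r"
    by (rule T_local_mean[of 3], simp, rule that)
  have "C4 + C3 > 0" using C3 C4 by simp
  show ?thesis
  proof (rule that[OF \<open>C4 + C3 > 0\<close>])
    fix h g x0 M
    assume h: "loc_Lp h" and g: "is_extension \<rho> T K h g" and M: "M \<ge> 0"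
      and hp: "Lq_mean_le p h x0 (3 * \<rho> x0) M" and gr: "dyadic_growth \<theta> \<alpha> h x0 (3 * \<rho> x0) M"
    have R: "3 * \<rho> x0 > 2 * \<rho> x0" using rho_pos[of x0] by simp
    let ?u = "T (restr (ball x0 (3 * \<rho> x0)) h)"
    from g[unfolded is_extension_def, rule_format, OF R]
    have "AE x in lebesgue. x \<in> ball x0 (\<rho> x0) \<longrightarrow>
        g x = ?u x + (LINT y:- ball x0 (3 * \<rho> x0)|lebesgue. K x y * h y)"
      by eventually_elim blast
    hence ae: "AE x in lebesgue. x \<in> ball x0 (\<rho> x0) \<longrightarrow> norm (g x - 0) \<le> norm (?u x) + C3 * M"
    proof eventually_elim
      case (elim x)
      show ?case
      proof
        assume x: "x \<in> ball x0 (\<rho> x0)"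
        have "norm (LINT y:- ball x0 (3 * \<rho> x0)|lebesgue. K x y * h y) \<le> C3 * M"
          using C3(2)[OF R x M gr] set_integral_norm_le[of lebesgue "- ball x0 (3 * \<rho> x0)" "\<lambda>y. K x y * h y"] by linarith
        thus "norm (g x - 0) \<le> norm (?u x) + C3 * M"
          using elim x norm_triangle_ineq[of "?u x" "LINT y:- ball x0 (3 * \<rho> x0)|lebesgue. K x y * h y"] by simp
      qed
    qed
    have u: "set_integrable lebesgue (ball x0 (\<rho> x0)) ?u"
        "(LINT y:ball x0 (\<rho> x0)|lebesgue. norm (?u y)) \<le> C4 * M * vol_ball x0 (\<rho> x0)"
      using C4(2)[OF rho_pos hp] by auto
    have gm: "g \<in> borel_measurable lebesgue" by (rule is_extension_measurable[OF h g])
    have e0: "C3 * M \<ge> 0" using C3 M by simp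
    note S = set_integrable_of_AE_bound[OF u(1) gm rho_pos e0 ae]
    show "set_integrable lebesgue (ball x0 (\<rho> x0)) g \<and> (LINT y:ball x0 (\<rho> x0)|lebesgue. norm (g y)) \<le> (C4 + C3) * M * vol_ball x0 (\<rho> x0)"
      using S u(2) by (simp add: algebra_simps)
  qed
qed

text \<open>
  The term \<open>f\<^sub>B T1\<close> on small balls and the size on critical balls are left as assumptions because they are
  verified in different ways: the first by the weighted oscillation condition or by \<open>T1 = 0\<close>, the
  second by the size condition on \<open>f\<close> or, if \<open>T1 = 0\<close>, after subtracting a constant from \<open>f\<close>.
\<close>

lemma Campanato_bounds_of_local:
  assumes al: "\<alpha> \<ge> 0" "\<alpha> < \<gamma>"
  obtains C where "C > 0" "\<And>f A D F T1. loc_integrable f \<Longrightarrow> osc_bound \<alpha> f A \<Longrightarrow> A > 0 \<Longrightarrow> D \<ge> 0 \<Longrightarrow>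
     is_extension \<rho> T K f F \<Longrightarrow> is_extension \<rho> T K (\<lambda>_. 1) T1 \<Longrightarrow>
     (\<forall>x r. 0 < r \<longrightarrow> r \<le> \<rho> x / 2 \<longrightarrow> set_integrable lebesgue (ball x r) T1 \<and>
        norm (avg f x r) * (LINT y:ball x r|lebesgue. norm (T1 y - avg T1 x r)) \<le> D * A * r powr \<alpha> * vol_ball x r) \<Longrightarrow>
     (\<forall>x. set_integrable lebesgue (ball x (\<rho> x)) F \<and>
        (LINT y:ball x (\<rho> x)|lebesgue. norm (F y)) \<le> D * A * \<rho> x powr \<alpha> * vol_ball x (\<rho> x)) \<Longrightarrow>
     loc_integrable F \<and> osc_bound \<alpha> F (C * (D + 1) * A) \<and> size_bound \<rho> \<alpha> F (C * (D + 1) * A)"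
proof -
  obtain C1 where C1: "C1 > 0" "\<And>f A x0 r g. loc_integrable f \<Longrightarrow> osc_bound \<alpha> f A \<Longrightarrow> A > 0 \<Longrightarrow> 0 < r \<Longrightarrow> r \<le> \<rho> x0 \<Longrightarrow>
     is_extension \<rho> T K (\<lambda>y. f y - avg f x0 r) g \<Longrightarrow>
     set_integrable lebesgue (ball x0 r) g \<and> (\<exists>c. (LINT y:ball x0 r|lebesgue. norm (g y - c)) \<le> C1 * A * r powr \<alpha> * vol_ball x0 r)"
    by (rule small_ball_oscillation[OF al], rule that)
  obtain C2 where C2: "C2 > 0" "\<And>g D x r. loc_integrable (g :: 'a \<Rightarrow> complex) \<Longrightarrow> D \<ge> 0 \<Longrightarrow>
    (\<forall>x. (LINT y:ball x (\<rho> x)|lebesgue. norm (g y)) \<le> D * \<rho> x powr \<alpha> * vol_ball x (\<rho> x)) \<Longrightarrow>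
    \<rho> x \<le> r \<Longrightarrow> (LINT y:ball x r|lebesgue. norm (g y)) \<le> C2 * D * r powr \<alpha> * vol_ball x r"
    by (rule size_from_critical[OF al(1)], rule that)
  let ?d = "DIM('a)"
  let ?\<kappa> = "scale_const ?d \<alpha>"
  have \<kappa>: "?\<kappa> > 0" by (rule scale_const_pos)
  define E where "E = 2 * C1 + 2 + 2 * C2 + 2 * (2 powr \<alpha> * 2 ^ ?d)"
  have E: "E > 0" using C1 C2 by (simp add: E_def add_pos_pos)
  show ?thesis
  proof (rule that[of "E / ?\<kappa>"])
    show "E / ?\<kappa> > 0" using E \<kappa> by simp
    fix f :: "'a \<Rightarrow> complex" and A D :: real and F T1 :: "'a \<Rightarrow> complex"
    assume f: "loc_integrable f" "osc_bound \<alpha> f A" "A > 0" and D: "D \<ge> 0"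
      and F: "is_extension \<rho> T K f F" and T1: "is_extension \<rho> T K (\<lambda>_. 1) T1"
      and small: "\<forall>x r. 0 < r \<longrightarrow> r \<le> \<rho> x / 2 \<longrightarrow> set_integrable lebesgue (ball x r) T1 \<and>
        norm (avg f x r) * (LINT y:ball x r|lebesgue. norm (T1 y - avg T1 x r)) \<le> D * A * r powr \<alpha> * vol_ball x r"
      and crit: "\<forall>x. set_integrable lebesgue (ball x (\<rho> x)) F \<and>
        (LINT y:ball x (\<rho> x)|lebesgue. norm (F y)) \<le> D * A * \<rho> x powr \<alpha> * vol_ball x (\<rho> x)"
    have Fl: "loc_integrable F" using crit by (intro loc_integrable_of_critical) blast
    have Fi: "set_integrable lebesgue (ball x r) F" for x r using Fl by (simp add: loc_integrable_def)
    have DA: "D * A \<ge> 0" using D f by simp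
    have AD: "D * A \<le> (D + 1) * A" "A \<le> (D + 1) * A" using D f by (auto simp: algebra_simps)
    let ?B = "E * ((D + 1) * A)"
    have le: "c * X \<le> ?B" if "X \<le> (D + 1) * A" "0 \<le> X" "c \<le> E" "0 \<le> c" for c X
      using that E by (intro mult_mono) auto
    have size: "(LINT y:ball x r|lebesgue. norm (F y)) \<le> C2 * (D * A) * r powr \<alpha> * vol_ball x r" if "\<rho> x \<le> r" for x r
      using C2(2)[OF Fl DA _ that] crit by blast
    have fL: "loc_Lp f" "loc_Lp (\<lambda>_. 1)"
      using Campanato_admissible[OF f al(1)] const_admissible[of 1] by (auto simp: admissible_def)
    have osc: "(LINT y:ball x r|lebesgue. norm (F y - avg F x r)) \<le> ?B * r powr \<alpha> * vol_ball x r" if r: "r > 0" for x r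
    proof -
      \<comment> \<open>radii just below the critical one are compared with the critical ball\<close>
      consider "r \<le> \<rho> x / 2" | "\<rho> x / 2 < r" "r < \<rho> x" | "\<rho> x \<le> r" by linarith
      thus ?thesis
      proof cases
        case 1
        define a where "a = avg f x r"
        define g where "g y = F y - a * T1 y" for y
        have "is_extension \<rho> T K (\<lambda>y. f y - a * 1) g"
          unfolding g_def by (rule is_extension_linear[OF fL(1) F fL(2) T1])
        hence g: "is_extension \<rho> T K (\<lambda>y. f y - avg f x r) g" by (simp add: a_def)
        have "r \<le> \<rho> x" using 1 rho_pos[of x] by linarith
        obtain c where gi: "set_integrable lebesgue (ball x r) g"
          and c: "(LINT y:ball x r|lebesgue. norm (g y - c)) \<le> C1 * A * r powr \<alpha> * vol_ball x r"
          using C1(2)[OF f r \<open>r \<le> \<rho> x\<close> g] by blast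
        have Ti: "set_integrable lebesgue (ball x r) T1"
          and Tb: "norm a * (LINT y:ball x r|lebesgue. norm (T1 y - avg T1 x r)) \<le> D * A * r powr \<alpha> * vol_ball x r"
          using small[rule_format, OF r 1] by (auto simp: a_def)
        define c' where "c' = c + a * avg T1 x r"
        have i1: "set_integrable lebesgue (ball x r) (\<lambda>y. norm (g y - c))"
          using gi by (intro set_integrable_norm set_integral_diff) auto
        have i2: "set_integrable lebesgue (ball x r) (\<lambda>y. norm a * norm (T1 y - avg T1 x r))"
          using Ti by (intro set_integrable_mult_right set_integrable_norm set_integral_diff) auto
        have "(LINT y:ball x r|lebesgue. norm (F y - avg F x r)) \<le> 2 * (LINT y:ball x r|lebesgue. norm (F y - c'))"
          by (rule osc_le_twice[OF Fi r])
        also have "(LINT y:ball x r|lebesgue. norm (F y - c')) \<le> (LINT y:ball x r|lebesgue. norm (g y - c) + norm a * norm (T1 y - avg T1 x r))"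
        proof (intro set_integral_mono set_integral_add i1 i2)
          show "set_integrable lebesgue (ball x r) (\<lambda>y. norm (F y - c'))"
            using Fi by (intro set_integrable_norm set_integral_diff) auto
          fix y
          have "F y - c' = (g y - c) + a * (T1 y - avg T1 x r)" by (simp add: g_def c'_def algebra_simps)
          thus "norm (F y - c') \<le> norm (g y - c) + norm a * norm (T1 y - avg T1 x r)"
            by (metis norm_mult norm_triangle_ineq)
        qed
        also have "\<dots> = (LINT y:ball x r|lebesgue. norm (g y - c)) + norm a * (LINT y:ball x r|lebesgue. norm (T1 y - avg T1 x r))"
          using i1 i2 by (subst set_integral_add) auto
        also have "\<dots> \<le> C1 * A * r powr \<alpha> * vol_ball x r + D * A * r powr \<alpha> * vol_ball x r" using c Tb by (intro add_mono)
        also have "2 * (C1 * A * r powr \<alpha> * vol_ball x r + D * A * r powr \<alpha> * vol_ball x r)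
           = (2 * C1 * A + 2 * (D * A)) * r powr \<alpha> * vol_ball x r" by (simp add: algebra_simps)
        also have "\<dots> \<le> ?B * r powr \<alpha> * vol_ball x r"
        proof (intro mult_right_mono)
          have "2 * C1 * A + 2 * (D * A) \<le> 2 * C1 * ((D + 1) * A) + 2 * ((D + 1) * A)"
            using AD C1 by (intro add_mono mult_left_mono) auto
          also have "\<dots> = (2 * C1 + 2) * ((D + 1) * A)" by (simp add: algebra_simps)
          also have "\<dots> \<le> ?B" using C1 C2 D f by (intro le) (auto simp: E_def)
          finally show "2 * C1 * A + 2 * (D * A) \<le> ?B" .
        qed auto
        finally show ?thesis by simp
      next
        case 2
        have "(LINT y:ball x r|lebesgue. norm (F y - avg F x r)) \<le> 2 * (LINT y:ball x r|lebesgue. norm (F y - 0))"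
          by (rule osc_le_twice[OF Fi r])
        also have "(LINT y:ball x r|lebesgue. norm (F y - 0)) \<le> (LINT y:ball x (\<rho> x)|lebesgue. norm (F y))"
          using 2 Fi by (simp, intro set_integral_mono_set_nonneg set_integrable_norm subset_ball) auto
        also have "\<dots> \<le> D * A * \<rho> x powr \<alpha> * vol_ball x (\<rho> x)" using crit by blast
        also have "\<dots> \<le> D * A * (2 * r) powr \<alpha> * vol_ball x (2 * r)"
          using 2 D f(3) al rho_pos[of x] r by (intro mult_mono powr_mono2 vol_ball_mono) auto
        also have "vol_ball x (2 * r) = 2 ^ ?d * vol_ball x r" using r by (intro vol_ball_scale) auto
        also have "2 * (D * A * (2 * r) powr \<alpha> * (2 ^ ?d * vol_ball x r)) = (2 * (2 powr \<alpha> * 2 ^ ?d)) * (D * A) * r powr \<alpha> * vol_ball x r"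
          by (simp add: powr_mult)
        also have "\<dots> \<le> ?B * r powr \<alpha> * vol_ball x r"
          using AD DA D f(3) C1(1) C2(1) by (intro mult_right_mono le) (auto simp: E_def)
        finally show ?thesis by simp
      next
        case 3
        have "(LINT y:ball x r|lebesgue. norm (F y - avg F x r)) \<le> 2 * (LINT y:ball x r|lebesgue. norm (F y - 0))"
          by (rule osc_le_twice[OF Fi r])
        also have "\<dots> \<le> (2 * C2) * (D * A) * r powr \<alpha> * vol_ball x r" using size[OF 3] by simp
        also have "\<dots> \<le> ?B * r powr \<alpha> * vol_ball x r"
          using AD DA D f(3) C1(1) C2(1) by (intro mult_right_mono le) (auto simp: E_def add_nonneg_nonneg)
        finally show ?thesis .
      qed
    qed
    have e: "E / ?\<kappa> * (D + 1) * A * (?\<kappa> * r powr \<alpha>) * vol_ball x r = ?B * r powr \<alpha> * vol_ball x r" for x r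
      using \<kappa> by simp
    have "osc_bound \<alpha> F (E / ?\<kappa> * (D + 1) * A)"
      unfolding osc_bound_iff e using osc by blast
    moreover have "size_bound \<rho> \<alpha> F (E / ?\<kappa> * (D + 1) * A)"
      unfolding size_bound_iff e
    proof (intro allI impI)
      fix x r assume r: "0 < r \<and> \<rho> x \<le> r"
      have "(LINT y:ball x r|lebesgue. norm (F y)) \<le> C2 * (D * A) * r powr \<alpha> * vol_ball x r" using r by (intro size) auto
      also have "\<dots> \<le> ?B * r powr \<alpha> * vol_ball x r"
        using AD DA D f(3) C1(1) C2(1) by (intro mult_right_mono le) (auto simp: E_def add_nonneg_nonneg)
      finally show "(LINT y:ball x r|lebesgue. norm (F y)) \<le> ?B * r powr \<alpha> * vol_ball x r" .
    qed
    ultimately show "loc_integrable F \<and> osc_bound \<alpha> F (E / ?\<kappa> * (D + 1) * A) \<and> size_bound \<rho> \<alpha> F (E / ?\<kappa> * (D + 1) * A)"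
      using Fl by blast
  qed
qed

end

section \<open>Test functions\<close>

lemma tent_sum_le:
  fixes b v :: real
  assumes b: "b > 1" and v: "v > 0"
  shows "(\<Sum>j\<le>m. min (b ^ j * v) (1 / (b ^ j * v))) \<le> (b + 1) / (b - 1)"
proof -
  \<comment> \<open>a bounded function whose increments along the geometric sequence dominate the summands\<close>
  define F where "F u = (if u \<le> 1 then u / (b - 1) else (1 + b * (1 - 1 / u)) / (b - 1))" for u :: real
  have step: "min u (1 / u) \<le> F (b * u) - F u" if u: "u > 0" for u
  proof -
    consider "b * u \<le> 1" | "u \<le> 1" "b * u > 1" | "u > 1" by linarith
    thus ?thesis
    proof cases
      case 1
      have "u \<le> 1" using 1 b u by (smt (verit) mult_less_cancel_right2)
      hence "F (b * u) - F u = u" using 1 b by (simp add: F_def diff_divide_distrib[symmetric]) (simp add: field_simps)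
      thus ?thesis by simp
    next
      case 2
      have "(1 - u) * (b * u - 1) \<ge> 0" using 2 by (intro mult_nonneg_nonneg) auto
      hence "1 / u \<le> 1 + b - b * u" using u by (simp add: field_simps power2_eq_square)
      moreover have "b * (1 - 1 / (b * u)) = b - 1 / u" using b u by (simp add: field_simps)
      ultimately have "(b - 1) * u \<le> 1 + b * (1 - 1 / (b * u)) - u" by (simp add: left_diff_distrib)
      hence "u \<le> (1 + b * (1 - 1 / (b * u)) - u) / (b - 1)" using b by (simp add: field_simps)
      also have "\<dots> = F (b * u) - F u" using 2 by (simp add: F_def diff_divide_distrib)
      finally show ?thesis by simp
    next
      case 3
      have "b * u > 1" using b 3 by (smt (verit) mult_less_cancel_right2)
      hence "F (b * u) - F u = 1 / u" using 3 b u by (simp add: F_def diff_divide_distrib[symmetric]) (simp add: field_simps)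
      thus ?thesis by simp
    qed
  qed
  have "(\<Sum>j\<le>m. min (b ^ j * v) (1 / (b ^ j * v))) \<le> (\<Sum>j\<le>m. F (b ^ Suc j * v) - F (b ^ j * v))"
  proof (intro sum_mono)
    fix j
    show "min (b ^ j * v) (1 / (b ^ j * v)) \<le> F (b ^ Suc j * v) - F (b ^ j * v)"
      using step[of "b ^ j * v"] b v by (simp add: mult.assoc)
  qed
  also have "\<dots> = F (b ^ Suc m * v) - F (b ^ 0 * v)" by (induction m) auto
  also have "\<dots> \<le> F (b ^ Suc m * v)" using b v by (auto simp: F_def divide_simps)
  also have "\<dots> \<le> (b + 1) / (b - 1)"
  proof -
    have "b ^ Suc m * v > 0" using b v by simp
    thus ?thesis using b by (auto simp: F_def intro!: divide_right_mono)
  qed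
  finally show ?thesis .
qed

definition bump :: "'a::euclidean_space \<Rightarrow> real \<Rightarrow> 'a \<Rightarrow> real" where
  "bump x0 s y = max 0 (min 1 (2 - dist x0 y / s))"

lemma bump_bounds: "0 \<le> bump x0 s y" "bump x0 s y \<le> 1"
  by (auto simp: bump_def)

lemma bump_eq_1: "s > 0 \<Longrightarrow> dist x0 y \<le> s \<Longrightarrow> bump x0 s y = 1"
  by (simp add: bump_def)

lemma bump_eq_0: "s > 0 \<Longrightarrow> 2 * s \<le> dist x0 y \<Longrightarrow> bump x0 s y = 0"
  by (simp add: bump_def field_simps)

lemma bump_Lipschitz:
  assumes "s > 0" shows "\<bar>bump x0 s y - bump x0 s z\<bar> \<le> dist y z / s"
proof -
  have "\<bar>bump x0 s y - bump x0 s z\<bar> \<le> \<bar>dist x0 y / s - dist x0 z / s\<bar>"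
    by (auto simp: bump_def max_def min_def)
  also have "\<dots> = \<bar>dist x0 y - dist x0 z\<bar> / s" using assms by (simp add: diff_divide_distrib[symmetric])
  also have "\<dots> \<le> dist y z / s"
    using assms abs_dist_diff_le[of y x0 z] by (intro divide_right_mono) (auto simp: dist_commute)
  finally show ?thesis .
qed

lemma continuous_bump: "s > 0 \<Longrightarrow> continuous_on S (bump x0 s)"
  unfolding bump_def[abs_def] by (intro continuous_intros) auto

lemma set_integrable_continuous_ball:
  fixes f :: "'a::euclidean_space \<Rightarrow> 'b::{banach, second_countable_topology}"
  assumes "continuous_on UNIV f" shows "set_integrable lebesgue (ball x r) f"
proof -
  have "set_integrable lborel (cball x r) f"
    unfolding set_integrable_def
    using assms by (intro borel_integrable_compact) (auto intro: continuous_on_subset)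
  hence "set_integrable lebesgue (cball x r) f"
    unfolding set_integrable_def by (subst integrable_completion) auto
  thus ?thesis by (rule set_integrable_subset) auto
qed

lemma bump_deviation:
  fixes x0 z :: "'a::euclidean_space"
  assumes s: "s > 0" and t: "t > 0"
  shows "(LINT y:ball z t|lebesgue. \<bar>bump x0 s y - (if t \<le> s then bump x0 s z else 0)\<bar>)
     \<le> 2 ^ DIM('a) * min (s / t) (1 / (s / t)) * vol_ball z t"
proof (cases "t \<le> s")
  case True
  have i: "set_integrable lebesgue (ball z t) (\<lambda>y. \<bar>bump x0 s y - bump x0 s z\<bar>)"
    using s by (intro set_integrable_continuous_ball continuous_intros continuous_bump)
  have "(LINT y:ball z t|lebesgue. \<bar>bump x0 s y - bump x0 s z\<bar>) \<le> (LINT y:ball z t|lebesgue. t / s)"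
  proof (intro set_integral_mono i set_integrable_const_ball)
    fix y assume "y \<in> ball z t"
    hence "dist y z / s \<le> t / s" using s by (intro divide_right_mono) (auto simp: dist_commute)
    thus "\<bar>bump x0 s y - bump x0 s z\<bar> \<le> t / s" using bump_Lipschitz[OF s, of x0 y z] by simp
  qed
  also have "\<dots> = 1 * (t / s * vol_ball z t)" by (simp add: set_integral_const_ball mult.commute)
  also have "\<dots> \<le> 2 ^ DIM('a) * (t / s * vol_ball z t)" using s t by (intro mult_right_mono) auto
  also have "t / s = min (s / t) (1 / (s / t))"
  proof -
    have "t / s \<le> 1" "1 \<le> s / t" using True s t by auto
    thus ?thesis by simp
  qed
  finally show ?thesis using True by (simp add: mult.assoc)
next
  case False
  have i: "set_integrable lebesgue S (bump x0 s)" if "S = ball z t \<or> S = ball x0 (2 * s)" for S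
    using that s by (auto intro!: set_integrable_continuous_ball continuous_bump)
  have "(LINT y:ball z t|lebesgue. bump x0 s y) \<le> (LINT y|lebesgue. indicat_real (ball x0 (2 * s)) y)"
    unfolding set_lebesgue_integral_def
  proof (rule integral_mono)
    show "integrable lebesgue (\<lambda>y. indicator (ball z t) y *\<^sub>R bump x0 s y)"
      using i[of "ball z t"] by (simp add: set_integrable_def)
    show "integrable lebesgue (\<lambda>y. indicat_real (ball x0 (2 * s)) y)"
      using set_integrable_const_ball[of x0 "2 * s" "1::real"] by (simp add: set_integrable_def)
    show "indicator (ball z t) y *\<^sub>R bump x0 s y \<le> indicat_real (ball x0 (2 * s)) y" for y
      using bump_bounds[of x0 s y] bump_eq_0[OF s, of x0 y] by (auto simp: indicator_def)
  qed
  also have "\<dots> = vol_ball x0 (2 * s)"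
    by (simp add: vol_ball_def)
  also have "\<dots> \<le> (2 * (s / t)) ^ DIM('a) * vol_ball z t" using s t by (intro vol_ball_le_scale) auto
  also have "\<dots> = 2 ^ DIM('a) * (s / t) ^ DIM('a) * vol_ball z t" by (simp add: power_mult_distrib power_divide)
  also have "\<dots> \<le> 2 ^ DIM('a) * (s / t) * vol_ball z t"
  proof (intro mult_right_mono mult_left_mono)
    have "(s / t) ^ DIM('a) \<le> (s / t) ^ 1"
      using s t False by (intro power_decreasing) (auto simp: Suc_leI)
    thus "(s / t) ^ DIM('a) \<le> s / t" by simp
  qed auto
  also have "s / t = min (s / t) (1 / (s / t))"
  proof -
    have "s / t \<le> 1" "1 \<le> t / s" using False s t by auto
    thus ?thesis by simp
  qed
  finally show ?thesis using False bump_bounds[of x0 s] by simp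
qed

text \<open>
  A dyadic version of the usual test functions, the truncations of \<open>log (R / |y - x0|)\<close> for \<open>\<alpha> = 0\<close> and of
  \<open>R powr \<alpha> - |y - x0| powr \<alpha>\<close> for \<open>\<alpha> > 0\<close>, with \<open>R = 2 ^ m * s\<close>.  In this form both are treated at once, and
  the oscillation of each summand is elementary.
\<close>

definition bump_sum :: "real \<Rightarrow> nat \<Rightarrow> 'a::euclidean_space \<Rightarrow> real \<Rightarrow> 'a \<Rightarrow> complex" where
  "bump_sum \<alpha> m x0 s y = (\<Sum>j\<le>m. of_real ((2 ^ j * s) powr \<alpha> * bump x0 (2 ^ j * s) y))"

lemma continuous_bump_sum: "s > 0 \<Longrightarrow> continuous_on S (bump_sum \<alpha> m x0 s)"
  unfolding bump_sum_def[abs_def] by (intro continuous_intros continuous_bump) auto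

lemma bump_sum_inner:
  assumes s: "s > 0" and y: "dist x0 y \<le> s"
  shows "bump_sum \<alpha> m x0 s y = of_real (s powr \<alpha> * dyadic_sum \<alpha> m)"
proof -
  have "bump x0 (2 ^ j * s) y = 1" for j
  proof (rule bump_eq_1)
    have "1 * s \<le> 2 ^ j * s" using s by (intro mult_right_mono) auto
    thus "dist x0 y \<le> 2 ^ j * s" using y by simp
  qed (use s in simp)
  hence "bump_sum \<alpha> m x0 s y = (\<Sum>j\<le>m. of_real ((2 ^ j * s) powr \<alpha>))" by (simp add: bump_sum_def)
  also have "\<dots> = of_real (\<Sum>j\<le>m. (2 powr \<alpha>) ^ j * s powr \<alpha>)" by (simp only: two_powr_pow of_real_sum)
  finally show ?thesis by (simp add: dyadic_sum_def sum_distrib_left mult.commute)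
qed

text \<open>
  A bump of scale \<open>s\<close> deviates little on balls of radius \<open>t \<le> s\<close> because it is Lipschitz, and on
  larger balls because its support is small; both bounds decay geometrically in the ratio of the scales.
\<close>

lemma bump_sum_oscillation:
  fixes x0 z :: "'a::euclidean_space"
  assumes al: "0 \<le> \<alpha>" "\<alpha> < 1" and s: "s > 0" and t: "t > 0"
  shows "(LINT y:ball z t|lebesgue. norm (bump_sum \<alpha> m x0 s y - avg (bump_sum \<alpha> m x0 s) z t))
     \<le> 2 * 2 ^ DIM('a) * ((2 powr (1 - \<alpha>) + 1) / (2 powr (1 - \<alpha>) - 1)) * t powr \<alpha> * vol_ball z t"
proof -
  let ?G = "bump_sum \<alpha> m x0 s" and ?s = "\<lambda>j. 2 ^ j * s"
  let ?\<beta> = "1 - \<alpha>"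
  have sj: "?s j > 0" for j :: nat using s by simp
  define k where "k j = (if t \<le> ?s j then bump x0 (?s j) z else 0)" for j
  define c :: complex where "c = (\<Sum>j\<le>m. of_real (?s j powr \<alpha> * k j))"
  have Gi: "set_integrable lebesgue (ball z t) ?G"
    using s by (intro set_integrable_continuous_ball continuous_bump_sum)
  have bi: "set_integrable lebesgue (ball z t) (\<lambda>y. \<bar>bump x0 (?s j) y - k j\<bar>)" for j
    by (intro set_integrable_continuous_ball continuous_intros continuous_bump sj)
  have bi': "set_integrable lebesgue (ball z t) (\<lambda>y. ?s j powr \<alpha> * \<bar>bump x0 (?s j) y - k j\<bar>)" for j
    using bi by (rule set_integrable_mult_right)
  have "(LINT y:ball z t|lebesgue. norm (?G y - avg ?G z t)) \<le> 2 * (LINT y:ball z t|lebesgue. norm (?G y - c))"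
    by (rule osc_le_twice[OF Gi t])
  also have "(LINT y:ball z t|lebesgue. norm (?G y - c)) \<le> (LINT y:ball z t|lebesgue. (\<Sum>j\<le>m. ?s j powr \<alpha> * \<bar>bump x0 (?s j) y - k j\<bar>))"
  proof (rule set_integral_mono)
    show "set_integrable lebesgue (ball z t) (\<lambda>y. norm (?G y - c))"
      using Gi by (intro set_integrable_norm set_integral_diff) auto
    show "set_integrable lebesgue (ball z t) (\<lambda>y. \<Sum>j\<le>m. ?s j powr \<alpha> * \<bar>bump x0 (?s j) y - k j\<bar>)"
      using sj by (intro set_integrable_continuous_ball continuous_intros continuous_bump) 
    fix y
    have "?G y - c = (\<Sum>j\<le>m. of_real (?s j powr \<alpha> * (bump x0 (?s j) y - k j)))"
      by (simp add: bump_sum_def c_def sum_subtractf right_diff_distrib)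
    also have "norm \<dots> \<le> (\<Sum>j\<le>m. ?s j powr \<alpha> * \<bar>bump x0 (?s j) y - k j\<bar>)"
      by (rule sum_norm_le) (simp only: norm_of_real abs_mult, simp)
    finally show "norm (?G y - c) \<le> (\<Sum>j\<le>m. ?s j powr \<alpha> * \<bar>bump x0 (?s j) y - k j\<bar>)" .
  qed
  also have "\<dots> = (\<Sum>j\<le>m. LINT y:ball z t|lebesgue. ?s j powr \<alpha> * \<bar>bump x0 (?s j) y - k j\<bar>)"
    unfolding set_lebesgue_integral_def scaleR_sum_right
    using bi'[unfolded set_integrable_def] by (rule Bochner_Integration.integral_sum)
  also have "\<dots> = (\<Sum>j\<le>m. ?s j powr \<alpha> * (LINT y:ball z t|lebesgue. \<bar>bump x0 (?s j) y - k j\<bar>))"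
    by (simp only: set_integral_mult_right)
  also have "\<dots> \<le> (\<Sum>j\<le>m. 2 ^ DIM('a) * t powr \<alpha> * vol_ball z t * min ((2 powr ?\<beta>) ^ j * (s / t) powr ?\<beta>) (1 / ((2 powr ?\<beta>) ^ j * (s / t) powr ?\<beta>)))"
  proof (intro sum_mono)
    fix j
    define u where "u = ?s j / t"
    have u: "u > 0" using s t by (simp add: u_def)
    have ub: "(2 powr ?\<beta>) ^ j * (s / t) powr ?\<beta> = u powr ?\<beta>"
      unfolding two_powr_pow u_def by simp
    have um: "u powr \<alpha> * min u (1 / u) \<le> min (u powr ?\<beta>) (1 / u powr ?\<beta>)"
    proof (cases "u \<le> 1")
      case True
      have "u powr \<alpha> \<le> 1" using True u al by (simp add: powr_le1)
      hence "u powr \<alpha> * u \<le> 1 * u" using u by (intro mult_right_mono) auto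
      also have "1 * u = u powr 1" using u by simp
      also have "\<dots> \<le> u powr ?\<beta>" using True u al by (intro powr_mono') auto
      finally have "u powr \<alpha> * u \<le> u powr ?\<beta>" .
      moreover have "u powr ?\<beta> \<le> 1" using True u al by (simp add: powr_le1)
      moreover from this have "u powr ?\<beta> \<le> 1 / u powr ?\<beta>" using u by (simp add: field_simps mult_le_one)
      moreover have "min u (1 / u) = u" using True u by (simp add: field_simps min_def mult_le_one)
      ultimately show ?thesis by simp
    next
      case False
      have "u powr \<alpha> * (1 / u) = u powr (\<alpha> - 1)" using u by (simp add: powr_diff)
      also have "\<dots> = 1 / u powr ?\<beta>" using powr_minus_divide[of u ?\<beta>] by simp
      finally have 1: "u powr \<alpha> * (1 / u) = 1 / u powr ?\<beta>" .
      have "1 \<le> u powr ?\<beta>" using False al by (intro ge_one_powr_ge_zero) auto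
      moreover from this have "1 / u powr ?\<beta> \<le> 1" using u by simp
      ultimately have "1 / u powr ?\<beta> \<le> u powr ?\<beta>" by linarith
      moreover have "min u (1 / u) = 1 / u"
      proof -
        have "1 / u \<le> 1" using False by simp
        hence "1 / u \<le> u" using False by linarith
        thus ?thesis by (rule min_absorb2)
      qed
      ultimately show ?thesis using 1 by simp
    qed
    have "?s j powr \<alpha> = t powr \<alpha> * u powr \<alpha>" using t s by (simp add: u_def powr_mult[symmetric])
    moreover have "(LINT y:ball z t|lebesgue. \<bar>bump x0 (?s j) y - k j\<bar>) \<le> 2 ^ DIM('a) * min u (1 / u) * vol_ball z t"
      unfolding k_def u_def by (rule bump_deviation[OF sj t])
    ultimately have "?s j powr \<alpha> * (LINT y:ball z t|lebesgue. \<bar>bump x0 (?s j) y - k j\<bar>)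
        \<le> (t powr \<alpha> * u powr \<alpha>) * (2 ^ DIM('a) * min u (1 / u) * vol_ball z t)"
      by (auto intro: mult_left_mono)
    also have "\<dots> = 2 ^ DIM('a) * t powr \<alpha> * vol_ball z t * (u powr \<alpha> * min u (1 / u))" by (simp add: mult_ac)
    also have "\<dots> \<le> 2 ^ DIM('a) * t powr \<alpha> * vol_ball z t * min (u powr ?\<beta>) (1 / u powr ?\<beta>)"
      by (intro mult_left_mono um) auto
    finally show "?s j powr \<alpha> * (LINT y:ball z t|lebesgue. \<bar>bump x0 (?s j) y - k j\<bar>)
       \<le> 2 ^ DIM('a) * t powr \<alpha> * vol_ball z t * min ((2 powr ?\<beta>) ^ j * (s / t) powr ?\<beta>) (1 / ((2 powr ?\<beta>) ^ j * (s / t) powr ?\<beta>))"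
      unfolding ub .
  qed
  also have "\<dots> = 2 ^ DIM('a) * t powr \<alpha> * vol_ball z t * (\<Sum>j\<le>m. min ((2 powr ?\<beta>) ^ j * (s / t) powr ?\<beta>) (1 / ((2 powr ?\<beta>) ^ j * (s / t) powr ?\<beta>)))"
    by (rule sum_distrib_left[symmetric])
  also have "\<dots> \<le> 2 ^ DIM('a) * t powr \<alpha> * vol_ball z t * ((2 powr ?\<beta> + 1) / (2 powr ?\<beta> - 1))"
    using al s t by (intro mult_left_mono tent_sum_le) auto
  finally show ?thesis by (simp add: mult_ac)
qed

text \<open>The summands have integrals that grow geometrically with the scale, so the largest one dominates.\<close>

lemma bump_sum_integral:
  fixes x0 :: "'a::euclidean_space"
  assumes al: "0 \<le> \<alpha>" and s: "s > 0"
  shows "(LINT y:ball z t|lebesgue. norm (bump_sum \<alpha> m x0 s y)) \<le> 2 * 2 ^ DIM('a) * (2 ^ m * s) powr \<alpha> * vol_ball x0 (2 ^ m * s)"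
proof -
  let ?s = "\<lambda>j. 2 ^ j * s"
  have sj: "?s j > 0" for j :: nat using s by simp
  have sm: "?s j \<le> ?s m" if "j \<le> m" for j using that s by (intro mult_right_mono power_increasing) auto
  have ii: "integrable lebesgue (\<lambda>y. indicat_real (ball x0 (2 * ?s j)) y)" for j
    using set_integrable_const_ball[of x0 "2 * ?s j" "1::real"] by (simp add: set_integrable_def)
  have "(LINT y:ball z t|lebesgue. norm (bump_sum \<alpha> m x0 s y))
      \<le> (LINT y|lebesgue. (\<Sum>j\<le>m. ?s m powr \<alpha> * indicat_real (ball x0 (2 * ?s j)) y))"
    unfolding set_lebesgue_integral_def
  proof (rule integral_mono)
    have "set_integrable lebesgue (ball z t) (\<lambda>y. norm (bump_sum \<alpha> m x0 s y))"
      using s by (intro set_integrable_norm set_integrable_continuous_ball continuous_bump_sum)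
    thus "integrable lebesgue (\<lambda>y. indicator (ball z t) y *\<^sub>R norm (bump_sum \<alpha> m x0 s y))"
      by (simp add: set_integrable_def)
    show "integrable lebesgue (\<lambda>y. \<Sum>j\<le>m. ?s m powr \<alpha> * indicat_real (ball x0 (2 * ?s j)) y)"
      using ii by (intro Bochner_Integration.integrable_sum integrable_mult_right) 
    fix y
    have "norm (bump_sum \<alpha> m x0 s y) \<le> (\<Sum>j\<le>m. ?s m powr \<alpha> * indicat_real (ball x0 (2 * ?s j)) y)"
      unfolding bump_sum_def
    proof (rule sum_norm_le)
      fix j assume j: "j \<in> {..m}"
      have "bump x0 (?s j) y \<le> indicat_real (ball x0 (2 * ?s j)) y"
        using bump_bounds[of x0 "?s j" y] bump_eq_0[OF sj, of j x0 y] by (auto simp: indicator_def)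
      hence "?s j powr \<alpha> * bump x0 (?s j) y \<le> ?s m powr \<alpha> * indicat_real (ball x0 (2 * ?s j)) y"
        using sm[of j] j al s bump_bounds[of x0 "?s j" y] by (intro mult_mono powr_mono2) auto
      thus "norm (of_real (?s j powr \<alpha> * bump x0 (?s j) y) :: complex) \<le> ?s m powr \<alpha> * indicat_real (ball x0 (2 * ?s j)) y"
        using bump_bounds(1)[of x0 "?s j" y] by (simp only: norm_of_real) simp
    qed
    moreover have "0 \<le> (\<Sum>j\<le>m. ?s m powr \<alpha> * indicat_real (ball x0 (2 * ?s j)) y)"
      by (intro sum_nonneg) auto
    ultimately show "indicator (ball z t) y *\<^sub>R norm (bump_sum \<alpha> m x0 s y) \<le> (\<Sum>j\<le>m. ?s m powr \<alpha> * indicat_real (ball x0 (2 * ?s j)) y)"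
      by (auto simp: indicator_def[of "ball z t"])
  qed
  also have "\<dots> = (\<Sum>j\<le>m. ?s m powr \<alpha> * vol_ball x0 (2 * ?s j))"
    using ii by (subst Bochner_Integration.integral_sum) (auto simp: vol_ball_def)
  also have "\<dots> \<le> (\<Sum>j\<le>m. ?s m powr \<alpha> * (2 ^ DIM('a) * vol_ball x0 (?s m)) * (1/2) ^ (m - j))"
  proof (intro sum_mono)
    fix j assume j: "j \<in> {..m}"
    have "?s j = (1/2) ^ (m - j) * ?s m" using j by (simp add: power_diff power_divide field_simps)
    hence "vol_ball x0 (2 * ?s j) \<le> (2 * (1/2) ^ (m - j)) ^ DIM('a) * vol_ball x0 (?s m)"
      using sj by (intro vol_ball_le_scale) (auto simp: less_imp_le)
    also have "\<dots> = 2 ^ DIM('a) * vol_ball x0 (?s m) * ((1/2) ^ (m - j)) ^ DIM('a)" by (simp add: power_mult_distrib)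
    also have "\<dots> \<le> 2 ^ DIM('a) * vol_ball x0 (?s m) * ((1/2) ^ (m - j)) ^ 1"
      by (intro mult_left_mono power_decreasing) (auto simp: Suc_leI power_le_one)
    finally have "vol_ball x0 (2 * ?s j) \<le> 2 ^ DIM('a) * vol_ball x0 (?s m) * (1/2) ^ (m - j)" by simp
    hence "?s m powr \<alpha> * vol_ball x0 (2 * ?s j) \<le> ?s m powr \<alpha> * (2 ^ DIM('a) * vol_ball x0 (?s m) * (1/2) ^ (m - j))"
      by (intro mult_left_mono) auto
    thus "?s m powr \<alpha> * vol_ball x0 (2 * ?s j) \<le> ?s m powr \<alpha> * (2 ^ DIM('a) * vol_ball x0 (?s m)) * (1/2) ^ (m - j)"
      by (simp add: mult.assoc)
  qed
  also have "\<dots> = ?s m powr \<alpha> * (2 ^ DIM('a) * vol_ball x0 (?s m)) * (\<Sum>j\<le>m. (1/2) ^ (m - j))"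
    by (rule sum_distrib_left[symmetric])
  also have "(\<Sum>j\<le>m. (1/2) ^ (m - j)) = (\<Sum>j\<le>m. (1/2::real) ^ j)"
    by (rule sum.reindex_bij_witness[where i="\<lambda>j. m - j" and j="\<lambda>j. m - j"]) auto
  also have "?s m powr \<alpha> * (2 ^ DIM('a) * vol_ball x0 (?s m)) * (\<Sum>j\<le>m. (1/2::real) ^ j) \<le> ?s m powr \<alpha> * (2 ^ DIM('a) * vol_ball x0 (?s m)) * 2"
  proof (intro mult_left_mono)
    have "(\<Sum>j\<le>m. (1/2::real) ^ j) \<le> (\<Sum>j. (1/2::real) ^ j)" by (intro sum_le_suminf summable_geometric) auto
    thus "(\<Sum>j\<le>m. (1/2::real) ^ j) \<le> 2" using suminf_geometric[of "1/2::real"] by simp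
  qed auto
  finally show ?thesis by (simp add: mult_ac)
qed

context critical_operator begin

text \<open>
  For the size condition: by slow variation of \<open>\<rho>\<close>, a ball of at least critical radius that meets the support,
  which lies in \<open>ball x0 (4 * \<rho> x0)\<close>, has radius at least a constant times \<open>\<rho> x0\<close>.
\<close>

lemma bump_sum_bounds:
  assumes al: "0 \<le> \<alpha>" "\<alpha> < 1"
  obtains A where "A > 0" "\<And>x0 s m. s > 0 \<Longrightarrow> 2 ^ m * s \<le> 2 * \<rho> x0 \<Longrightarrow>
     loc_integrable (bump_sum \<alpha> m x0 s :: 'a \<Rightarrow> complex) \<and> osc_bound \<alpha> (bump_sum \<alpha> m x0 s) A \<and> size_bound \<rho> \<alpha> (bump_sum \<alpha> m x0 s) A"
proof -
  let ?d = "DIM('a)"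
  let ?\<kappa> = "scale_const ?d \<alpha>"
  have \<kappa>: "?\<kappa> > 0" by (rule scale_const_pos)
  obtain c0 where c0: "c0 > 0" "\<And>x y. dist x y \<le> 5 * \<rho> x \<Longrightarrow> c0 * \<rho> x \<le> \<rho> y"
    using rho_slow[of 5] by auto
  define c where "c = min c0 1"
  have c: "c > 0" "c \<le> 1" "c \<le> c0" using c0 by (auto simp: c_def)
  define A1 where "A1 = 2 * 2 ^ ?d * ((2 powr (1 - \<alpha>) + 1) / (2 powr (1 - \<alpha>) - 1))"
  have "2 powr (1 - \<alpha>) > 1" using al by simp
  hence A1: "A1 > 0" by (simp add: A1_def)
  define A2 where "A2 = 2 * 2 ^ ?d * (2 / c) powr \<alpha> * (2 / c) ^ ?d"
  have A2: "A2 > 0" using c by (simp add: A2_def)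
  show ?thesis
  proof (rule that[of "(A1 + A2) / ?\<kappa>"])
    show "(A1 + A2) / ?\<kappa> > 0" using A1 A2 \<kappa> by simp
    fix x0 s m assume s: "s > 0" and m: "2 ^ m * s \<le> 2 * \<rho> x0"
    let ?G = "bump_sum \<alpha> m x0 s :: 'a \<Rightarrow> complex"
    have Gl: "loc_integrable ?G"
      unfolding loc_integrable_def using s by (intro allI set_integrable_continuous_ball continuous_bump_sum)
    have e: "(A1 + A2) / ?\<kappa> * (?\<kappa> * r powr \<alpha>) * vol_ball x r = (A1 + A2) * r powr \<alpha> * vol_ball x r" for x r
      using \<kappa> by simp
    have "osc_bound \<alpha> ?G ((A1 + A2) / ?\<kappa>)"
      unfolding osc_bound_iff e
    proof (intro allI impI)
      fix x r assume r: "(0::real) < r"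
      have "(LINT y:ball x r|lebesgue. norm (?G y - avg ?G x r)) \<le> A1 * r powr \<alpha> * vol_ball x r"
        unfolding A1_def by (rule bump_sum_oscillation[OF al s r])
      also have "\<dots> \<le> (A1 + A2) * r powr \<alpha> * vol_ball x r" using A2 by (intro mult_right_mono) auto
      finally show "(LINT y:ball x r|lebesgue. norm (?G y - avg ?G x r)) \<le> (A1 + A2) * r powr \<alpha> * vol_ball x r" .
    qed
    moreover have "size_bound \<rho> \<alpha> ?G ((A1 + A2) / ?\<kappa>)"
      unfolding size_bound_iff e
    proof (intro allI impI)
      fix z t assume t: "0 < t \<and> \<rho> z \<le> t"
      have "(LINT y:ball z t|lebesgue. norm (?G y)) \<le> A2 * t powr \<alpha> * vol_ball z t"
      proof (cases "c * \<rho> x0 \<le> t")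
        case True
        have le: "2 ^ m * s \<le> 2 / c * t"
        proof -
          have "\<rho> x0 \<le> t / c" using True c by (simp add: field_simps)
          thus ?thesis using m by simp
        qed
        have "(LINT y:ball z t|lebesgue. norm (?G y)) \<le> 2 * 2 ^ ?d * (2 ^ m * s) powr \<alpha> * vol_ball x0 (2 ^ m * s)"
          by (rule bump_sum_integral[OF al(1) s])
        also have "\<dots> \<le> 2 * 2 ^ ?d * (2 / c * t) powr \<alpha> * ((2 / c) ^ ?d * vol_ball z t)"
        proof (rule mult_mono[OF mult_left_mono])
          show "(2 ^ m * s) powr \<alpha> \<le> (2 / c * t) powr \<alpha>" using le s al by (intro powr_mono2) auto
          show "vol_ball x0 (2 ^ m * s) \<le> (2 / c) ^ ?d * vol_ball z t"
            using le s t by (intro vol_ball_le_scale) auto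
        qed auto
        also have "\<dots> = A2 * t powr \<alpha> * vol_ball z t" unfolding powr_mult[of "2 / c" t] A2_def by (simp add: mult_ac)
        finally show ?thesis .
      next
        case False
        have far: "dist x0 z > 5 * \<rho> x0"
        proof (rule ccontr)
          assume "\<not> dist x0 z > 5 * \<rho> x0"
          hence "c0 * \<rho> x0 \<le> \<rho> z" using c0(2)[of x0 z] by simp
          moreover have "c * \<rho> x0 \<le> c0 * \<rho> x0" using c rho_pos[of x0] by (intro mult_right_mono) auto
          ultimately show False using False t by simp
        qed
        have "?G y = 0" if y: "y \<in> ball z t" for y
        proof -
          have "c * \<rho> x0 \<le> 1 * \<rho> x0" using c rho_pos[of x0] by (intro mult_right_mono) auto
          hence "t < \<rho> x0" using False by linarith
          hence dy: "dist x0 y \<ge> 4 * \<rho> x0" using far y dist_triangle[of x0 z y] by (simp add: dist_commute)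
          have "bump x0 (2 ^ j * s) y = 0" if "j \<le> m" for j
          proof (rule bump_eq_0)
            have "2 ^ j * s \<le> 2 ^ m * s" using that s by (intro mult_right_mono power_increasing) auto
            thus "2 * (2 ^ j * s) \<le> dist x0 y" using m dy by linarith
          qed (use s in simp)
          thus ?thesis by (simp add: bump_sum_def)
        qed
        hence "(LINT y:ball z t|lebesgue. norm (?G y)) = (LINT y:ball z t|lebesgue. 0)"
          by (intro set_lebesgue_integral_cong) auto
        thus ?thesis using A2 by simp
      qed
      also have "\<dots> \<le> (A1 + A2) * t powr \<alpha> * vol_ball z t" using A1 by (intro mult_right_mono) auto
      finally show "(LINT y:ball z t|lebesgue. norm (?G y)) \<le> (A1 + A2) * t powr \<alpha> * vol_ball z t" .
    qed
    ultimately show "loc_integrable ?G \<and> osc_bound \<alpha> ?G ((A1 + A2) / ?\<kappa>) \<and> size_bound \<rho> \<alpha> ?G ((A1 + A2) / ?\<kappa>)"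
      using Gl by blast
  qed
qed

end

section \<open>The equivalences\<close>

lemma Lq_mean_le_bound:
  assumes f: "Lq_mean_le q f x r M" and h: "h \<in> borel_measurable lebesgue" and q: "q > 0"
    and ae: "AE y in lebesgue. y \<in> ball x r \<longrightarrow> norm (h y) \<le> norm (f y)"
  shows "Lq_mean_le q h x r M"
proof -
  have "set_borel_measurable lebesgue (ball x r) h"
    unfolding set_borel_measurable_def using h by (intro borel_measurable_scaleR borel_measurable_indicator) auto
  hence hL: "in_Lp q (ball x r) h"
    by (rule in_Lp_bound[where f=f]) (use f ae q in \<open>auto simp: Lq_mean_le_def\<close>)
  have "(LINT y:ball x r|lebesgue. norm (h y) powr q) \<le> (LINT y:ball x r|lebesgue. norm (f y) powr q)"
  proof (rule set_integral_mono_AE)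
    show "AE y\<in>ball x r in lebesgue. norm (h y) powr q \<le> norm (f y) powr q"
      using ae by eventually_elim (use q in \<open>auto intro: powr_mono2\<close>)
  qed (use hL f in \<open>auto simp: in_Lp_def Lq_mean_le_def\<close>)
  thus ?thesis using hL f by (auto simp: Lq_mean_le_def)
qed

lemma Lq_mean_le_cmult:
  assumes "Lq_mean_le q f x r M" shows "Lq_mean_le q (\<lambda>y. c * f y) x r (norm c * M)"
proof -
  have "(LINT y:ball x r|lebesgue. norm (c * f y) powr q) = norm c powr q * (LINT y:ball x r|lebesgue. norm (f y) powr q)"
    by (simp add: norm_mult powr_mult)
  also have "\<dots> \<le> norm c powr q * (M powr q * vol_ball x r)"
    using assms by (intro mult_left_mono) (auto simp: Lq_mean_le_def)
  finally show ?thesis using assms in_Lp_cmult[of q "ball x r" f c] by (simp add: Lq_mean_le_def powr_mult mult.assoc)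
qed

lemma Lq_mean_le_center:
  assumes f: "Lq_mean_le q (\<lambda>y. f y - c) x r M" and q: "q > 1" and r: "r > 0"
  shows "Lq_mean_le q (\<lambda>y. f y - avg f x r) x r (8 * M)"
proof -
  have M: "M \<ge> 0" using f by (simp add: Lq_mean_le_def)
  note L = Lq_mean_le_L1[OF f q]
  have "set_integrable lebesgue (ball x r) (\<lambda>y. (f y - c) + c)" using L(1) by (intro set_integral_add) auto
  hence "set_integrable lebesgue (ball x r) f" by simp
  from avg_dist_le[OF this r, of c] L(2)
  have "norm (avg f x r - c) * vol_ball x r \<le> M * vol_ball x r" by linarith
  hence "norm (c - avg f x r) \<le> M" using vol_ball_pos[OF r, of x] by (simp add: norm_minus_commute)
  hence "Lq_mean_le q (\<lambda>y. c - avg f x r) x r M"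
    using q by (intro Lq_mean_le_mono[OF Lq_mean_le_const]) auto
  from Lq_mean_le_add[OF f this] show ?thesis using q by simp
qed

lemma dyadic_index:
  fixes t :: real assumes "t \<ge> 2"
  obtains m :: nat where "m \<ge> 1" "2 ^ m \<le> t" "t < 2 ^ (m + 1)"
proof -
  have ex: "\<exists>n. t < 2 ^ n" using real_arch_pow[of 2 t] by simp
  define k where "k = (LEAST n. t < 2 ^ n)"
  have k: "t < 2 ^ k" unfolding k_def using ex by (rule LeastI_ex)
  have "k \<noteq> 0" using k assms by (intro notI) simp
  moreover have "k \<noteq> 1" using k assms by (intro notI) simp
  ultimately obtain m where m: "k = Suc m" "m \<ge> 1" by (cases k) auto
  have "\<not> t < 2 ^ m" using not_less_Least[of m "\<lambda>n. t < 2 ^ n"] m by (simp add: k_def)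
  thus ?thesis using that[of m] m k by simp
qed

lemma BMO_L_norm_Inf: "BMO_L_norm \<rho> \<alpha> = (\<lambda>f :: 'a::euclidean_space \<Rightarrow> complex. Inf {A. A > 0 \<and> (osc_bound \<alpha> f A \<and> size_bound \<rho> \<alpha> f A)})"
  by (simp add: BMO_L_norm_def[abs_def])

lemma BMO_norm_Inf: "BMO_norm \<alpha> = (\<lambda>f :: 'a::euclidean_space \<Rightarrow> complex. Inf {A. A > 0 \<and> osc_bound \<alpha> f A})"
  by (simp add: BMO_norm_def[abs_def])

context critical_operator begin

abbreviation "T_ext \<equiv> ext_op \<rho> T K"

lemma T1_extension: "is_extension \<rho> T K (\<lambda>_. 1) (T_ext (\<lambda>_. 1))"
  by (rule ext_op_extension[OF const_admissible])

text \<open>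
  Necessity.  For a ball of radius \<open>r\<close> the operator is tested on a function \<open>G\<close> that is constantly
  \<open>l\<close> on the doubled ball, where \<open>l\<close> is comparable to the largest value that such a function of norm one
  can take.  The local part of \<open>G - l\<close>, which the boundedness of \<open>T\<close> on \<open>L\<^sup>p\<close> could not control in
  \<open>L\<^sup>\<theta>\<close>, vanishes, and on the ball \<open>l T1\<close> differs from \<open>T G\<close> by a constant and an error of order \<open>r\<^sup>\<alpha>\<close>.
\<close>

lemma weighted_cond_of_bounded:
  assumes al: "\<alpha> \<ge> 0" "\<alpha> < \<gamma>" and w: "dyadic_weight \<alpha> w" and C0: "C0 \<ge> 0"
    and bd: "\<And>f A B. f \<in> BMO_L \<rho> \<alpha> \<Longrightarrow> A > 0 \<Longrightarrow> osc_bound \<alpha> f A \<and> size_bound \<rho> \<alpha> f A \<Longrightarrow> B > C0 * A \<Longrightarrow>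
      T_ext f \<in> BMO_L \<rho> \<alpha> \<and> (osc_bound \<alpha> (T_ext f) B \<and> size_bound \<rho> \<alpha> (T_ext f) B)"
  shows "weighted_osc_cond \<rho> w \<theta> (T_ext (\<lambda>_. 1))"
proof -
  have al1: "\<alpha> < 1" using al gamma_le_1 by simp
  have th: "\<theta> > 1" "\<theta> \<ge> 1" "\<theta> > 0" using theta by auto
  let ?T1 = "T_ext (\<lambda>_. 1)"
  have root: "(t powr \<theta>) powr (1 / \<theta>) = t" if "t \<ge> 0" for t :: real
    using that th by (simp add: powr_powr)
  obtain A0 where A0: "A0 > 0" "\<And>x0 s m. s > 0 \<Longrightarrow> 2 ^ m * s \<le> 2 * \<rho> x0 \<Longrightarrow>
     loc_integrable (bump_sum \<alpha> m x0 s :: 'a \<Rightarrow> complex) \<and> osc_bound \<alpha> (bump_sum \<alpha> m x0 s) A0 \<and> size_bound \<rho> \<alpha> (bump_sum \<alpha> m x0 s) A0"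
    by (rule bump_sum_bounds[OF al(1) al1], rule that)
  obtain C1 where C1: "C1 > 0" "\<And>(f :: 'a \<Rightarrow> complex) A x r. loc_integrable f \<Longrightarrow> osc_bound \<alpha> f A \<Longrightarrow> A > 0 \<Longrightarrow> r > 0 \<Longrightarrow>
      Lq_mean_le \<theta> (\<lambda>y. f y - avg f x r) x r (C1 * A * r powr \<alpha>)"
    using Campanato_power_mean[OF al(1) th(3), where 'a='a] by auto
  obtain C2 where C2: "C2 > 0" "\<And>(f :: 'a \<Rightarrow> complex) A x r k. loc_integrable f \<Longrightarrow> osc_bound \<alpha> f A \<Longrightarrow> A > 0 \<Longrightarrow> r > 0 \<Longrightarrow>
      Lq_mean_le \<theta> (\<lambda>y. f y - avg f x r) x (2 ^ k * r) (C2 * A * r powr \<alpha> * (real k + 1) * (2 powr \<alpha>) ^ k)"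
    using Campanato_growth[OF al(1) th(2), where 'a='a] by auto
  obtain C3 where C3: "C3 > 0" "\<And>x0 r h g M. 0 < r \<Longrightarrow> r \<le> \<rho> x0 \<Longrightarrow> loc_Lp h \<Longrightarrow> is_extension \<rho> T K h g \<Longrightarrow>
      M \<ge> 0 \<Longrightarrow> dyadic_growth \<theta> \<alpha> h x0 r M \<Longrightarrow>
     \<exists>c. AE x in lebesgue. x \<in> ball x0 r \<longrightarrow> norm (g x - T (restr (ball x0 (2 * r)) h) x - c) \<le> C3 * M"
    by (rule local_oscillation[OF al], rule that)
  obtain cw where cw: "cw > 0" "\<And>m t. m \<ge> 1 \<and> 2 ^ m \<le> t \<and> t < 2 ^ (m + 1) \<Longrightarrow>
      w t \<ge> 0 \<and> dyadic_sum \<alpha> m \<le> cw * w t \<and> w t \<le> cw * dyadic_sum \<alpha> m"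
    using w unfolding dyadic_weight_def by blast
  define A1 where "A1 = C0 * A0 + 1"
  have A1: "A1 > 0" "A1 > C0 * A0" using C0 A0 by (auto simp: A1_def add_nonneg_pos)
  define E where "E = C3 * (C2 * A0)"
  have E: "E > 0" using C2 C3 A0 by (simp add: E_def)
  define Q where "Q = 4 * (C1 * A1 + E)"
  have Q: "Q > 0" using C1 A1 E by (simp add: Q_def add_pos_pos)
  have T1m: "?T1 \<in> borel_measurable lebesgue"
    using is_extension_measurable[OF _ T1_extension] const_admissible[of 1] by (simp add: admissible_def)
  show ?thesis unfolding weighted_osc_cond_def
  proof (intro exI[of _ "cw * (8 * Q)"] allI impI)
    fix x0 r assume "0 < r \<and> r \<le> \<rho> x0 / 2"
    hence r: "r > 0" "r \<le> \<rho> x0" "\<rho> x0 / r \<ge> 2" using rho_pos[of x0] by (auto simp: field_simps)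
    obtain m where m: "m \<ge> 1" "2 ^ m \<le> \<rho> x0 / r" "\<rho> x0 / r < 2 ^ (m + 1)" using dyadic_index[OF r(3)] by blast
    let ?ds = "dyadic_sum \<alpha> m"
    have ds: "?ds > 0" by (rule dyadic_sum_pos)
    \<comment> \<open>the scales of the bumps range from \<open>2 * r\<close> to at most \<open>2 * \<rho> x0\<close>\<close>
    define G where "G = (bump_sum \<alpha> m x0 (2 * r) :: 'a \<Rightarrow> complex)"
    define l where "l = (2 * r) powr \<alpha> * ?ds"
    have l: "l > 0" "l \<ge> r powr \<alpha> * ?ds"
      using r ds al unfolding l_def by (auto intro!: mult_right_mono powr_mono2)
    have "2 ^ m * (2 * r) \<le> 2 * \<rho> x0" using m(2) r by (simp add: field_simps)
    hence G: "loc_integrable G" "osc_bound \<alpha> G A0" "size_bound \<rho> \<alpha> G A0"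
      unfolding G_def using A0(2)[of "2 * r" m x0] r by auto
    have Gl: "G y = of_real l" if "y \<in> ball x0 (2 * r)" for y
      unfolding G_def l_def using that r by (intro bump_sum_inner) auto
    have avgG: "avg G x0 r = of_real l"
    proof -
      have "(LINT y:ball x0 r|lebesgue. G y) = (LINT y:ball x0 r|lebesgue. of_real l)"
        using Gl r by (intro set_lebesgue_integral_cong) auto
      thus ?thesis using vol_ball_pos[OF r(1), of x0] by (simp add: avg_def set_integral_const_ball)
    qed
    define F where "F = T_ext G"
    have GB: "G \<in> BMO_L \<rho> \<alpha>" using G A0(1) by (auto simp: BMO_L_def)
    have F: "loc_integrable F" "osc_bound \<alpha> F A1"
      unfolding F_def using bd[OF GB A0(1) _ A1(2)] G by (auto simp: BMO_L_def)
    have Gad: "admissible G" by (rule Campanato_admissible[OF G(1,2) A0(1) al(1)])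
    hence FE: "is_extension \<rho> T K G F" unfolding F_def by (rule ext_op_extension)
    have GL: "loc_Lp G" "loc_Lp (\<lambda>_. 1)" using Gad const_admissible[of 1] by (auto simp: admissible_def)
    define h where "h y = G y - of_real l" for y
    have hE: "is_extension \<rho> T K h (\<lambda>x. F x - of_real l * ?T1 x)"
      using is_extension_linear[OF GL(1) FE GL(2) T1_extension, of "of_real l"] by (simp add: h_def[abs_def])
    have hL: "loc_Lp h" unfolding h_def by (rule loc_Lp_diff_const[OF GL(1)])
    have hgr: "dyadic_growth \<theta> \<alpha> h x0 r (C2 * A0 * r powr \<alpha>)"
      unfolding dyadic_growth_def h_def using C2(2)[OF G(1,2) A0(1) r(1), of x0] by (simp add: avgG mult.assoc)
    have "C2 * A0 * r powr \<alpha> \<ge> 0" using C2 A0 by simp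
    then obtain c where c: "AE x in lebesgue. x \<in> ball x0 r \<longrightarrow>
        norm (F x - of_real l * ?T1 x - T (restr (ball x0 (2 * r)) h) x - c) \<le> C3 * (C2 * A0 * r powr \<alpha>)"
      using C3(2)[OF r(1,2) hL hE _ hgr] by blast
    have r0: "restr (ball x0 (2 * r)) h = (\<lambda>_. 0)"
      using Gl by (auto simp: restr_def h_def indicator_def)
    \<comment> \<open>on \<open>ball x0 r\<close>, the function \<open>l T1\<close> is within \<open>O(r powr \<alpha>)\<close> of \<open>F\<close> up to the constant \<open>k\<close>\<close>
    define a where "a = avg F x0 r"
    define k where "k = a - c"
    have ae: "AE y in lebesgue. y \<in> ball x0 r \<longrightarrow>
        norm (of_real l * ?T1 y - k) \<le> norm (of_real (norm (F y - a)) + of_real (E * r powr \<alpha>) :: complex)"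
      using c T_zero
    proof eventually_elim
      case (elim y)
      show ?case
      proof
        assume y: "y \<in> ball x0 r"
        have 1: "norm (F y - of_real l * ?T1 y - c) \<le> E * r powr \<alpha>"
          using elim y unfolding r0 by (simp add: E_def mult_ac)
        have 2: "of_real l * ?T1 y - k = (F y - a) - (F y - of_real l * ?T1 y - c)" by (simp add: k_def)
        have "norm (of_real l * ?T1 y - k) \<le> norm (F y - a) + E * r powr \<alpha>"
          unfolding 2 using norm_triangle_ineq4[of "F y - a" "F y - of_real l * ?T1 y - c"] 1 by linarith
        also have "\<dots> = norm (of_real (norm (F y - a) + E * r powr \<alpha>) :: complex)"
          using E by (simp only: norm_of_real) simp
        finally show "norm (of_real l * ?T1 y - k) \<le> norm (of_real (norm (F y - a)) + of_real (E * r powr \<alpha>) :: complex)"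
          by simp
      qed
    qed
    have Fm: "F \<in> borel_measurable lebesgue" by (rule loc_integrable_measurable[OF F(1)])
    have f1: "Lq_mean_le \<theta> (\<lambda>y. of_real (norm (F y - a))) x0 r (C1 * A1 * r powr \<alpha>)"
    proof (rule Lq_mean_le_bound[OF C1(2)[OF F A1(1) r(1), of x0] _ th(3)])
      have "(\<lambda>y. F y - a) \<in> borel_measurable lebesgue" using Fm by (intro borel_measurable_diff) auto
      hence "(\<lambda>y. norm (F y - a)) \<in> borel_measurable lebesgue" by (rule measurable_compose[OF _ borel_measurable_norm])
      thus "(\<lambda>y. of_real (norm (F y - a)) :: complex) \<in> borel_measurable lebesgue"
        by (rule borel_measurable_continuous_on[rotated]) (intro continuous_intros)
    qed (simp add: a_def)
    have f2: "Lq_mean_le \<theta> (\<lambda>y. of_real (E * r powr \<alpha>)) x0 r (E * r powr \<alpha>)"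
      using Lq_mean_le_const[of \<theta> "of_real (E * r powr \<alpha>)" x0 r] E by (simp only: norm_of_real) simp
    have f3: "Lq_mean_le \<theta> (\<lambda>y. of_real (norm (F y - a)) + of_real (E * r powr \<alpha>)) x0 r (Q * r powr \<alpha>)"
      using Lq_mean_le_add[OF f1 f2 th(2)] by (simp add: Q_def algebra_simps)
    have "(\<lambda>y. of_real l * ?T1 y - k) \<in> borel_measurable lebesgue"
      using T1m by (intro borel_measurable_diff borel_measurable_times) auto
    from Lq_mean_le_bound[OF f3 this th(3) ae]
    have "Lq_mean_le \<theta> (\<lambda>y. of_real l * ?T1 y - k) x0 r (Q * r powr \<alpha>)" .
    from Lq_mean_le_cmult[OF this, of "of_real (1 / l)"]
    have "Lq_mean_le \<theta> (\<lambda>y. ?T1 y - k / of_real l) x0 r (Q * r powr \<alpha> / l)"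
      using l by (simp add: right_diff_distrib norm_divide)
    from Lq_mean_le_center[OF this th(1) r(1)]
    have T: "Lq_mean_le \<theta> (\<lambda>y. ?T1 y - avg ?T1 x0 r) x0 r (8 * (Q * r powr \<alpha> / l))" .
    let ?M = "8 * (Q * r powr \<alpha> / l)" and ?W = "w (\<rho> x0 / r)"
    have W: "?W \<ge> 0" "?W \<le> cw * ?ds" using cw(2)[of m "\<rho> x0 / r"] m by auto
    have M0: "?M \<ge> 0" using Q l by simp
    have "avg (\<lambda>y. norm (?T1 y - avg ?T1 x0 r) powr \<theta>) x0 r \<le> ?M powr \<theta>"
      using T vol_ball_pos[OF r(1), of x0] by (simp add: Lq_mean_le_def avg_def field_simps)
    moreover have "avg (\<lambda>y. norm (?T1 y - avg ?T1 x0 r) powr \<theta>) x0 r \<ge> 0"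
      by (simp add: avg_def set_integral_nonneg)
    ultimately have "avg (\<lambda>y. norm (?T1 y - avg ?T1 x0 r) powr \<theta>) x0 r powr (1 / \<theta>) \<le> (?M powr \<theta>) powr (1 / \<theta>)"
      using th by (intro powr_mono2) auto
    also have "\<dots> = ?M" by (rule root[OF M0])
    finally have "?W * avg (\<lambda>y. norm (?T1 y - avg ?T1 x0 r) powr \<theta>) x0 r powr (1 / \<theta>) \<le> (cw * ?ds) * ?M"
      using W M0 cw ds by (intro mult_mono) auto
    also have "\<dots> = cw * (8 * Q) * ((r powr \<alpha> * ?ds) / l)" by simp
    also have "\<dots> \<le> cw * (8 * Q) * 1" using l cw Q by (intro mult_left_mono) auto
    finally show "in_Lp \<theta> (ball x0 r) (\<lambda>y. ?T1 y - avg ?T1 x0 r) \<and>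
      ?W * avg (\<lambda>y. norm (?T1 y - avg ?T1 x0 r) powr \<theta>) x0 r powr (1 / \<theta>) \<le> cw * (8 * Q)"
      using T by (simp add: Lq_mean_le_def)
  qed
qed

lemma Campanato_L_growth:
  assumes al: "\<alpha> \<ge> 0" and q: "q \<ge> 1"
  obtains C where "C > 0" "\<And>(f :: 'a \<Rightarrow> complex) A x R k. loc_integrable f \<Longrightarrow> osc_bound \<alpha> f A \<Longrightarrow> size_bound \<rho> \<alpha> f A \<Longrightarrow> A > 0 \<Longrightarrow> \<rho> x \<le> R \<Longrightarrow>
      Lq_mean_le q f x (2 ^ k * R) (C * A * R powr \<alpha> * ((real k + 1) * (2 powr \<alpha>) ^ k))"
proof -
  let ?\<kappa> = "scale_const DIM('a) \<alpha>"
  have \<kappa>: "?\<kappa> > 0" by (rule scale_const_pos)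
  obtain C2 where C2: "C2 > 0" "\<And>(f :: 'a \<Rightarrow> complex) A x r k. loc_integrable f \<Longrightarrow> osc_bound \<alpha> f A \<Longrightarrow> A > 0 \<Longrightarrow> r > 0 \<Longrightarrow>
      Lq_mean_le q (\<lambda>y. f y - avg f x r) x (2 ^ k * r) (C2 * A * r powr \<alpha> * (real k + 1) * (2 powr \<alpha>) ^ k)"
    using Campanato_growth[OF al q, where 'a='a] by auto
  show ?thesis
  proof (rule that[of "4 * (C2 + ?\<kappa>)"])
    show "4 * (C2 + ?\<kappa>) > 0" using C2 \<kappa> by simp
    fix f :: "'a \<Rightarrow> complex" and A x R and k :: nat
    assume f: "loc_integrable f" "osc_bound \<alpha> f A" "size_bound \<rho> \<alpha> f A" and A: "A > 0" and R: "\<rho> x \<le> R"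
    have R0: "R > 0" using R rho_pos[of x] by linarith
    let ?D = "(real k + 1) * (2 powr \<alpha>) ^ k"
    have D: "1 \<le> ?D"
    proof -
      have "1 * 1 \<le> ?D" using al by (intro mult_mono one_le_power) (auto simp: ge_one_powr_ge_zero)
      thus ?thesis by simp
    qed
    have "set_integrable lebesgue (ball x R) f" using f by (simp add: loc_integrable_def)
    from avg_dist_le[OF this R0, of 0]
    have "norm (avg f x R) * vol_ball x R \<le> (LINT y:ball x R|lebesgue. norm (f y))" by simp
    also have "\<dots> \<le> A * (?\<kappa> * R powr \<alpha>) * vol_ball x R" using f R R0 by (simp add: size_bound_iff)
    finally have "norm (avg f x R) \<le> A * (?\<kappa> * R powr \<alpha>) * 1" using vol_ball_pos[OF R0, of x] by simp
    also have "\<dots> \<le> A * (?\<kappa> * R powr \<alpha>) * ?D" using D A \<kappa> by (intro mult_left_mono) auto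
    finally have "Lq_mean_le q (\<lambda>y. avg f x R) x (2 ^ k * R) (A * (?\<kappa> * R powr \<alpha>) * ?D)"
      using q by (intro Lq_mean_le_mono[OF Lq_mean_le_const]) auto
    from Lq_mean_le_add[OF C2(2)[OF f(1,2) A R0] this q]
    show "Lq_mean_le q f x (2 ^ k * R) (4 * (C2 + ?\<kappa>) * A * R powr \<alpha> * ?D)" by (simp add: algebra_simps)
  qed
qed

text \<open>
  Sufficiency.  The weight in the condition cancels the growth of the means of \<open>f\<close> over small balls.
\<close>

lemma bounded_of_weighted_cond:
  assumes al: "\<alpha> \<ge> 0" "\<alpha> < \<gamma>" and w: "dyadic_weight \<alpha> w" and cond: "weighted_osc_cond \<rho> w \<theta> (T_ext (\<lambda>_. 1))"
  shows "\<exists>C>0. \<forall>f A. loc_integrable f \<longrightarrow> osc_bound \<alpha> f A \<longrightarrow> size_bound \<rho> \<alpha> f A \<longrightarrow> A > 0 \<longrightarrow>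
     loc_integrable (T_ext f) \<and> osc_bound \<alpha> (T_ext f) (C * A) \<and> size_bound \<rho> \<alpha> (T_ext f) (C * A)"
proof -
  have th: "\<theta> > 1" "\<theta> \<ge> 1" "\<theta> > 0" "p \<ge> 1" using theta p_gt_1 by auto
  let ?T1 = "T_ext (\<lambda>_. 1)"
  let ?\<kappa> = "scale_const DIM('a) \<alpha>"
  have \<kappa>: "?\<kappa> > 0" by (rule scale_const_pos)
  obtain C1 where C1: "\<And>x r. 0 < r \<and> r \<le> \<rho> x / 2 \<Longrightarrow> in_Lp \<theta> (ball x r) (\<lambda>y. ?T1 y - avg ?T1 x r) \<and>
     w (\<rho> x / r) * avg (\<lambda>y. norm (?T1 y - avg ?T1 x r) powr \<theta>) x r powr (1 / \<theta>) \<le> C1"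
    using cond unfolding weighted_osc_cond_def by blast
  obtain cw where cw: "cw > 0" "\<And>m t. m \<ge> 1 \<and> 2 ^ m \<le> t \<and> t < 2 ^ (m + 1) \<Longrightarrow>
      w t \<ge> 0 \<and> dyadic_sum \<alpha> m \<le> cw * w t \<and> w t \<le> cw * dyadic_sum \<alpha> m"
    using w unfolding dyadic_weight_def by blast
  obtain Gp where Gp: "Gp > 0" "\<And>(f :: 'a \<Rightarrow> complex) A x R k. loc_integrable f \<Longrightarrow> osc_bound \<alpha> f A \<Longrightarrow> size_bound \<rho> \<alpha> f A \<Longrightarrow> A > 0 \<Longrightarrow> \<rho> x \<le> R \<Longrightarrow>
      Lq_mean_le p f x (2 ^ k * R) (Gp * A * R powr \<alpha> * ((real k + 1) * (2 powr \<alpha>) ^ k))"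
    by (rule Campanato_L_growth[OF al(1) th(4)], rule that)
  obtain Gt where Gt: "Gt > 0" "\<And>(f :: 'a \<Rightarrow> complex) A x R k. loc_integrable f \<Longrightarrow> osc_bound \<alpha> f A \<Longrightarrow> size_bound \<rho> \<alpha> f A \<Longrightarrow> A > 0 \<Longrightarrow> \<rho> x \<le> R \<Longrightarrow>
      Lq_mean_le \<theta> f x (2 ^ k * R) (Gt * A * R powr \<alpha> * ((real k + 1) * (2 powr \<alpha>) ^ k))"
    by (rule Campanato_L_growth[OF al(1) th(2)], rule that)
  obtain C4 where C4: "C4 > 0" "\<And>h g x0 M. loc_Lp h \<Longrightarrow> is_extension \<rho> T K h g \<Longrightarrow> M \<ge> 0 \<Longrightarrow>
     Lq_mean_le p h x0 (3 * \<rho> x0) M \<Longrightarrow> dyadic_growth \<theta> \<alpha> h x0 (3 * \<rho> x0) M \<Longrightarrow>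
     set_integrable lebesgue (ball x0 (\<rho> x0)) g \<and> (LINT y:ball x0 (\<rho> x0)|lebesgue. norm (g y)) \<le> C4 * M * vol_ball x0 (\<rho> x0)"
    by (rule critical_ball_size[OF al(1)], rule that)
  obtain C5 where C5: "C5 > 0" "\<And>f A D F T1. loc_integrable f \<Longrightarrow> osc_bound \<alpha> f A \<Longrightarrow> A > 0 \<Longrightarrow> D \<ge> 0 \<Longrightarrow>
     is_extension \<rho> T K f F \<Longrightarrow> is_extension \<rho> T K (\<lambda>_. 1) T1 \<Longrightarrow>
     (\<forall>x r. 0 < r \<longrightarrow> r \<le> \<rho> x / 2 \<longrightarrow> set_integrable lebesgue (ball x r) T1 \<and>
        norm (avg f x r) * (LINT y:ball x r|lebesgue. norm (T1 y - avg T1 x r)) \<le> D * A * r powr \<alpha> * vol_ball x r) \<Longrightarrow>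
     (\<forall>x. set_integrable lebesgue (ball x (\<rho> x)) F \<and>
        (LINT y:ball x (\<rho> x)|lebesgue. norm (F y)) \<le> D * A * \<rho> x powr \<alpha> * vol_ball x (\<rho> x)) \<Longrightarrow>
     loc_integrable F \<and> osc_bound \<alpha> F (C5 * (D + 1) * A) \<and> size_bound \<rho> \<alpha> F (C5 * (D + 1) * A)"
    by (rule Campanato_bounds_of_local[OF al], rule that)
  define Ka where "Ka = (2 ^ DIM('a) + 1) * 2 powr \<alpha> * (2 + 2 powr \<alpha>) * ?\<kappa>"
  have Ka: "Ka > 0" using \<kappa> by (simp add: Ka_def add_pos_pos)
  define D1 where "D1 = Ka * cw * max C1 0"
  define D2 where "D2 = C4 * ((Gp + Gt) * 3 powr \<alpha>)"
  define D where "D = D1 + D2"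
  have D: "D1 \<ge> 0" "D2 \<ge> 0" "D \<ge> 0" using Ka cw C4 Gp Gt by (auto simp: D1_def D2_def D_def)
  show ?thesis
  proof (intro exI[of _ "C5 * (D + 1)"] conjI allI impI)
    show "C5 * (D + 1) > 0" using C5 D by simp
    fix f A assume f: "loc_integrable f" "osc_bound \<alpha> f A" "size_bound \<rho> \<alpha> f A" and A: "A > 0"
    have fad: "admissible f" by (rule Campanato_admissible[OF f(1,2) A al(1)])
    have fE: "is_extension \<rho> T K f (T_ext f)" by (rule ext_op_extension[OF fad])
    have small: "\<forall>x r. 0 < r \<longrightarrow> r \<le> \<rho> x / 2 \<longrightarrow> set_integrable lebesgue (ball x r) ?T1 \<and>
        norm (avg f x r) * (LINT y:ball x r|lebesgue. norm (?T1 y - avg ?T1 x r)) \<le> D * A * r powr \<alpha> * vol_ball x r"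
    proof (intro allI impI)
      fix x r assume r: "0 < r" "r \<le> \<rho> x / 2"
      let ?h = "\<lambda>y. ?T1 y - avg ?T1 x r" and ?W = "w (\<rho> x / r)"
      define v where "v = avg (\<lambda>y. norm (?h y) powr \<theta>) x r powr (1 / \<theta>)"
      have a0: "avg (\<lambda>y. norm (?h y) powr \<theta>) x r \<ge> 0" by (simp add: avg_def set_integral_nonneg)
      have L: "in_Lp \<theta> (ball x r) ?h" and Wv: "?W * v \<le> C1" using C1[of r x] r by (auto simp: v_def)
      have "v powr \<theta> = avg (\<lambda>y. norm (?h y) powr \<theta>) x r" using a0 th by (simp add: v_def powr_powr)
      hence "Lq_mean_le \<theta> ?h x r v"
        using L vol_ball_pos[OF r(1), of x] by (simp add: Lq_mean_le_def avg_def v_def)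
      note L1 = Lq_mean_le_L1[OF this th(1)]
      have "\<rho> x / r \<ge> 2" using r by (simp add: field_simps)
      then obtain m where m: "m \<ge> 1" "2 ^ m \<le> \<rho> x / r" "\<rho> x / r < 2 ^ (m + 1)" using dyadic_index by blast
      have W: "?W \<ge> 0" "dyadic_sum \<alpha> m \<le> cw * ?W" using cw(2)[of m "\<rho> x / r"] m by auto
      have "\<rho> x < 2 ^ (m + 1) * r" using m(3) r by (simp add: field_simps)
      hence "norm (avg f x r) \<le> Ka * A * r powr \<alpha> * dyadic_sum \<alpha> m"
        using Campanato_avg_small_ball[OF f A r(1) _ al(1), of x m] by (simp add: Ka_def)
      also have "\<dots> \<le> Ka * A * r powr \<alpha> * (cw * ?W)" using W Ka A by (intro mult_left_mono) auto
      finally have av: "norm (avg f x r) \<le> Ka * A * r powr \<alpha> * (cw * ?W)" .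
      have "set_integrable lebesgue (ball x r) (\<lambda>y. ?h y + avg ?T1 x r)" using L1(1) by (intro set_integral_add) auto
      hence i: "set_integrable lebesgue (ball x r) ?T1" by simp
      have "norm (avg f x r) * (LINT y:ball x r|lebesgue. norm (?h y)) \<le> (Ka * A * r powr \<alpha> * (cw * ?W)) * (v * vol_ball x r)"
        using av L1(2) by (intro mult_mono) (auto intro: order_trans[OF norm_ge_zero] set_integral_nonneg)
      also have "\<dots> = Ka * A * r powr \<alpha> * cw * vol_ball x r * (?W * v)" by simp
      also have "\<dots> \<le> Ka * A * r powr \<alpha> * cw * vol_ball x r * max C1 0"
        using Wv Ka A cw by (intro mult_left_mono) auto
      also have "\<dots> = D1 * (A * r powr \<alpha> * vol_ball x r)" by (simp add: D1_def)
      also have "\<dots> \<le> D * (A * r powr \<alpha> * vol_ball x r)" using D A by (intro mult_right_mono) (auto simp: D_def)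
      finally show "set_integrable lebesgue (ball x r) ?T1 \<and>
        norm (avg f x r) * (LINT y:ball x r|lebesgue. norm (?T1 y - avg ?T1 x r)) \<le> D * A * r powr \<alpha> * vol_ball x r"
        using i by (simp add: mult.assoc)
    qed
    have crit: "\<forall>x. set_integrable lebesgue (ball x (\<rho> x)) (T_ext f) \<and>
        (LINT y:ball x (\<rho> x)|lebesgue. norm (T_ext f y)) \<le> D * A * \<rho> x powr \<alpha> * vol_ball x (\<rho> x)"
    proof
      fix x
      let ?R = "3 * \<rho> x"
      have R: "\<rho> x \<le> ?R" using rho_pos[of x] by simp
      define M where "M = (Gp + Gt) * A * ?R powr \<alpha>"
      have M0: "M \<ge> 0" using Gp Gt A by (simp add: M_def)
      have le: "Gp * A * ?R powr \<alpha> \<le> M" "Gt * A * ?R powr \<alpha> \<le> M"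
        using Gp Gt A by (auto simp: M_def intro!: mult_right_mono)
      have "Lq_mean_le p f x (2 ^ 0 * ?R) (Gp * A * ?R powr \<alpha> * ((real 0 + 1) * (2 powr \<alpha>) ^ 0))"
        by (rule Gp(2)[OF f A R])
      hence mp: "Lq_mean_le p f x ?R M" using le th by (auto intro: Lq_mean_le_mono)
      have gr: "dyadic_growth \<theta> \<alpha> f x ?R M" unfolding dyadic_growth_def
      proof
        fix k show "Lq_mean_le \<theta> f x (2 ^ k * ?R) (M * ((real k + 1) * (2 powr \<alpha>) ^ k))"
          using le th by (intro Lq_mean_le_mono[OF Gt(2)[OF f A R]] mult_right_mono) auto
      qed
      have "loc_Lp f" using fad by (simp add: admissible_def)
      note c = C4(2)[OF this fE M0 mp gr]
      have "C4 * M * vol_ball x (\<rho> x) = D2 * (A * \<rho> x powr \<alpha> * vol_ball x (\<rho> x))"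
        by (simp add: M_def D2_def powr_mult)
      also have "\<dots> \<le> D * (A * \<rho> x powr \<alpha> * vol_ball x (\<rho> x))" using D A by (intro mult_right_mono) (auto simp: D_def)
      finally show "set_integrable lebesgue (ball x (\<rho> x)) (T_ext f) \<and>
        (LINT y:ball x (\<rho> x)|lebesgue. norm (T_ext f y)) \<le> D * A * \<rho> x powr \<alpha> * vol_ball x (\<rho> x)"
        using c by (simp add: mult.assoc)
    qed
    note C = C5(2)[OF f(1,2) A D(3) fE T1_extension small crit]
    show "loc_integrable (T_ext f)" "osc_bound \<alpha> (T_ext f) (C5 * (D + 1) * A)" "size_bound \<rho> \<alpha> (T_ext f) (C5 * (D + 1) * A)"
      using C by auto
  qed
qed

text \<open>
  When \<open>T1 = 0\<close>, a constant may be subtracted from \<open>f\<close> at no cost, and the estimates on critical balls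
  no longer involve the mean of \<open>f\<close>.
\<close>

lemma bounded_of_T1_zero:
  assumes al: "\<alpha> \<ge> 0" "\<alpha> < \<gamma>" and z: "AE x in lebesgue. T_ext (\<lambda>_. 1) x = 0"
  shows "\<exists>C>0. \<forall>f A. loc_integrable f \<longrightarrow> osc_bound \<alpha> f A \<longrightarrow> A > 0 \<longrightarrow>
     loc_integrable (T_ext f) \<and> osc_bound \<alpha> (T_ext f) (C * A) \<and> size_bound \<rho> \<alpha> (T_ext f) (C * A)"
proof -
  have th: "\<theta> > 1" "\<theta> \<ge> 1" "\<theta> > 0" "p \<ge> 1" using theta p_gt_1 by auto
  let ?T1 = "T_ext (\<lambda>_. 1)"
  obtain Gp where Gp: "Gp > 0" "\<And>(f :: 'a \<Rightarrow> complex) A x r k. loc_integrable f \<Longrightarrow> osc_bound \<alpha> f A \<Longrightarrow> A > 0 \<Longrightarrow> r > 0 \<Longrightarrow>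
      Lq_mean_le p (\<lambda>y. f y - avg f x r) x (2 ^ k * r) (Gp * A * r powr \<alpha> * (real k + 1) * (2 powr \<alpha>) ^ k)"
    using Campanato_growth[OF al(1) th(4), where 'a='a] by auto
  obtain Gt where Gt: "Gt > 0" "\<And>(f :: 'a \<Rightarrow> complex) A x r k. loc_integrable f \<Longrightarrow> osc_bound \<alpha> f A \<Longrightarrow> A > 0 \<Longrightarrow> r > 0 \<Longrightarrow>
      Lq_mean_le \<theta> (\<lambda>y. f y - avg f x r) x (2 ^ k * r) (Gt * A * r powr \<alpha> * (real k + 1) * (2 powr \<alpha>) ^ k)"
    using Campanato_growth[OF al(1) th(2), where 'a='a] by auto
  obtain C4 where C4: "C4 > 0" "\<And>h g x0 M. loc_Lp h \<Longrightarrow> is_extension \<rho> T K h g \<Longrightarrow> M \<ge> 0 \<Longrightarrow>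
     Lq_mean_le p h x0 (3 * \<rho> x0) M \<Longrightarrow> dyadic_growth \<theta> \<alpha> h x0 (3 * \<rho> x0) M \<Longrightarrow>
     set_integrable lebesgue (ball x0 (\<rho> x0)) g \<and> (LINT y:ball x0 (\<rho> x0)|lebesgue. norm (g y)) \<le> C4 * M * vol_ball x0 (\<rho> x0)"
    by (rule critical_ball_size[OF al(1)], rule that)
  obtain C5 where C5: "C5 > 0" "\<And>f A D F T1. loc_integrable f \<Longrightarrow> osc_bound \<alpha> f A \<Longrightarrow> A > 0 \<Longrightarrow> D \<ge> 0 \<Longrightarrow>
     is_extension \<rho> T K f F \<Longrightarrow> is_extension \<rho> T K (\<lambda>_. 1) T1 \<Longrightarrow>
     (\<forall>x r. 0 < r \<longrightarrow> r \<le> \<rho> x / 2 \<longrightarrow> set_integrable lebesgue (ball x r) T1 \<and>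
        norm (avg f x r) * (LINT y:ball x r|lebesgue. norm (T1 y - avg T1 x r)) \<le> D * A * r powr \<alpha> * vol_ball x r) \<Longrightarrow>
     (\<forall>x. set_integrable lebesgue (ball x (\<rho> x)) F \<and>
        (LINT y:ball x (\<rho> x)|lebesgue. norm (F y)) \<le> D * A * \<rho> x powr \<alpha> * vol_ball x (\<rho> x)) \<Longrightarrow>
     loc_integrable F \<and> osc_bound \<alpha> F (C5 * (D + 1) * A) \<and> size_bound \<rho> \<alpha> F (C5 * (D + 1) * A)"
    by (rule Campanato_bounds_of_local[OF al], rule that)
  define D where "D = C4 * ((Gp + Gt) * 3 powr \<alpha>)"
  have D: "D \<ge> 0" using C4 Gp Gt by (simp add: D_def)
  have L1: "loc_Lp (\<lambda>_. 1)" using const_admissible[of 1] by (simp add: admissible_def)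
  have T1m: "?T1 \<in> borel_measurable lebesgue" by (rule is_extension_measurable[OF L1 T1_extension])
  have T1s: "set_integrable lebesgue (ball x r) ?T1" "avg ?T1 x r = 0" "(LINT y:ball x r|lebesgue. norm (?T1 y)) = 0" for x r
  proof -
    have ae: "AE y in lebesgue. 0 = indicator (ball x r) y *\<^sub>R ?T1 y" "AE y in lebesgue. indicator (ball x r) y *\<^sub>R ?T1 y = 0"
      "AE y in lebesgue. indicator (ball x r) y *\<^sub>R norm (?T1 y) = 0"
      using z by (eventually_elim, simp)+
    have m: "(\<lambda>y. indicator (ball x r) y *\<^sub>R ?T1 y) \<in> borel_measurable lebesgue"
      using T1m by (intro borel_measurable_scaleR borel_measurable_indicator) auto
    show "set_integrable lebesgue (ball x r) ?T1"
      unfolding set_integrable_def using integrable_cong_AE[OF _ m ae(1)] by simp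
    have "(LINT y:ball x r|lebesgue. ?T1 y) = 0"
      unfolding set_lebesgue_integral_def by (rule integral_eq_zero_AE[OF ae(2)])
    thus "avg ?T1 x r = 0" by (simp add: avg_def)
    show "(LINT y:ball x r|lebesgue. norm (?T1 y)) = 0"
      unfolding set_lebesgue_integral_def by (rule integral_eq_zero_AE[OF ae(3)])
  qed
  show ?thesis
  proof (intro exI[of _ "C5 * (D + 1)"] conjI allI impI)
    show "C5 * (D + 1) > 0" using C5 D by simp
    fix f :: "'a \<Rightarrow> complex" and A
    assume f: "loc_integrable f" "osc_bound \<alpha> f A" and A: "A > 0"
    have fad: "admissible f" by (rule Campanato_admissible[OF f A al(1)])
    have fL: "loc_Lp f" using fad by (simp add: admissible_def)
    have fE: "is_extension \<rho> T K f (T_ext f)" by (rule ext_op_extension[OF fad])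
    have small: "\<forall>x r. 0 < r \<longrightarrow> r \<le> \<rho> x / 2 \<longrightarrow> set_integrable lebesgue (ball x r) ?T1 \<and>
        norm (avg f x r) * (LINT y:ball x r|lebesgue. norm (?T1 y - avg ?T1 x r)) \<le> D * A * r powr \<alpha> * vol_ball x r"
      using D A T1s by simp
    have crit: "\<forall>x. set_integrable lebesgue (ball x (\<rho> x)) (T_ext f) \<and>
        (LINT y:ball x (\<rho> x)|lebesgue. norm (T_ext f y)) \<le> D * A * \<rho> x powr \<alpha> * vol_ball x (\<rho> x)"
    proof
      fix x
      let ?R = "3 * \<rho> x"
      have R: "?R > 0" using rho_pos[of x] by simp
      define c where "c = avg f x ?R"
      define h where "h y = f y - c" for y
      define g where "g y = T_ext f y - c * ?T1 y" for y
      have hE: "is_extension \<rho> T K h g"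
        using is_extension_linear[OF fL fE L1 T1_extension, of c] by (simp add: h_def[abs_def] g_def[abs_def])
      have hL: "loc_Lp h" unfolding h_def by (rule loc_Lp_diff_const[OF fL])
      define M where "M = (Gp + Gt) * A * ?R powr \<alpha>"
      have M0: "M \<ge> 0" using Gp Gt A by (simp add: M_def)
      have le: "Gp * A * ?R powr \<alpha> \<le> M" "Gt * A * ?R powr \<alpha> \<le> M"
        using Gp Gt A by (auto simp: M_def intro!: mult_right_mono)
      have "Lq_mean_le p h x (2 ^ 0 * ?R) (Gp * A * ?R powr \<alpha> * (real 0 + 1) * (2 powr \<alpha>) ^ 0)"
        unfolding h_def c_def by (rule Gp(2)[OF f A R])
      hence mp: "Lq_mean_le p h x ?R M" using le th by (auto intro: Lq_mean_le_mono)
      have gr: "dyadic_growth \<theta> \<alpha> h x ?R M" unfolding dyadic_growth_def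
      proof
        fix k
        have "Lq_mean_le \<theta> h x (2 ^ k * ?R) (Gt * A * ?R powr \<alpha> * ((real k + 1) * (2 powr \<alpha>) ^ k))"
          unfolding h_def c_def using Gt(2)[OF f A R, of x k] by (simp only: mult.assoc)
        thus "Lq_mean_le \<theta> h x (2 ^ k * ?R) (M * ((real k + 1) * (2 powr \<alpha>) ^ k))"
          by (rule Lq_mean_le_mono) (use le th in \<open>auto intro!: mult_right_mono\<close>)
      qed
      note C = C4(2)[OF hL hE M0 mp gr]
      have "AE y in lebesgue. y \<in> ball x (\<rho> x) \<longrightarrow> norm (T_ext f y - 0) \<le> norm (g y) + 0"
        using z by eventually_elim (simp add: g_def)
      note S = set_integrable_of_AE_bound[OF conjunct1[OF C] is_extension_measurable[OF fL fE] rho_pos order_refl this]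
      have "(LINT y:ball x (\<rho> x)|lebesgue. norm (T_ext f y)) \<le> C4 * M * vol_ball x (\<rho> x)"
        using S(2) C by simp
      also have "\<dots> = D * A * \<rho> x powr \<alpha> * vol_ball x (\<rho> x)" by (simp add: M_def D_def powr_mult)
      finally show "set_integrable lebesgue (ball x (\<rho> x)) (T_ext f) \<and>
        (LINT y:ball x (\<rho> x)|lebesgue. norm (T_ext f y)) \<le> D * A * \<rho> x powr \<alpha> * vol_ball x (\<rho> x)"
        using S(1) by blast
    qed
    note C = C5(2)[OF f A D fE T1_extension small crit]
    show "loc_integrable (T_ext f)" "osc_bound \<alpha> (T_ext f) (C5 * (D + 1) * A)" "size_bound \<rho> \<alpha> (T_ext f) (C5 * (D + 1) * A)"
      using C by auto
  qed
qed

lemma zero_of_size_bounds: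
  assumes g: "loc_integrable g" and b: "\<And>\<epsilon>. \<epsilon> > 0 \<Longrightarrow> size_bound \<rho> \<alpha> g \<epsilon>"
  shows "AE x in lebesgue. g x = 0"
proof -
  let ?\<kappa> = "scale_const DIM('a) \<alpha>"
  have loc: "AE y in lebesgue. y \<in> ball x (\<rho> x) \<longrightarrow> g y = 0" for x
  proof -
    let ?I = "LINT y:ball x (\<rho> x)|lebesgue. norm (g y)"
    define P where "P = ?\<kappa> * \<rho> x powr \<alpha> * vol_ball x (\<rho> x)"
    have le: "?I \<le> \<epsilon> * P" if "\<epsilon> > 0" for \<epsilon>
      using b[OF that] rho_pos[of x] by (simp add: size_bound_iff P_def mult.assoc)
    have P: "P > 0"
      using scale_const_pos rho_pos[of x] vol_ball_pos[OF rho_pos, of x x] by (simp add: P_def)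
    have "?I \<le> 0"
    proof (rule field_le_epsilon)
      fix e :: real assume "e > 0"
      thus "?I \<le> 0 + e" using le[of "e / P"] P by simp
    qed
    hence I: "?I = 0" using set_integral_nonneg[of "ball x (\<rho> x)" "\<lambda>y. norm (g y)" lebesgue] by simp
    have i: "integrable lebesgue (\<lambda>y. indicator (ball x (\<rho> x)) y *\<^sub>R norm (g y))"
      using set_integrable_norm[of lebesgue "ball x (\<rho> x)" g] g by (simp add: loc_integrable_def set_integrable_def)
    have "AE y in lebesgue. indicator (ball x (\<rho> x)) y *\<^sub>R norm (g y) = 0"
      using I i by (subst integral_nonneg_eq_0_iff_AE[symmetric]) (auto simp: set_lebesgue_integral_def)
    thus ?thesis by eventually_elim (auto simp: indicator_def)
  qed
  obtain X where X: "countable X" "\<And>x. \<exists>z\<in>X. x \<in> ball z (\<rho> z)" using countable_critical_cover by blast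
  have "AE y in lebesgue. \<forall>x\<in>X. y \<in> ball x (\<rho> x) \<longrightarrow> g y = 0"
    unfolding AE_ball_countable[OF X(1)] using loc by blast
  thus ?thesis by eventually_elim (use X(2) in blast)
qed

text \<open>With \<open>w = ln\<close> this is the case \<open>\<alpha> = 0\<close>, and with a power weight the case \<open>\<alpha> > 0\<close>.\<close>

theorem bounded_BMO_L_iff:
  assumes al: "\<alpha> \<ge> 0" "\<alpha> < \<gamma>" and w: "dyadic_weight \<alpha> w"
  shows "bounded_op (BMO_L \<rho> \<alpha>) (BMO_L_norm \<rho> \<alpha>) (BMO_L \<rho> \<alpha>) (BMO_L_norm \<rho> \<alpha>) T_ext
     \<longleftrightarrow> weighted_osc_cond \<rho> w \<theta> (T_ext (\<lambda>_. 1))"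
proof
  assume b: "bounded_op (BMO_L \<rho> \<alpha>) (BMO_L_norm \<rho> \<alpha>) (BMO_L \<rho> \<alpha>) (BMO_L_norm \<rho> \<alpha>) T_ext"
  obtain C0 where "C0 \<ge> 0" "\<And>f A B. f \<in> BMO_L \<rho> \<alpha> \<Longrightarrow> A > 0 \<Longrightarrow> osc_bound \<alpha> f A \<and> size_bound \<rho> \<alpha> f A \<Longrightarrow> B > C0 * A \<Longrightarrow>
      T_ext f \<in> BMO_L \<rho> \<alpha> \<and> (osc_bound \<alpha> (T_ext f) B \<and> size_bound \<rho> \<alpha> (T_ext f) B)"
  proof (rule bounded_op_InfE[OF b[unfolded BMO_L_norm_Inf]])
    show "\<exists>A>0. osc_bound \<alpha> g A \<and> size_bound \<rho> \<alpha> g A" if "g \<in> BMO_L \<rho> \<alpha>" for g using that by (simp add: BMO_L_def)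
    show "osc_bound \<alpha> g B \<and> size_bound \<rho> \<alpha> g B" if "osc_bound \<alpha> g A \<and> size_bound \<rho> \<alpha> g A" "A \<le> B" for g A B
      using that osc_bound_mono size_bound_mono by blast
  qed (rule that)
  thus "weighted_osc_cond \<rho> w \<theta> (T_ext (\<lambda>_. 1))" by (rule weighted_cond_of_bounded[OF al w])
next
  assume c: "weighted_osc_cond \<rho> w \<theta> (T_ext (\<lambda>_. 1))"
  obtain C where C: "C > 0" "\<forall>f A. loc_integrable f \<longrightarrow> osc_bound \<alpha> f A \<longrightarrow> size_bound \<rho> \<alpha> f A \<longrightarrow> A > 0 \<longrightarrow>
     loc_integrable (T_ext f) \<and> osc_bound \<alpha> (T_ext f) (C * A) \<and> size_bound \<rho> \<alpha> (T_ext f) (C * A)"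
    using bounded_of_weighted_cond[OF al w c] by blast
  show "bounded_op (BMO_L \<rho> \<alpha>) (BMO_L_norm \<rho> \<alpha>) (BMO_L \<rho> \<alpha>) (BMO_L_norm \<rho> \<alpha>) T_ext"
    unfolding BMO_L_norm_Inf
  proof (rule bounded_op_InfI)
    show "\<exists>A>0. osc_bound \<alpha> f A \<and> size_bound \<rho> \<alpha> f A" if "f \<in> BMO_L \<rho> \<alpha>" for f using that by (simp add: BMO_L_def)
    show "C > 0" by (rule C)
    fix f A assume f: "f \<in> BMO_L \<rho> \<alpha>" "A > 0" "osc_bound \<alpha> f A \<and> size_bound \<rho> \<alpha> f A"
    have "loc_integrable (T_ext f) \<and> osc_bound \<alpha> (T_ext f) (C * A) \<and> size_bound \<rho> \<alpha> (T_ext f) (C * A)"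
      using C(2) f by (auto simp: BMO_L_def)
    moreover have "C * A > 0" using C f by simp
    ultimately show "T_ext f \<in> BMO_L \<rho> \<alpha> \<and> (osc_bound \<alpha> (T_ext f) (C * A) \<and> size_bound \<rho> \<alpha> (T_ext f) (C * A))"
      unfolding BMO_L_def by blast
  qed
qed

text \<open>
  Constants have arbitrarily small admissible bounds in \<open>BMO\<^sup>\<alpha>\<close>, hence so has \<open>T1\<close> in \<open>BMO\<^sub>L\<^sup>\<alpha>\<close>, where only
  functions vanishing almost everywhere have this property.
\<close>

theorem bounded_BMO_BMO_L_iff:
  assumes al: "\<alpha> \<ge> 0" "\<alpha> < \<gamma>"
  shows "bounded_op (BMO \<alpha>) (BMO_norm \<alpha>) (BMO_L \<rho> \<alpha>) (BMO_L_norm \<rho> \<alpha>) T_ext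
     \<longleftrightarrow> (AE x in lebesgue. T_ext (\<lambda>_. 1) x = 0)"
proof
  assume b: "bounded_op (BMO \<alpha>) (BMO_norm \<alpha>) (BMO_L \<rho> \<alpha>) (BMO_L_norm \<rho> \<alpha>) T_ext"
  obtain C0 where C0: "C0 \<ge> 0" "\<And>f A B. f \<in> BMO \<alpha> \<Longrightarrow> A > 0 \<Longrightarrow> osc_bound \<alpha> f A \<Longrightarrow> B > C0 * A \<Longrightarrow>
      T_ext f \<in> BMO_L \<rho> \<alpha> \<and> (osc_bound \<alpha> (T_ext f) B \<and> size_bound \<rho> \<alpha> (T_ext f) B)"
  proof (rule bounded_op_InfE[OF b[unfolded BMO_L_norm_Inf BMO_norm_Inf]])
    show "\<exists>A>0. osc_bound \<alpha> g A \<and> size_bound \<rho> \<alpha> g A" if "g \<in> BMO_L \<rho> \<alpha>" for g using that by (simp add: BMO_L_def)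
    show "osc_bound \<alpha> g B \<and> size_bound \<rho> \<alpha> g B" if "osc_bound \<alpha> g A \<and> size_bound \<rho> \<alpha> g A" "A \<le> B" for g A B
      using that osc_bound_mono size_bound_mono by blast
  qed (rule that)
  have all: "T_ext (\<lambda>_. 1) \<in> BMO_L \<rho> \<alpha> \<and> size_bound \<rho> \<alpha> (T_ext (\<lambda>_. 1)) \<epsilon>" if e: "\<epsilon> > 0" for \<epsilon>
  proof -
    define A where "A = \<epsilon> / (C0 + 1)"
    have A: "A > 0" using e C0(1) by (simp add: A_def)
    have "C0 * A < \<epsilon>" using e C0(1) by (simp add: A_def field_simps)
    thus ?thesis using C0(2)[OF const_in_BMO A osc_bound_mono[OF osc_bound_const]] A by simp
  qed
  have "loc_integrable (T_ext (\<lambda>_. 1))" using all[of 1] by (simp add: BMO_L_def)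
  moreover have "\<And>\<epsilon>. \<epsilon> > 0 \<Longrightarrow> size_bound \<rho> \<alpha> (T_ext (\<lambda>_. 1)) \<epsilon>" using all by blast
  ultimately show "AE x in lebesgue. T_ext (\<lambda>_. 1) x = 0" by (rule zero_of_size_bounds)
next
  assume z: "AE x in lebesgue. T_ext (\<lambda>_. 1) x = 0"
  obtain C where C: "C > 0" "\<forall>f A. loc_integrable f \<longrightarrow> osc_bound \<alpha> f A \<longrightarrow> A > 0 \<longrightarrow>
     loc_integrable (T_ext f) \<and> osc_bound \<alpha> (T_ext f) (C * A) \<and> size_bound \<rho> \<alpha> (T_ext f) (C * A)"
    using bounded_of_T1_zero[OF al z] by blast
  show "bounded_op (BMO \<alpha>) (BMO_norm \<alpha>) (BMO_L \<rho> \<alpha>) (BMO_L_norm \<rho> \<alpha>) T_ext"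
    unfolding BMO_L_norm_Inf BMO_norm_Inf
  proof (rule bounded_op_InfI)
    show "\<exists>A>0. osc_bound \<alpha> f A" if "f \<in> BMO \<alpha>" for f using that by (simp add: BMO_def)
    show "C > 0" by (rule C)
    fix f :: "'a \<Rightarrow> complex" and A assume f: "f \<in> BMO \<alpha>" "A > 0" "osc_bound \<alpha> f A"
    have "loc_integrable (T_ext f) \<and> osc_bound \<alpha> (T_ext f) (C * A) \<and> size_bound \<rho> \<alpha> (T_ext f) (C * A)"
      using C(2) f by (auto simp: BMO_def)
    moreover have "C * A > 0" using C f by simp
    ultimately show "T_ext f \<in> BMO_L \<rho> \<alpha> \<and> (osc_bound \<alpha> (T_ext f) (C * A) \<and> size_bound \<rho> \<alpha> (T_ext f) (C * A))"
      unfolding BMO_L_def by blast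
  qed
qed

end

theorem theorem1p4:
  fixes V :: "'a::euclidean_space \<Rightarrow> real"
    and \<sigma> :: ereal and \<gamma> \<theta> \<theta>' :: real
    and T :: "('a \<Rightarrow> complex) \<Rightarrow> 'a \<Rightarrow> complex"
    and K :: "'a \<Rightarrow> 'a \<Rightarrow> complex"
  defines "\<rho> \<equiv> crit_radius V"
  assumes "DIM('a) \<ge> 3"
    and "ereal (real DIM('a) / 2) \<le> \<sigma>"
    and "reverse_Holder \<sigma> V"
    and "\<not> (AE x in lebesgue. V x = 0)"
    and "1 < \<theta>" and "1 / \<theta> + 1 / \<theta>' = 1"
    and "0 < \<gamma>" and "ereal \<gamma> < 2 - ereal (real DIM('a)) / \<sigma>"
    and "GCZO_star \<rho> \<gamma> \<theta>' T K"
  shows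
    "(bounded_op (BMO_L \<rho> 0) (BMO_L_norm \<rho> 0) (BMO_L \<rho> 0) (BMO_L_norm \<rho> 0) (ext_op \<rho> T K)
        \<longleftrightarrow> weighted_osc_cond \<rho> ln \<theta> (ext_op \<rho> T K (\<lambda>_. 1)))
     \<and> (\<forall>\<alpha>. 0 < \<alpha> \<and> \<alpha> < \<gamma> \<longrightarrow>
        (bounded_op (BMO_L \<rho> \<alpha>) (BMO_L_norm \<rho> \<alpha>) (BMO_L \<rho> \<alpha>) (BMO_L_norm \<rho> \<alpha>) (ext_op \<rho> T K)
        \<longleftrightarrow> weighted_osc_cond \<rho> (\<lambda>t. t powr \<alpha>) \<theta> (ext_op \<rho> T K (\<lambda>_. 1))))
     \<and> (\<forall>\<alpha>. 0 < \<alpha> \<and> \<alpha> < \<gamma> \<longrightarrow>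
        (bounded_op (BMO \<alpha>) (BMO_norm \<alpha>) (BMO_L \<rho> \<alpha>) (BMO_L_norm \<rho> \<alpha>) (ext_op \<rho> T K)
        \<longleftrightarrow> (AE x in lebesgue. ext_op \<rho> T K (\<lambda>_. 1) x = 0)))"
proof -
  have pos: "\<rho> x > 0" for x
    unfolding \<rho>_def by (rule crit_radius_pos[OF assms(2,4,5,8,9)])
  have slow: "\<exists>c>0. \<forall>x y. dist x y \<le> A * \<rho> x \<longrightarrow> c * \<rho> x \<le> \<rho> y" if "A \<ge> 0" for A
    unfolding \<rho>_def by (rule crit_radius_slow[OF assms(2,4,5,8,9) that])
  interpret critical_operator \<rho> \<gamma> \<theta>' \<theta> T K
    by unfold_locales (use pos slow assms(6,7,10) in \<open>auto simp: add.commute\<close>)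
  show ?thesis
    using bounded_BMO_L_iff[of 0 ln] bounded_BMO_L_iff bounded_BMO_BMO_L_iff
      dyadic_weight_ln dyadic_weight_powr gamma_pos
    by (auto simp: less_imp_le)
qed

end
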